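(* Let $\mathbf p=(p_k)_{k\ge0}$ be a probability distribution on $\{0,1,2,\dots\}$ with mean $1$ and finite variance $\sigma^2>0$, and let $\Lambda_n$ be the distance profile of a conditioned Galton--Watson tree of order $n$ with offspring distribution $\mathbf p$. (i) Let $r\ge1$ be a real number. Then, for all integers $i,n\ge1$, $$\mathbb E[\Lambda_n(i)^r]\le C_r\,n^{3r/2}e^{-ci^2/n}.$$ (ii) Let $r\ge1$ be an integer, and suppose that $\sum_k k^{1+r}p_k<\infty$. Then, for all integers $i,n\ge1$, $$\mathbb E[\Lambda_n(i)^r]\le C_r\,i^rn^r.$$ Furthermore, in this case, for all integers $i,n\ge1$, $$\mathbb E[\Lambda_n(i)^r]\le C_r\,i^rn^re^{-ci^2/n}.$$ Here $c>0$ denotes constants that depend on $\mathbf p$ only, and $C_r$ denotes finite constants that depend on $\mathbf p$ and $r$ only; they may differ between the three inequalities.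
   Context: The Galton--Watson tree with offspring distribution $\mathbf p$ is the random ordered rooted family tree in which every vertex independently has a number of children with distribution $\mathbf p$; the conditioned Galton--Watson tree of order $n$ is this tree conditioned on having exactly $n$ vertices. Only those $n$ for which this event has positive probability are considered. For a finite tree $T$ with graph distance $\mathsf d$, the distance profile at an integer $i$ is $\Lambda_T(i):=|\{(v,w)\in T\times T:\mathsf d(v,w)=i\}|$ (ordered pairs, $v=w$ included). *)

theory Defs
  imports "HOL-Probability.Probability"
begin

text \<open>
  Vertices of an ordered rooted tree are Ulam--Harris words: the root is the empty word and the
  children of a vertex \<open>u\<close> with \<open>d\<close> children are \<open>u @ [0], \<dots>, u @ [d - 1]\<close>. The tree may be infinite.
\<close>

inductive_set family_tree :: "(nat list \<Rightarrow> nat) \<Rightarrow> nat list set"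
  for \<xi> :: "nat list \<Rightarrow> nat"
where
  root: "[] \<in> family_tree \<xi>"
| child: "u \<in> family_tree \<xi> \<Longrightarrow> j < \<xi> u \<Longrightarrow> u @ [j] \<in> family_tree \<xi>"

definition tree_edges :: "nat list set \<Rightarrow> nat list rel" where
  "tree_edges T = {(u, v). u \<in> T \<and> v \<in> T \<and> (\<exists>j. v = u @ [j] \<or> u = v @ [j])}"

text \<open>
  Length of a shortest path, for a symmetric edge relation; only meaningful for vertices in the
  same connected component.
\<close>

definition graph_dist :: "'a rel \<Rightarrow> 'a \<Rightarrow> 'a \<Rightarrow> nat" where
  "graph_dist E v w = (LEAST k. (v, w) \<in> E ^^ k)"

definition distance_profile :: "nat list set \<Rightarrow> nat \<Rightarrow> nat" where
  "distance_profile T i = card {(v, w) \<in> T \<times> T. graph_dist (tree_edges T) v w = i}"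

text \<open>
  The Galton--Watson tree is the random variable \<^const>\<open>family_tree\<close> on the following space of i.i.d.
  offspring numbers, indexed by all potential vertices.
\<close>

definition gw_space :: "nat pmf \<Rightarrow> (nat list \<Rightarrow> nat) measure" where
  "gw_space p = (\<Pi>\<^sub>M u\<in>UNIV. measure_pmf p)"

text \<open>
  Since an infinite set has \<^const>\<open>card\<close> 0, for \<open>n \<ge> 1\<close> this is the event that the tree is finite
  with exactly \<open>n\<close> vertices.
\<close>

definition gw_size_event :: "nat pmf \<Rightarrow> nat \<Rightarrow> (nat list \<Rightarrow> nat) set" where
  "gw_size_event p n = {\<xi> \<in> space (gw_space p). card (family_tree \<xi>) = n}"

definition conditioned_gw :: "nat pmf \<Rightarrow> nat \<Rightarrow> (nat list \<Rightarrow> nat) measure" where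
  "conditioned_gw p n = uniform_measure (gw_space p) (gw_size_event p n)"

definition gw_admissible :: "nat pmf \<Rightarrow> nat \<Rightarrow> bool" where
  "gw_admissible p n \<longleftrightarrow> measure (gw_space p) (gw_size_event p n) > 0"

end

theory Submission
  imports Defs "HOL-Computational_Algebra.Formal_Power_Series" "HOL-Real_Asymp.Real_Asymp"
begin

text \<open>
  Let \<open>Q\<^sub>v\<close> be the number of vertices at distance \<open>i\<close> from \<open>v\<close>. One of two vertices at distance \<open>i\<close>
  has height at least \<open>i / 2\<close>, so by convexity it suffices to bound, for each \<open>h \<ge> i / 2\<close>, the
  expectation of \<open>\<Sum> Q\<^sub>v ^ r\<close> over the vertices \<open>v\<close> of height \<open>h\<close>, on the event that the tree has \<open>n\<close>
  vertices. This sum counts tuples of vertices; cutting out the Steiner tree that they span with the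
  root leaves a forest of \<open>N\<close> independent Galton--Watson trees of total size \<open>m\<close>. By the Otter--Dwass
  formula, concentration and a Chernoff bound, such a forest has probability at most
  \<open>C / m * exp (- c * N\<^sup>2 / m)\<close>. As the Steiner tree has at most \<open>h + r * i\<close> inner vertices,
  which one may take to be at most \<open>n / 2\<close>, this allows one to replace each tree of the forest by a
  factor \<open>y = 1 - x\<close>, with \<open>x\<close> of order \<open>1 / sqrt n + h / n\<close>, at the cost of a factor \<open>1 / n\<close>.
  The resulting weighted count is a generating function of level sizes at a number
  slightly inside its disc of convergence, where iterating the offspring generating function is a
  contraction. It remains to divide by the probability that the tree has \<open>n\<close> vertices, which
  a local limit theorem bounds from below by a multiple of \<open>n powr (- 3 / 2)\<close>.
\<close>

unbundle no vec_syntax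
unbundle fps_syntax

section \<open>Plane trees and forests\<close>

text \<open>A finite variance gives the offspring generating function only two derivatives at 1,
  while an \<open>r\<close>-th moment asks for \<open>r + 1\<close>. Moving to \<open>1 - x\<close>
  provides them all: each moment costs a factor of order \<open>1 / x\<close>, and leaving the
  boundary costs \<open>exp (K * x\<^sup>2 * n)\<close>, because a critical generating function
  differs from the identity to second order only. In return each vertex of the spine contributes a
  derivative taken at distance of order \<open>x\<close> below 1, so that a spine of length
  \<open>h\<close> gains \<open>exp (- c * x * h)\<close>. With \<open>x\<close> of order
  \<open>h / n\<close> the exponentials combine to \<open>exp (- c * h\<^sup>2 / n)\<close>, and
  keeping \<open>x\<close> above a multiple of \<open>1 / sqrt n\<close> keeps the moments of order
  \<open>sqrt n ^ r\<close>. With \<open>r + 1\<close> moments the derivatives at 1 are finite, and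
  \<open>1 / x\<close> is replaced by \<open>i\<close>. Plain evaluation at such a point would lose
  the factor \<open>1 / n\<close>, which the lower bound \<open>n powr (- 3 / 2)\<close> makes
  indispensable. That factor is available only while the Steiner tree is small; hence the series are
  not evaluated but kept as expansions with controlled degrees, truncated at the order of the
  moment.\<close>

datatype ptree = Node "ptree list"

fun num_verts :: "ptree \<Rightarrow> nat" where
  "num_verts (Node ts) = Suc (sum_list (map num_verts ts))"

lemma num_verts_pos: "num_verts t > 0"
  by (cases t) auto

definition forests :: "nat \<Rightarrow> nat \<Rightarrow> ptree list set" where
  "forests d n = {ts. length ts = d \<and> sum_list (map num_verts ts) = n}"

definition trees :: "nat \<Rightarrow> ptree set" where
  "trees n = {t. num_verts t = n}"

lemma trees_0 [simp]: "trees 0 = {}"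
  using num_verts_pos by (auto simp: trees_def)

lemma length_le_sum_num_verts: "length ts \<le> sum_list (map num_verts ts)"
proof (induction ts)
  case (Cons t ts)
  then show ?case using num_verts_pos[of t] by simp
qed simp

lemma trees_Suc: "trees (Suc n) = Node ` (\<Union>d\<le>n. forests d n)"
proof (intro set_eqI iffI)
  fix t assume "t \<in> trees (Suc n)"
  then obtain ts where "t = Node ts" "sum_list (map num_verts ts) = n"
    by (cases t) (auto simp: trees_def)
  then show "t \<in> Node ` (\<Union>d\<le>n. forests d n)"
    using length_le_sum_num_verts[of ts] by (auto simp: forests_def)
qed (auto simp: trees_def forests_def)

lemma forests_0: "forests 0 n = (if n = 0 then {[]} else {})"
  by (auto simp: forests_def)

lemma forests_Suc:
  "forests (Suc d) n = (\<lambda>(t, ts). t # ts) ` (\<Union>k\<le>n. trees k \<times> forests d (n - k))"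
proof (intro set_eqI iffI)
  fix ts assume "ts \<in> forests (Suc d) n"
  then show "ts \<in> (\<lambda>(t, ts). t # ts) ` (\<Union>k\<le>n. trees k \<times> forests d (n - k))"
    by (cases ts) (auto simp: forests_def trees_def image_iff intro!: bexI[of _ "num_verts (hd ts)"])
qed (auto simp: forests_def trees_def)

lemma finite_forests_aux:
  assumes "\<And>k. k \<le> n \<Longrightarrow> finite (trees k)"
  shows "finite (forests d n)"
  using assms
proof (induction d arbitrary: n)
  case (Suc d)
  then show ?case by (auto simp: forests_Suc)
qed (auto simp: forests_0)

lemma finite_trees [simp]: "finite (trees n)"
proof (induction n rule: less_induct)
  case (less n)
  show ?case
  proof (cases n)
    case (Suc m)
    then show ?thesis using less finite_forests_aux[of m] by (auto simp: trees_Suc)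
  qed auto
qed

lemma finite_forests [simp]: "finite (forests d n)"
  by (rule finite_forests_aux) simp

section \<open>Generating functions by size, with and without a marked subtree\<close>

definition tree_gf :: "(ptree \<Rightarrow> 'a::comm_monoid_add) \<Rightarrow> 'a fps" where
  "tree_gf e = Abs_fps (\<lambda>n. \<Sum>t\<in>trees n. e t)"

lemma tree_gf_nth_0 [simp]: "tree_gf e $ 0 = 0"
  by (simp add: tree_gf_def)

lemma sum_forests_Suc:
  fixes g :: "ptree list \<Rightarrow> 'a::comm_monoid_add"
  shows "(\<Sum>ts\<in>forests (Suc d) n. g ts)
    = (\<Sum>k\<le>n. \<Sum>t\<in>trees k. \<Sum>ts\<in>forests d (n - k). g (t # ts))"
proof -
  have "(\<Sum>ts\<in>forests (Suc d) n. g ts)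
      = (\<Sum>(t, ts)\<in>(\<Union>k\<le>n. trees k \<times> forests d (n - k)). g (t # ts))"
    unfolding forests_Suc
    by (subst sum.reindex) (auto simp: inj_on_def case_prod_unfold)
  also have "\<dots> = (\<Sum>k\<le>n. \<Sum>(t, ts)\<in>trees k \<times> forests d (n - k). g (t # ts))"
    by (rule sum.UNION_disjoint) (simp_all, auto simp: trees_def)
  also have "\<dots> = (\<Sum>k\<le>n. \<Sum>t\<in>trees k. \<Sum>ts\<in>forests d (n - k). g (t # ts))"
    by (simp add: sum.cartesian_product)
  finally show ?thesis .
qed

lemma sum_trees_Suc:
  fixes g :: "ptree \<Rightarrow> 'a::comm_monoid_add"
  shows "(\<Sum>t\<in>trees (Suc n). g t) = (\<Sum>d\<le>n. \<Sum>ts\<in>forests d n. g (Node ts))"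
  unfolding trees_Suc
  by (subst sum.reindex, simp add: inj_on_def, unfold o_def, rule sum.UNION_disjoint)
     (simp_all, auto simp: forests_def)

lemma sum_forests_prod:
  fixes e :: "ptree \<Rightarrow> 'a::comm_semiring_1"
  shows "(\<Sum>ts\<in>forests d n. prod_list (map e ts)) = (tree_gf e ^ d) $ n"
proof (induction d arbitrary: n)
  case 0
  then show ?case by (simp add: forests_0)
next
  case (Suc d)
  then show ?case
    by (simp add: sum_forests_Suc fps_mult_nth tree_gf_def sum_distrib_left[symmetric]
      sum_distrib_right[symmetric] atLeast0AtMost)
qed

text \<open>The marked tree will be the one that contains the end of the spine; \<open>k\<close> is
  its weight and \<open>e\<close> that of its siblings.\<close>

definition one_marked ::
    "(ptree \<Rightarrow> 'a::comm_semiring_1) \<Rightarrow> (ptree \<Rightarrow> 'a) \<Rightarrow> ptree list \<Rightarrow> 'a" where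
  "one_marked k e ts = (\<Sum>j<length ts. k (ts ! j) * (\<Prod>l\<in>{..<length ts} - {j}. e (ts ! l)))"

lemma prod_nth_conv_prod_list:
  fixes e :: "'b \<Rightarrow> 'a::comm_monoid_mult"
  shows "(\<Prod>l<length ts. e (ts ! l)) = prod_list (map e ts)"
  by (simp add: prod.list_conv_set_nth atLeast0LessThan)

lemma one_marked_Cons:
  "one_marked k e (t # ts) = k t * prod_list (map e ts) + e t * one_marked k e ts"
proof -
  have 1: "{..<length (t # ts)} - {0} = Suc ` {..<length ts}"
    by (auto simp: image_iff less_Suc_eq_0_disj)
  have 2: "{..<length (t # ts)} - {Suc j} = insert 0 (Suc ` ({..<length ts} - {j}))" for j
    by (auto simp: image_iff less_Suc_eq_0_disj)
  have "one_marked k e (t # ts) = k t * (\<Prod>l\<in>{..<length (t # ts)} - {0}. e ((t # ts) ! l))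
     + (\<Sum>j<length ts. k (ts ! j) * (\<Prod>l\<in>{..<length (t # ts)} - {Suc j}. e ((t # ts) ! l)))"
    unfolding one_marked_def length_Cons sum.lessThan_Suc_shift nth_Cons_0 nth_Cons_Suc ..
  also have "(\<Prod>l\<in>{..<length (t # ts)} - {0}. e ((t # ts) ! l)) = prod_list (map e ts)"
    unfolding 1 by (simp add: prod.reindex prod_nth_conv_prod_list)
  also have "(\<Sum>j<length ts. k (ts ! j) * (\<Prod>l\<in>{..<length (t # ts)} - {Suc j}. e ((t # ts) ! l)))
      = e t * one_marked k e ts"
    unfolding 2 one_marked_def sum_distrib_left
    by (intro sum.cong refl) (simp add: prod.reindex mult_ac)
  finally show ?thesis .
qed

text \<open>After summation the position of the marked tree no longer matters, so the
  \<open>Suc d\<close> positions contribute equally.\<close>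

lemma sum_forests_one_marked:
  fixes e k :: "ptree \<Rightarrow> 'a::comm_semiring_1"
  shows "(\<Sum>ts\<in>forests (Suc d) n. one_marked k e ts)
    = (of_nat (Suc d) * (tree_gf k * tree_gf e ^ d)) $ n"
proof (induction d arbitrary: n)
  case 0
  have "(\<Sum>t\<in>trees k. \<Sum>ts\<in>forests 0 (n - k). one_marked k' e (t # ts))
      = (if k = n then \<Sum>t\<in>trees n. k' t else 0)" if "k \<le> n" for k k'
    using that by (auto simp: forests_0 one_marked_Cons one_marked_def)
  then show ?case
    by (simp add: sum_forests_Suc tree_gf_def)
next
  case (Suc d)
  have "(\<Sum>ts\<in>forests (Suc (Suc d)) n. one_marked k e ts)
     = (\<Sum>j\<le>n. \<Sum>t\<in>trees j. \<Sum>ts\<in>forests (Suc d) (n - j). k t * prod_list (map e ts))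
     + (\<Sum>j\<le>n. \<Sum>t\<in>trees j. \<Sum>ts\<in>forests (Suc d) (n - j). e t * one_marked k e ts)"
    by (subst sum_forests_Suc) (simp add: one_marked_Cons sum.distrib)
  also have "(\<Sum>j\<le>n. \<Sum>t\<in>trees j. \<Sum>ts\<in>forests (Suc d) (n - j). k t * prod_list (map e ts))
     = (tree_gf k * tree_gf e ^ Suc d) $ n"
    unfolding fps_mult_nth sum_distrib_left[symmetric] sum_forests_prod sum_distrib_right[symmetric]
    by (simp add: tree_gf_def atLeast0AtMost)
  also have "(\<Sum>j\<le>n. \<Sum>t\<in>trees j. \<Sum>ts\<in>forests (Suc d) (n - j). e t * one_marked k e ts)
     = (tree_gf e * (of_nat (Suc d) * (tree_gf k * tree_gf e ^ d))) $ n"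
    unfolding fps_mult_nth[of "tree_gf e"] sum_distrib_left[symmetric] Suc.IH sum_distrib_right[symmetric]
    by (simp add: tree_gf_def atLeast0AtMost)
  also have "(tree_gf k * tree_gf e ^ Suc d) $ n
      + (tree_gf e * (of_nat (Suc d) * (tree_gf k * tree_gf e ^ d))) $ n
     = (of_nat (Suc (Suc d)) * (tree_gf k * tree_gf e ^ Suc d)) $ n"
    unfolding fps_add_nth[symmetric]
    by (rule arg_cong[where f = "\<lambda>F. F $ n"]) (simp add: algebra_simps)
  finally show ?case .
qed

text \<open>Removing the root leaves a forest. The weights \<open>e\<close> and \<open>e'\<close>
  differ in the application to level sizes, where a level of the tree is the preceding level of the
  subtrees.\<close>

lemma tree_gf_rec:
  fixes e e' :: "ptree \<Rightarrow> 'a::comm_semiring_1"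
  assumes "\<And>ts. e (Node ts) = c (length ts) * prod_list (map e' ts)"
  shows "tree_gf e = fps_X * (Abs_fps c oo tree_gf e')"
proof (rule fps_ext)
  fix n show "tree_gf e $ n = (fps_X * (Abs_fps c oo tree_gf e')) $ n"
  proof (cases n)
    case (Suc m)
    have "tree_gf e $ Suc m = (\<Sum>d\<le>m. \<Sum>ts\<in>forests d m. e (Node ts))"
      by (simp add: tree_gf_def sum_trees_Suc)
    also have "\<dots> = (\<Sum>d\<le>m. c d * (\<Sum>ts\<in>forests d m. prod_list (map e' ts)))"
      unfolding sum_distrib_left
      by (intro sum.cong refl) (auto simp: assms forests_def)
    also have "\<dots> = (\<Sum>d\<le>m. c d * (tree_gf e' ^ d) $ m)"
      by (simp add: sum_forests_prod)
    finally show ?thesis using Suc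
      by (simp add: fps_compose_nth atLeast0AtMost)
  qed simp
qed

text \<open>Choosing the child to be marked produces the coefficients of a derivative; this is the
  origin of size-biasing along the spine.\<close>

lemma tree_gf_rec_marked:
  fixes e e' k :: "ptree \<Rightarrow> 'a::comm_semiring_1"
  assumes "\<And>ts. e (Node ts) = c (length ts) * one_marked k e' ts"
  shows "tree_gf e $ Suc n
    = (\<Sum>d\<le>n. of_nat (Suc d) * c (Suc d) * (tree_gf k * tree_gf e' ^ d) $ n)"
proof -
  have "tree_gf e $ Suc n = (\<Sum>d\<le>n. \<Sum>ts\<in>forests d n. e (Node ts))"
    by (simp add: tree_gf_def sum_trees_Suc)
  also have "\<dots> = (\<Sum>d\<le>n. c d * (\<Sum>ts\<in>forests d n. one_marked k e' ts))"
    unfolding sum_distrib_left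
    by (intro sum.cong refl) (auto simp: assms forests_def)
  \<comment> \<open>The added term is empty, since \<open>Suc n\<close> trees have more than
    \<open>n\<close> vertices; it allows the sum to be shifted by one.\<close>
  also have "\<dots> = (\<Sum>d\<le>Suc n. c d * (\<Sum>ts\<in>forests d n. one_marked k e' ts))"
  proof -
    have "forests (Suc n) n = {}"
      using length_le_sum_num_verts by (auto simp: forests_def) (metis length_le_sum_num_verts not_less_eq_eq order_refl)
    then show ?thesis by simp
  qed
  also have "\<dots> = (\<Sum>d\<le>n. c (Suc d) * (\<Sum>ts\<in>forests (Suc d) n. one_marked k e' ts))"
    by (subst sum.atMost_Suc_shift) (simp add: forests_0 one_marked_def)
  also have "\<dots> = (\<Sum>d\<le>n. of_nat (Suc d) * c (Suc d) * (tree_gf k * tree_gf e' ^ d) $ n)"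
    by (intro sum.cong refl)
      (simp only: sum_forests_one_marked fps_of_nat[symmetric] fps_mult_left_const_nth,
       simp only: mult_ac)
  finally show ?thesis .
qed

lemma size_nth_less [termination_simp]:
  "x < length ts \<Longrightarrow> size (ts ! x) < Suc (size_list size ts)"
  by (simp add: less_Suc_eq_le size_list_estimation'[OF nth_mem])

section \<open>Vertices as words, and the link with \<open>family_tree\<close>\<close>

fun verts :: "ptree \<Rightarrow> nat list set" where
  "verts (Node ts) = insert [] (\<Union>j<length ts. (#) j ` verts (ts ! j))"

declare verts.simps [simp del]

lemma Nil_in_verts [simp]: "[] \<in> verts t"
  by (cases t) (simp add: verts.simps)

lemma Cons_in_verts [simp]:
  "j # v \<in> verts (Node ts) \<longleftrightarrow> j < length ts \<and> v \<in> verts (ts ! j)"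
  by (auto simp: verts.simps)

lemma finite_verts [simp]: "finite (verts t)"
proof (induction t)
  case (Node ts)
  then show ?case by (auto simp: verts.simps)
qed

lemma sum_verts:
  fixes g :: "nat list \<Rightarrow> 'a::comm_monoid_add"
  shows "(\<Sum>v\<in>verts (Node ts). g v) = g [] + (\<Sum>j<length ts. \<Sum>v\<in>verts (ts ! j). g (j # v))"
proof -
  have "(\<Sum>v\<in>verts (Node ts). g v) = g [] + (\<Sum>v\<in>(\<Union>j<length ts. (#) j ` verts (ts ! j)). g v)"
    unfolding verts.simps by (subst sum.insert) auto
  also have "(\<Sum>v\<in>(\<Union>j<length ts. (#) j ` verts (ts ! j)). g v)
      = (\<Sum>j<length ts. \<Sum>v\<in>(#) j ` verts (ts ! j). g v)"
    by (rule sum.UNION_disjoint) auto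
  also have "\<dots> = (\<Sum>j<length ts. \<Sum>v\<in>verts (ts ! j). g (j # v))"
    by (simp add: sum.reindex o_def)
  finally show ?thesis .
qed

lemma card_verts: "card (verts t) = num_verts t"
proof (induction t)
  case (Node ts)
  have "card (verts (Node ts)) = 1 + (\<Sum>j<length ts. card (verts (ts ! j)))"
    using sum_verts[of "\<lambda>_. 1::nat" ts] by simp
  also have "(\<Sum>j<length ts. card (verts (ts ! j))) = (\<Sum>j<length ts. num_verts (ts ! j))"
    using Node by simp
  finally show ?case by (simp add: sum_list_sum_nth atLeast0LessThan)
qed

lemma verts_prefix_closed: "u @ w \<in> verts t \<Longrightarrow> u \<in> verts t"
proof (induction u arbitrary: t)
  case (Cons a u)
  then show ?case by (cases t) auto
qed simp

lemma length_less_num_verts: "v \<in> verts t \<Longrightarrow> length v < num_verts t"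
proof (induction v arbitrary: t)
  case Nil then show ?case by (simp add: num_verts_pos)
next
  case (Cons j v)
  then obtain ts where t: "t = Node ts" "j < length ts" "v \<in> verts (ts ! j)" by (cases t) auto
  then have "length v < num_verts (ts ! j)" using Cons by auto
  also have "\<dots> \<le> sum_list (map num_verts ts)"
    using t(2) by (intro member_le_sum_list) auto
  finally show ?case by (simp add: t(1))
qed

fun outdeg :: "ptree \<Rightarrow> nat list \<Rightarrow> nat" where
  "outdeg (Node ts) [] = length ts"
| "outdeg (Node ts) (j # v) = (if j < length ts then outdeg (ts ! j) v else 0)"

text \<open>\<open>family_tree\<close> grows words at their end, whereas \<open>verts\<close>
  recurses at the root. Shifting the offspring numbers converts the first kind of recursion into the
  second.\<close>

lemma family_tree_Cons:
  "j # v \<in> family_tree \<xi> \<longleftrightarrow> j < \<xi> [] \<and> v \<in> family_tree (\<lambda>u. \<xi> (j # u))"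
proof
  have "w \<in> family_tree \<xi> \<Longrightarrow> w = j # v \<Longrightarrow> j < \<xi> [] \<and> v \<in> family_tree (\<lambda>u. \<xi> (j # u))" for w
  proof (induction arbitrary: j v rule: family_tree.induct)
    case (child u k)
    show ?case
    proof (cases u)
      case Nil
      then show ?thesis using child by (auto intro: family_tree.root)
    next
      case (Cons a w)
      then show ?thesis using child by (auto intro: family_tree.child)
    qed
  qed simp
  then show "j # v \<in> family_tree \<xi> \<Longrightarrow> j < \<xi> [] \<and> v \<in> family_tree (\<lambda>u. \<xi> (j # u))" by blast
next
  have "j < \<xi> [] \<Longrightarrow> v \<in> family_tree (\<lambda>u. \<xi> (j # u)) \<Longrightarrow> j # v \<in> family_tree \<xi>"
  proof (rotate_tac, induction rule: family_tree.induct)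
    case root
    then show ?case using family_tree.child[OF family_tree.root] by fastforce
  next
    case (child u k)
    then show ?case using family_tree.child[of "j # u" \<xi> k] by simp
  qed
  then show "j < \<xi> [] \<and> v \<in> family_tree (\<lambda>u. \<xi> (j # u)) \<Longrightarrow> j # v \<in> family_tree \<xi>" by blast
qed

lemma Nil_in_family_tree [simp]: "[] \<in> family_tree \<xi>"
  by (rule family_tree.root)

text \<open>This makes the occurrence of a given finite tree a cylinder event, which involves
  finitely many independent offspring numbers.\<close>

lemma family_tree_eq_verts_iff:
  "family_tree \<xi> = verts t \<longleftrightarrow> (\<forall>u\<in>verts t. \<xi> u = outdeg t u)"
proof (induction t arbitrary: \<xi>)
  case (Node ts)
  have 1: "(family_tree \<xi> = verts (Node ts)) \<longleftrightarrow>
     (\<forall>j. {v. j # v \<in> family_tree \<xi>} = {v. j # v \<in> verts (Node ts)})"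
    (is "?L \<longleftrightarrow> ?R")
  proof
    assume R: ?R
    have "w \<in> family_tree \<xi> \<longleftrightarrow> w \<in> verts (Node ts)" for w
      using R by (cases w) (auto simp: set_eq_iff)
    then show ?L by blast
  qed auto
  have 2: "{v. j # v \<in> family_tree \<xi>} = {v. j # v \<in> verts (Node ts)} \<longleftrightarrow>
     (j < \<xi> [] \<longleftrightarrow> j < length ts) \<and> (j < length ts \<longrightarrow> family_tree (\<lambda>u. \<xi> (j # u)) = verts (ts ! j))" for j
    unfolding set_eq_iff mem_Collect_eq family_tree_Cons Cons_in_verts
    using Nil_in_family_tree Nil_in_verts by blast
  have 3: "(\<forall>j. j < \<xi> [] \<longleftrightarrow> j < length ts) \<longleftrightarrow> \<xi> [] = length ts"
    by (metis less_irrefl linorder_neqE_nat)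
  have 4: "(\<forall>u\<in>verts (Node ts). \<xi> u = outdeg (Node ts) u) \<longleftrightarrow>
     \<xi> [] = length ts \<and> (\<forall>j<length ts. \<forall>u\<in>verts (ts ! j). \<xi> (j # u) = outdeg (ts ! j) u)"
    by (auto simp: verts.simps)
  have 5: "family_tree (\<lambda>u. \<xi> (j # u)) = verts (ts ! j) \<longleftrightarrow>
      (\<forall>u\<in>verts (ts ! j). \<xi> (j # u) = outdeg (ts ! j) u)" if "j < length ts" for j
    by (rule Node) (use that in simp)
  show ?case unfolding 1 2 4 all_conj_distrib 3 using 5 by auto
qed

lemma verts_inject: "verts t = verts t' \<Longrightarrow> t = t'"
proof (induction t arbitrary: t')
  case (Node ts)
  obtain ts' where t': "t' = Node ts'" by (cases t')
  have *: "j < length ts \<and> v \<in> verts (ts ! j) \<longleftrightarrow> j < length ts' \<and> v \<in> verts (ts' ! j)" for j v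
    using Node.prems unfolding t' Cons_in_verts[symmetric] by simp
  have len: "length ts = length ts'"
    using *[of _ "[]"] by (metis Nil_in_verts linorder_neqE_nat nat_neq_iff)
  have "ts ! j = ts' ! j" if "j < length ts" for j
    using Node.IH[of "ts ! j" "ts' ! j"] that * len by auto
  then show ?case using len t' by (auto intro: nth_equalityI)
qed

text \<open>Induction on the number of vertices: the subtree at a child of the root embeds into the
  tree without its root.\<close>

lemma finite_family_tree_is_verts:
  assumes "finite (family_tree \<xi>)"
  shows "\<exists>t. family_tree \<xi> = verts t"
  using assms
proof (induction "card (family_tree \<xi>)" arbitrary: \<xi> rule: less_induct)
  case less
  let ?F = "\<lambda>j. family_tree (\<lambda>u. \<xi> (j # u))"
  have "\<exists>t. ?F j = verts t" if "j < \<xi> []" for j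
  proof (rule less.hyps)
    have sub: "(#) j ` ?F j \<subseteq> family_tree \<xi> - {[]}"
      using that by (auto simp: family_tree_Cons)
    have "card ((#) j ` ?F j) \<le> card (family_tree \<xi> - {[]})"
      using sub less.prems by (intro card_mono) auto
    also have "\<dots> < card (family_tree \<xi>)"
      by (rule card_Diff1_less[OF less.prems Nil_in_family_tree])
    finally show "card (?F j) < card (family_tree \<xi>)"
      by (simp add: card_image)
    show "finite (?F j)"
      by (rule finite_imageD[OF finite_subset[OF sub finite_Diff[OF less.prems]]]) simp
  qed
  then obtain f where f: "\<And>j. j < \<xi> [] \<Longrightarrow> ?F j = verts (f j)" by metis
  have "w \<in> family_tree \<xi> \<longleftrightarrow> w \<in> verts (Node (map f [0..<\<xi> []]))" for w
    using f by (cases w) (auto simp: family_tree_Cons)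
  then show ?case by blast
qed

section \<open>Graph distance in a tree as a distance of words\<close>

fun wdist :: "'a list \<Rightarrow> 'a list \<Rightarrow> nat" where
  "wdist [] w = length w"
| "wdist v [] = length v"
| "wdist (a # v) (b # w) = (if a = b then wdist v w else length v + length w + 2)"

lemma wdist_Nil2 [simp]: "wdist v [] = length v"
  by (cases v) auto

lemma wdist_sym: "wdist v w = wdist w v"
  by (induction v w rule: wdist.induct) auto

lemma wdist_le: "wdist v w \<le> length v + length w"
  by (induction v w rule: wdist.induct) auto

lemma wdist_refl [simp]: "wdist v v = 0"
  by (induction v) auto

text \<open>An edge of the tree changes \<open>wdist\<close> by at most one; hence
  \<open>wdist\<close> is a lower bound for the length of any walk.\<close>

lemma wdist_snoc: "wdist v (w @ [j]) \<le> wdist v w + 1 \<and> wdist v w \<le> wdist v (w @ [j]) + 1"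
  by (induction v w rule: wdist.induct) auto

lemma wdist_edge:
  assumes "(w, w') \<in> tree_edges T"
  shows "wdist v w' \<le> wdist v w + 1"
proof -
  obtain j where "w' = w @ [j] \<or> w = w' @ [j]"
    using assms by (auto simp: tree_edges_def)
  then show ?thesis using wdist_snoc[of v w j] wdist_snoc[of v w' j] by auto
qed

lemma wdist_le_walk:
  "(v, w) \<in> tree_edges T ^^ k \<Longrightarrow> wdist v w \<le> k"
proof (induction k arbitrary: w)
  case (Suc k)
  then obtain u where "(v, u) \<in> tree_edges T ^^ k" "(u, w) \<in> tree_edges T" by auto
  then show ?case using Suc.IH[of u] wdist_edge[of u w T v] by simp
qed simp

lemma tree_edges_sym: "(v, w) \<in> tree_edges T \<longleftrightarrow> (w, v) \<in> tree_edges T"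
  by (auto simp: tree_edges_def)

lemma walk_sym: "(v, w) \<in> tree_edges T ^^ k \<longleftrightarrow> (w, v) \<in> tree_edges T ^^ k"
proof (induction k arbitrary: v w)
  case (Suc k)
  have "(v, w) \<in> tree_edges T ^^ Suc k \<longleftrightarrow> (\<exists>u. (v, u) \<in> tree_edges T ^^ k \<and> (u, w) \<in> tree_edges T)"
    by auto
  also have "\<dots> \<longleftrightarrow> (\<exists>u. (w, u) \<in> tree_edges T \<and> (u, v) \<in> tree_edges T ^^ k)"
    using Suc tree_edges_sym by blast
  also have "\<dots> \<longleftrightarrow> (w, v) \<in> tree_edges T ^^ Suc k"
    by (meson relpow_Suc_D2 relpow_Suc_I2)
  finally show ?case .
qed auto

lemma walk_up:
  assumes "\<And>u w. u @ w \<in> T \<Longrightarrow> u \<in> T" "x @ v \<in> T"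
  shows "(x, x @ v) \<in> tree_edges T ^^ length v"
  using assms(2)
proof (induction v rule: rev_induct)
  case (snoc j v)
  have "x @ v \<in> T" using snoc.prems assms(1)[of "x @ v" "[j]"] by simp
  then have "(x @ v, x @ v @ [j]) \<in> tree_edges T"
    using snoc.prems by (auto simp: tree_edges_def)
  then show ?case using snoc.IH[OF \<open>x @ v \<in> T\<close>] by auto
qed simp

text \<open>The bound is attained by climbing to the longest common prefix and descending again;
  \<open>x\<close> accumulates the prefix that has been stripped. Prefix-closedness keeps the walk
  inside \<open>T\<close>.\<close>

lemma walk_wdist:
  assumes T: "\<And>u w. u @ w \<in> T \<Longrightarrow> u \<in> T" and "x @ v \<in> T" "x @ w \<in> T"
  shows "(x @ v, x @ w) \<in> tree_edges T ^^ wdist v w"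
  using assms(2,3)
proof (induction v w arbitrary: x rule: wdist.induct)
  case (1 w)
  then show ?case using T walk_up[of T x w] by simp
next
  case (2 a v)
  then have "(x, x @ a # v) \<in> tree_edges T ^^ Suc (length v)"
    using T walk_up[of T x "a # v"] by simp
  then have "(x @ a # v, x) \<in> tree_edges T ^^ Suc (length v)"
    by (rule walk_sym[THEN iffD1])
  then show ?case by simp
next
  case (3 a v b w)
  show ?case
  proof (cases "a = b")
    case True
    then show ?thesis using 3(1)[of "x @ [a]"] 3(2,3) by simp
  next
    case False
    have "(x, x @ a # v) \<in> tree_edges T ^^ Suc (length v)"
      using T walk_up[of T x "a # v"] 3(2) by simp
    then have 1: "(x @ a # v, x) \<in> tree_edges T ^^ Suc (length v)"
      by (rule walk_sym[THEN iffD1])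
    have 2: "(x, x @ b # w) \<in> tree_edges T ^^ Suc (length w)"
      using T walk_up[of T x "b # w"] 3(3) by simp
    have "(x @ a # v, x @ b # w) \<in> tree_edges T ^^ (Suc (length v) + Suc (length w))"
      unfolding relpow_add using 1 2 by blast
    then show ?thesis using False by simp
  qed
qed

lemma graph_dist_eq_wdist:
  assumes "\<And>u w. u @ w \<in> T \<Longrightarrow> u \<in> T" "v \<in> T" "w \<in> T"
  shows "graph_dist (tree_edges T) v w = wdist v w"
  unfolding graph_dist_def
  using walk_wdist[of T "[]" v w] assms wdist_le_walk
  by (intro Least_equality) auto

section \<open>Level sizes and numbers of vertices at a given distance\<close>

definition level_size :: "nat \<Rightarrow> ptree \<Rightarrow> nat" where
  "level_size j t = card {v \<in> verts t. length v = j}"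

definition at_dist :: "nat \<Rightarrow> ptree \<Rightarrow> nat list \<Rightarrow> nat" where
  "at_dist i t v = card {w \<in> verts t. wdist v w = i}"

lemma distance_profile_eq:
  "distance_profile (verts t) i = (\<Sum>v\<in>verts t. at_dist i t v)"
proof -
  have "distance_profile (verts t) i = card (SIGMA v:verts t. {w \<in> verts t. wdist v w = i})"
    unfolding distance_profile_def
    by (intro arg_cong[where f = card])
      (auto simp: graph_dist_eq_wdist[OF verts_prefix_closed])
  then show ?thesis by (simp add: at_dist_def)
qed

text \<open>At least one of two vertices at distance \<open>i\<close> has height at least \<open>i / 2\<close>.\<close>

lemma distance_profile_le:
  "distance_profile (verts t) i \<le> 2 * (\<Sum>v | v \<in> verts t \<and> i \<le> 2 * length v. at_dist i t v)"
proof -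
  let ?H = "{v \<in> verts t. i \<le> 2 * length v}"
  let ?A = "SIGMA v:?H. {w \<in> verts t. wdist v w = i}"
  have "distance_profile (verts t) i = card (SIGMA v:verts t. {w \<in> verts t. wdist v w = i})"
    by (simp add: distance_profile_eq at_dist_def)
  also have "\<dots> \<le> card (?A \<union> prod.swap ` ?A)"
  proof (rule card_mono)
    show "(SIGMA v:verts t. {w \<in> verts t. wdist v w = i}) \<subseteq> ?A \<union> prod.swap ` ?A"
    proof
      fix x assume "x \<in> (SIGMA v:verts t. {w \<in> verts t. wdist v w = i})"
      then obtain v w where x: "x = (v, w)" "v \<in> verts t" "w \<in> verts t" "wdist v w = i" by auto
      have "i \<le> 2 * length v \<or> i \<le> 2 * length w" using wdist_le[of v w] x by linarith
      then show "x \<in> ?A \<union> prod.swap ` ?A"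
      proof
        assume "i \<le> 2 * length w"
        then have "(w, v) \<in> ?A" using x by (auto simp: wdist_sym)
        then have "prod.swap (w, v) \<in> prod.swap ` ?A" by blast
        then show ?thesis using x by simp
      qed (use x in auto)
    qed
  qed auto
  also have "\<dots> \<le> card ?A + card (prod.swap ` ?A)" by (rule card_Un_le)
  also have "\<dots> \<le> 2 * card ?A" using card_image_le[of ?A prod.swap] by simp
  finally show ?thesis by (simp add: at_dist_def)
qed

lemma level_size_0: "level_size 0 t = 1"
proof -
  have "{v \<in> verts t. length v = 0} = {[]}" by auto
  then show ?thesis unfolding level_size_def by simp
qed

lemma level_size_alt: "level_size j t = (\<Sum>v\<in>verts t. if length v = j then 1 else 0)"
  by (simp add: level_size_def sum.inter_filter[symmetric])

lemma level_size_Suc: "level_size (Suc j) (Node ts) = sum_list (map (level_size j) ts)"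
  by (simp add: level_size_alt sum_verts sum_list_sum_nth atLeast0LessThan)

lemma at_dist_alt: "at_dist i t v = (\<Sum>w\<in>verts t. if wdist v w = i then 1 else 0)"
  by (simp add: at_dist_def sum.inter_filter[symmetric])

lemma at_dist_Nil: "at_dist i t [] = level_size i t"
  by (simp add: at_dist_def level_size_def)

text \<open>The three terms are the root, the subtree that contains \<open>v\<close>, and the
  sibling subtrees, whose vertices are reached through the root by \<open>length v + 2\<close> edges
  and a descent. The test \<open>i < length v + 2\<close> guards the truncated subtraction.\<close>

lemma at_dist_Cons:
  assumes "j < length ts"
  shows "at_dist i (Node ts) (j # v) = (if i = Suc (length v) then 1 else 0)
    + at_dist i (ts ! j) v
    + (\<Sum>l\<in>{..<length ts} - {j}. if i < length v + 2 then 0 else level_size (i - length v - 2) (ts ! l))"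
proof -
  have "at_dist i (Node ts) (j # v) = (if i = Suc (length v) then 1 else 0)
    + (\<Sum>l<length ts. \<Sum>w\<in>verts (ts ! l). if wdist (j # v) (l # w) = i then 1 else 0)"
    by (simp add: at_dist_alt sum_verts)
  also have "(\<Sum>l<length ts. \<Sum>w\<in>verts (ts ! l). if wdist (j # v) (l # w) = i then 1 else 0)
     = at_dist i (ts ! j) v + (\<Sum>l\<in>{..<length ts} - {j}. \<Sum>w\<in>verts (ts ! l). if wdist (j # v) (l # w) = i then 1 else 0)"
    using assms by (subst sum.remove[of _ j]) (auto simp: at_dist_alt)
  also have "(\<Sum>l\<in>{..<length ts} - {j}. \<Sum>w\<in>verts (ts ! l). if wdist (j # v) (l # w) = i then 1 else (0::nat))
     = (\<Sum>l\<in>{..<length ts} - {j}. if i < length v + 2 then 0 else level_size (i - length v - 2) (ts ! l))"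
  proof (intro sum.cong refl)
    fix l assume "l \<in> {..<length ts} - {j}"
    then have "(wdist (j # v) (l # w) = i) = (\<not> i < length v + 2 \<and> length w = i - length v - 2)" for w
      by auto
    then show "(\<Sum>w\<in>verts (ts ! l). if wdist (j # v) (l # w) = i then 1 else (0::nat))
      = (if i < length v + 2 then 0 else level_size (i - length v - 2) (ts ! l))"
      by (simp add: level_size_alt)
  qed
  finally show ?thesis by simp
qed

section \<open>The law of the Galton--Watson tree and its conditioning on the size\<close>

fun tree_wt :: "(nat \<Rightarrow> 'a::comm_semiring_1) \<Rightarrow> ptree \<Rightarrow> 'a" where
  "tree_wt w (Node ts) = w (length ts) * prod_list (map (tree_wt w) ts)"

lemma prod_verts_outdeg: "(\<Prod>u\<in>verts t. w (outdeg t u)) = tree_wt w t"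
proof (induction t)
  case (Node ts)
  have "(\<Prod>u\<in>verts (Node ts). w (outdeg (Node ts) u))
      = w (length ts) * (\<Prod>u\<in>(\<Union>j<length ts. (#) j ` verts (ts ! j)). w (outdeg (Node ts) u))"
    unfolding verts.simps by (subst prod.insert) auto
  also have "(\<Prod>u\<in>(\<Union>j<length ts. (#) j ` verts (ts ! j)). w (outdeg (Node ts) u))
      = (\<Prod>j<length ts. \<Prod>u\<in>(#) j ` verts (ts ! j). w (outdeg (Node ts) u))"
    by (rule prod.UNION_disjoint) auto
  also have "\<dots> = (\<Prod>j<length ts. tree_wt w (ts ! j))"
    using Node by (intro prod.cong refl) (simp add: prod.reindex o_def)
  finally show ?case by (simp add: prod_nth_conv_prod_list)
qed

lemma tree_wt_nonneg: "(\<And>d. 0 \<le> w d) \<Longrightarrow> 0 \<le> tree_wt (w :: nat \<Rightarrow> real) t"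
  unfolding prod_verts_outdeg[symmetric] by (simp add: prod_nonneg)

definition tree_event :: "ptree \<Rightarrow> (nat list \<Rightarrow> nat) set" where
  "tree_event t = {\<xi>. family_tree \<xi> = verts t}"

lemma space_gw_space [simp]: "space (gw_space p) = UNIV"
  by (simp add: gw_space_def space_PiM PiE_UNIV_domain)

lemma prob_space_gw_space: "prob_space (gw_space p)"
  unfolding gw_space_def by (intro prob_space_PiM) (simp add: measure_pmf.prob_space_axioms)

lemma tree_event_Collect:
  "tree_event t = {\<xi> \<in> space (gw_space p). \<forall>u\<in>verts t. \<xi> u \<in> {outdeg t u}}"
  by (simp add: tree_event_def family_tree_eq_verts_iff)

lemma tree_event_sets [measurable]: "tree_event t \<in> sets (gw_space p)"
proof -
  have "tree_event t = prod_emb UNIV (\<lambda>_. measure_pmf p) (verts t) (PiE (verts t) (\<lambda>u. {outdeg t u}))"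
    by (auto simp: tree_event_def family_tree_eq_verts_iff prod_emb_def PiE_iff space_PiM)
  then show ?thesis unfolding gw_space_def by simp
qed

lemma measure_tree_event: "measure (gw_space p) (tree_event t) = tree_wt (pmf p) t"
proof -
  interpret product_prob_space "\<lambda>_::nat list. measure_pmf p" UNIV
    by unfold_locales
  have "emeasure (gw_space p) (tree_event t) = (\<Prod>u\<in>verts t. emeasure (measure_pmf p) {outdeg t u})"
    unfolding tree_event_Collect[of t p] gw_space_def
    by (subst emeasure_PiM_Collect) auto
  also have "\<dots> = ennreal (\<Prod>u\<in>verts t. pmf p (outdeg t u))"
    by (simp add: emeasure_pmf_single prod_ennreal)
  finally show ?thesis
    by (simp add: measure_def prod_verts_outdeg tree_wt_nonneg)
qed

lemma disjoint_tree_event: "disjoint_family_on tree_event A"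
  by (auto simp: disjoint_family_on_def tree_event_def dest: verts_inject)

lemma gw_size_event_eq:
  assumes "n \<ge> 1"
  shows "gw_size_event p n = (\<Union>t\<in>trees n. tree_event t)"
proof -
  have "card (family_tree \<xi>) = n \<longleftrightarrow> (\<exists>t\<in>trees n. family_tree \<xi> = verts t)" for \<xi>
  proof
    assume c: "card (family_tree \<xi>) = n"
    then have "finite (family_tree \<xi>)" using assms by (intro card_ge_0_finite) simp
    then obtain t where "family_tree \<xi> = verts t" using finite_family_tree_is_verts by blast
    then show "\<exists>t\<in>trees n. family_tree \<xi> = verts t" using c by (auto simp: trees_def card_verts)
  qed (auto simp: trees_def card_verts)
  then show ?thesis by (auto simp: gw_size_event_def tree_event_def)
qed

lemma measure_gw_size_event:
  assumes "n \<ge> 1"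
  shows "measure (gw_space p) (gw_size_event p n) = tree_gf (tree_wt (pmf p)) $ n"
proof -
  interpret prob_space "gw_space p" by (rule prob_space_gw_space)
  show ?thesis unfolding gw_size_event_eq[OF assms]
    by (subst finite_measure_finite_Union)
      (auto simp: disjoint_tree_event measure_tree_event tree_gf_def)
qed

text \<open>An inequality avoids proving that the integrand is measurable: if it is not integrable,
  its Bochner integral is 0 by convention, and the right-hand side is nonnegative.\<close>

lemma conditioned_gw_integral_le:
  fixes F :: "nat list set \<Rightarrow> real"
  assumes n: "n \<ge> 1" and adm: "gw_admissible p n" and F: "\<And>T. 0 \<le> F T"
  shows "(\<integral>\<xi>. F (family_tree \<xi>) \<partial>conditioned_gw p n)
    \<le> (\<Sum>t\<in>trees n. tree_wt (pmf p) t * F (verts t)) / tree_gf (tree_wt (pmf p)) $ n"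
    (is "_ \<le> ?R")
proof -
  interpret G: prob_space "gw_space p" by (rule prob_space_gw_space)
  let ?A = "gw_size_event p n" and ?U = "conditioned_gw p n"
  let ?g = "\<lambda>\<xi>. \<Sum>t\<in>trees n. F (verts t) * indicator (tree_event t) \<xi>"
  have A: "?A \<in> sets (gw_space p)" unfolding gw_size_event_eq[OF n] by auto
  have pos: "measure (gw_space p) ?A > 0" using adm by (simp add: gw_admissible_def)
  have eA: "emeasure (gw_space p) ?A \<noteq> 0" "emeasure (gw_space p) ?A \<noteq> \<infinity>"
    using pos by (auto simp: G.emeasure_eq_measure)
  interpret U: prob_space ?U unfolding conditioned_gw_def
    by (rule prob_space_uniform_measure) (use eA in auto)
  have setsU: "sets ?U = sets (gw_space p)" by (simp add: conditioned_gw_def uniform_measure_def)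
  have R0: "0 \<le> ?R"
    using pos measure_gw_size_event[OF n] by (auto intro!: sum_nonneg divide_nonneg_pos mult_nonneg_nonneg F tree_wt_nonneg)
  show ?thesis
  proof (cases "integrable ?U (\<lambda>\<xi>. F (family_tree \<xi>))")
    case False
    then show ?thesis using R0 by (simp add: not_integrable_integral_eq)
  next
    case True
    have ev [measurable]: "tree_event t \<in> sets ?U" for t by (simp add: setsU)
    have m: "measure ?U (tree_event t) = tree_wt (pmf p) t / tree_gf (tree_wt (pmf p)) $ n" if "t \<in> trees n" for t
    proof -
      have "?A \<inter> tree_event t = tree_event t" using that unfolding gw_size_event_eq[OF n] by auto
      then show ?thesis unfolding conditioned_gw_def
        using eA A by (simp add: measure_tree_event measure_gw_size_event[OF n])
    qed
    \<comment> \<open>Under the conditioning the tree is almost surely one of the finitely many in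
      \<open>trees n\<close>, so the integrand agrees with a finite sum of indicators.\<close>
    have ae: "AE \<xi> in ?U. F (family_tree \<xi>) = ?g \<xi>"
      unfolding conditioned_gw_def
    proof (rule AE_uniform_measureI[OF A], rule AE_I2, rule impI)
      fix \<xi> assume "\<xi> \<in> ?A"
      then obtain t where t: "t \<in> trees n" "\<xi> \<in> tree_event t"
        unfolding gw_size_event_eq[OF n] by auto
      then have "indicator (tree_event s) \<xi> = (if s = t then 1 else (0::real))" for s
        using disjoint_tree_event[of UNIV] by (auto simp: disjoint_family_on_def indicator_def)
      then show "F (family_tree \<xi>) = ?g \<xi>"
        using t by (simp add: tree_event_def mult_delta_right)
    qed
    have ii: "integrable ?U (indicator (tree_event t) :: _ \<Rightarrow> real)" for t
      by (rule integrable_real_indicator[OF ev]) (simp add: U.emeasure_eq_measure)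
    have gm: "?g \<in> borel_measurable ?U" by measurable
    have "(\<integral>\<xi>. F (family_tree \<xi>) \<partial>?U) = (\<integral>\<xi>. ?g \<xi> \<partial>?U)"
      by (rule integral_cong_AE[OF borel_measurable_integrable[OF True] gm ae])
    also have "\<dots> = (\<Sum>t\<in>trees n. F (verts t) * measure ?U (tree_event t))"
      by (subst Bochner_Integration.integral_sum)
        (auto simp: sets.Int_space_eq2[OF ev] ii)
    also have "\<dots> = ?R"
      by (simp add: m sum_divide_distrib mult.commute)
    finally show ?thesis by simp
  qed
qed

section \<open>Expansions in Steiner trees\<close>

lemma fps_power_nth_less:
  "(Y :: 'a::comm_ring_1 fps) $ 0 = 0 \<Longrightarrow> n < N \<Longrightarrow> (Y ^ N) $ n = 0"
  by (rule startsby_zero_power_prefix[rule_format]) auto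

text \<open>Since \<open>Y ^ d\<close> starts in degree \<open>d\<close>, all degrees can share the
  range \<open>d \<le> n\<close>, and the sum over \<open>d\<close> can be taken last.\<close>

lemma fps_compose_mult_nth:
  fixes Y C W :: "'a::comm_ring_1 fps"
  assumes Y0: "Y $ 0 = 0"
  shows "((C oo Y) * W) $ n = (\<Sum>d\<le>n. C $ d * (Y ^ d * W) $ n)"
proof -
  have "((C oo Y) * W) $ n = (\<Sum>i\<le>n. (\<Sum>d\<le>i. C $ d * (Y ^ d) $ i) * W $ (n - i))"
    by (simp add: fps_mult_nth fps_compose_nth atLeast0AtMost)
  also have "\<dots> = (\<Sum>i\<le>n. (\<Sum>d\<le>n. C $ d * (Y ^ d) $ i) * W $ (n - i))"
  proof (intro sum.cong refl)
    fix i assume i: "i \<in> {..n}"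
    have "(\<Sum>d\<le>i. C $ d * (Y ^ d) $ i) = (\<Sum>d\<le>n. C $ d * (Y ^ d) $ i)"
      using i fps_power_nth_less[OF Y0] by (intro sum.mono_neutral_left) auto
    then show "(\<Sum>d\<le>i. C $ d * (Y ^ d) $ i) * W $ (n - i)
       = (\<Sum>d\<le>n. C $ d * (Y ^ d) $ i) * W $ (n - i)" by simp
  qed
  also have "\<dots> = (\<Sum>d\<le>n. C $ d * (\<Sum>i\<le>n. (Y ^ d) $ i * W $ (n - i)))"
    unfolding sum_distrib_right sum_distrib_left by (subst sum.swap) (simp add: mult_ac)
  also have "\<dots> = (\<Sum>d\<le>n. C $ d * (Y ^ d * W) $ n)"
    by (simp add: fps_mult_nth atLeast0AtMost)
  finally show ?thesis .
qed

text \<open>Series of trees have the size as outer variable and series in the moment variable as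
  coefficients. After the swap the moment variable is the outer one, and truncating in it means
  restricting the order of the moments.\<close>

definition fps_swap :: "'a::zero fps fps \<Rightarrow> 'a fps fps" where
  "fps_swap F = Abs_fps (\<lambda>k. Abs_fps (\<lambda>n. F $ n $ k))"

lemma fps_swap_nth [simp]: "fps_swap F $ k $ n = F $ n $ k"
  by (simp add: fps_swap_def)

lemma fps_mult_nth_nth:
  fixes F G :: "'a::comm_ring_1 fps fps"
  shows "(F * G) $ k $ n = (\<Sum>i\<le>k. \<Sum>j\<le>n. F $ i $ j * G $ (k - i) $ (n - j))"
  by (simp add: fps_mult_nth fps_sum_nth atLeast0AtMost)

lemma fps_swap_mult:
  fixes F G :: "'a::comm_ring_1 fps fps"
  shows "fps_swap (F * G) = fps_swap F * fps_swap G"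
proof (intro fps_ext)
  fix k n
  show "fps_swap (F * G) $ k $ n = (fps_swap F * fps_swap G) $ k $ n"
    by (simp add: fps_mult_nth_nth) (rule sum.swap)
qed

lemma fps_swap_1 [simp]: "fps_swap (1 :: 'a::comm_ring_1 fps fps) = 1"
  by (intro fps_ext) (simp add: fps_one_nth)

lemma fps_swap_power:
  fixes F :: "'a::comm_ring_1 fps fps"
  shows "fps_swap (F ^ d) = fps_swap F ^ d"
  by (induction d) (simp_all add: fps_swap_mult)

lemma fps_swap_X: "fps_swap (fps_X :: 'a::comm_ring_1 fps fps) = fps_const fps_X"
  by (intro fps_ext) (simp add: fps_X_nth)

lemma fps_swap_const: "fps_swap (fps_const (F :: 'a::comm_ring_1 fps)) = Abs_fps (\<lambda>k. fps_const (F $ k))"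
  by (intro fps_ext) simp

text \<open>The series of the \<open>m\<close>-th derivative, divided by \<open>fact m\<close>, of
  the series with coefficients \<open>c\<close>.\<close>

definition taylor_coeff :: "(nat \<Rightarrow> real) \<Rightarrow> nat \<Rightarrow> real fps" where
  "taylor_coeff c m = Abs_fps (\<lambda>e. of_nat ((e + m) choose m) * c (e + m))"

lemma fps_power_nth_nth_less:
  fixes X :: "'a::comm_ring_1 fps fps"
  assumes "\<And>j. X $ j $ 0 = 0" "n < m"
  shows "(X ^ m) $ k $ n = 0"
proof -
  have "fps_swap X $ 0 = 0" by (rule fps_ext) (simp add: assms(1))
  then have "(fps_swap X ^ m) $ n = 0" using assms(2) by (rule fps_power_nth_less)
  then have "fps_swap (X ^ m) $ n $ k = 0" by (simp add: fps_swap_power)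
  then show ?thesis by simp
qed

text \<open>Taylor's formula at \<open>Y\<close>, the part of \<open>G\<close> of order 0 in the
  moment variable. The increment has no such part, so its powers beyond \<open>R\<close> do not
  reach the orders \<open>k \<le> R\<close>.\<close>

lemma fps_swap_compose_taylor:
  fixes G :: "real fps fps"
  assumes G0: "G $ 0 = 0" and k: "k \<le> R"
  defines "Y \<equiv> fps_swap G $ 0"
  shows "fps_swap (Abs_fps (\<lambda>d. fps_const (c d)) oo G) $ k
    = (\<Sum>m\<le>R. fps_const (taylor_coeff c m oo Y) * (fps_swap G - fps_const Y) ^ m) $ k"
proof (rule fps_ext)
  fix n
  let ?H = "fps_swap G"
  define X where "X = ?H - fps_const Y"
  have Y0: "Y $ 0 = 0" by (simp add: Y_def G0)
  have X0: "X $ 0 = 0" by (simp add: X_def Y_def)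
  have X00: "X $ j $ 0 = 0" for j using Y0 G0 by (simp add: X_def)
  define t where "t m e = of_nat ((e + m) choose m) * c (e + m) * (Y ^ e * (X ^ m) $ k) $ n" for m e
  \<comment> \<open>The increment starts in order 1 in both variables: the power \<open>m\<close>
    excludes moment orders below \<open>m\<close>, and together with \<open>Y ^ e\<close> it
    excludes sizes below \<open>e + m\<close>. This makes the double sum finite.\<close>
  have t0: "t m e = 0" if "k < m \<or> n < e + m" for m e
  proof -
    have "(Y ^ e * (X ^ m) $ k) $ n = 0"
    proof (cases "k < m")
      case True
      then show ?thesis using fps_power_nth_less[OF X0] by simp
    next
      case False
      then have "n < e + m" using that by simp
      then have "(Y ^ e) $ i * (X ^ m) $ k $ (n - i) = 0" if "i \<le> n" for i
        using fps_power_nth_less[OF Y0, of i e] fps_power_nth_nth_less[OF X00, of "n - i" m k] that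
        by (cases "i < e") auto
      then show ?thesis unfolding fps_mult_nth by (intro sum.neutral) auto
    qed
    then show ?thesis by (simp add: t_def)
  qed
  have "fps_swap (Abs_fps (\<lambda>d. fps_const (c d)) oo G) $ k $ n = (\<Sum>d\<le>n. c d * (?H ^ d) $ k $ n)"
    by (simp add: fps_compose_nth fps_sum_nth atLeast0AtMost flip: fps_swap_power)
  also have "\<dots> = (\<Sum>d\<le>n. \<Sum>m\<le>d. t m (d - m))"
  proof (intro sum.cong refl)
    fix d
    have "?H ^ d = (X + fps_const Y) ^ d" by (simp add: X_def)
    also have "\<dots> = (\<Sum>m\<le>d. of_nat (d choose m) * X ^ m * fps_const Y ^ (d - m))"
      by (rule binomial_ring)
    also have "\<dots> = (\<Sum>m\<le>d. fps_const (fps_const (real (d choose m))) * (fps_const (Y ^ (d - m)) * X ^ m))"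
      by (intro sum.cong refl) (simp add: fps_of_nat[symmetric] fps_const_power mult_ac)
    finally have "(?H ^ d) $ k $ n = (\<Sum>m\<le>d. real (d choose m) * (Y ^ (d - m) * (X ^ m) $ k) $ n)"
      by (simp add: fps_sum_nth)
    then show "c d * (?H ^ d) $ k $ n = (\<Sum>m\<le>d. t m (d - m))"
      by (simp add: t_def sum_distrib_left mult_ac)
  qed
  also have "\<dots> = (\<Sum>(m, e)\<in>{(m, e). m + e \<le> n}. t m e)"
    by (rule sum.triangle_reindex_eq[symmetric])
  also have "\<dots> = (\<Sum>(m, e)\<in>{..R} \<times> {..n}. t m e)"
  proof -
    have "finite {(m, e). m + e \<le> n}" by (rule finite_subset[of _ "{..n} \<times> {..n}"]) auto
    then have "(\<Sum>(m, e)\<in>{(m, e). m + e \<le> n}. t m e) = (\<Sum>(m, e)\<in>{(m, e). m + e \<le> n} \<inter> {..R} \<times> {..n}. t m e)"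
      using k by (intro sum.mono_neutral_right) (auto intro!: t0)
    also have "\<dots> = (\<Sum>(m, e)\<in>{..R} \<times> {..n}. t m e)"
      by (intro sum.mono_neutral_left) (auto, metis t0 add.commute not_le)
    finally show ?thesis .
  qed
  also have "\<dots> = (\<Sum>m\<le>R. \<Sum>e\<le>n. t m e)" by (simp add: sum.cartesian_product)
  also have "\<dots> = (\<Sum>m\<le>R. ((taylor_coeff c m oo Y) * (X ^ m) $ k) $ n)"
    by (simp add: fps_compose_mult_nth[OF Y0] t_def taylor_coeff_def)
  also have "\<dots> = (\<Sum>m\<le>R. fps_const (taylor_coeff c m oo Y) * X ^ m) $ k $ n"
    by (simp add: fps_sum_nth)
  finally show "fps_swap (Abs_fps (\<lambda>d. fps_const (c d)) oo G) $ k $ n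
    = (\<Sum>m\<le>R. fps_const (taylor_coeff c m oo Y) * (?H - fps_const Y) ^ m) $ k $ n"
    by (simp add: X_def)
qed

text \<open>The generating functions of interest are, modulo the power \<open>R + 1\<close> of the outer variable \<open>a\<close>,
  nonnegative combinations of monomials \<open>a ^ l * X ^ k * Y ^ N\<close>, where \<open>k\<close> counts the vertices of a
  Steiner tree and \<open>N\<close> the subtrees that hang off it. The predicate below records a bound on \<open>k\<close> and
  a bound \<open>B\<close> on the combination evaluated at \<open>a = \<alpha>\<close>, \<open>X = z\<close>, \<open>Y = y\<close>.\<close>

definition dominated :: "real \<Rightarrow> real fps \<Rightarrow> real \<Rightarrow> bool" where
  "dominated y c b \<longleftrightarrow> (\<forall>N. 0 \<le> c $ N) \<and> (\<forall>M. (\<Sum>N\<le>M. c $ N * y ^ N) \<le> b)"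

lemma dominated_nonneg: "dominated y c b \<Longrightarrow> 0 \<le> b"
  unfolding dominated_def by (auto dest!: spec[of _ "0::nat"])

lemma dominated_mult:
  assumes c: "dominated y c b" and d: "dominated y d b'" and y: "0 \<le> y"
  shows "dominated y (c * d) (b * b')"
  unfolding dominated_def
proof (intro conjI allI)
  fix N show "0 \<le> (c * d) $ N"
    using c d by (auto simp: dominated_def fps_mult_nth intro!: sum_nonneg mult_nonneg_nonneg)
next
  fix M
  have "(\<Sum>N\<le>M. (c * d) $ N * y ^ N) = (\<Sum>N\<le>M. \<Sum>i\<le>N. (c $ i * y ^ i) * (d $ (N - i) * y ^ (N - i)))"
    unfolding fps_mult_nth sum_distrib_right atLeast0AtMost
  proof (intro sum.cong refl)
    fix N i :: nat assume "i \<in> {..N}"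
    then have "y ^ N = y ^ i * y ^ (N - i)" by (simp flip: power_add)
    then show "c $ i * d $ (N - i) * y ^ N = (c $ i * y ^ i) * (d $ (N - i) * y ^ (N - i))" by simp
  qed
  also have "\<dots> = (\<Sum>(i, j)\<in>{(i, j). i + j \<le> M}. (c $ i * y ^ i) * (d $ j * y ^ j))"
    by (rule sum.triangle_reindex_eq[symmetric])
  also have "\<dots> \<le> (\<Sum>(i, j)\<in>{..M} \<times> {..M}. (c $ i * y ^ i) * (d $ j * y ^ j))"
    using c d y by (intro sum_mono2) (auto simp: dominated_def)
  also have "\<dots> = (\<Sum>i\<le>M. c $ i * y ^ i) * (\<Sum>j\<le>M. d $ j * y ^ j)"
    by (simp add: sum_product sum.cartesian_product)
  also have "\<dots> \<le> b * b'"
    using c d y dominated_nonneg[OF c] by (intro mult_mono sum_nonneg) (auto simp: dominated_def)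
  finally show "(\<Sum>N\<le>M. (c * d) $ N * y ^ N) \<le> b * b'" .
qed

text \<open>\<open>\<sigma>\<close> is the number of inner vertices that each marked vertex may add
  to the Steiner tree; in the application it is the distance \<open>i\<close>. \<open>R\<close> is
  the order at which the moment variable is cut off.\<close>

locale steiner_expansion =
  fixes Y :: "real fps" and y z \<alpha> :: real and \<sigma> R :: nat
  assumes Y0: "Y $ 0 = 0" and y: "0 \<le> y" and z: "0 \<le> z" and \<alpha>: "0 < \<alpha>"
begin

definition mono_term :: "nat \<Rightarrow> nat \<Rightarrow> real fps \<Rightarrow> real fps fps" where
  "mono_term l k c = fps_X ^ l * fps_const (fps_X ^ k * (c oo Y))"

text \<open>Only finitely many monomials occur, each with an entire series in \<open>Y\<close> as
  its factor. The offset \<open>\<tau>\<close> may be negative: a series without part of order 0 has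
  only monomials with \<open>l \<ge> 1\<close>, which bring at least one
  \<open>\<sigma>\<close>.\<close>

inductive expands :: "int \<Rightarrow> real \<Rightarrow> real fps fps \<Rightarrow> bool" where
  zero: "0 \<le> B \<Longrightarrow> (\<And>r. r \<le> R \<Longrightarrow> G $ r = 0) \<Longrightarrow> expands \<tau> B G"
| add: "expands \<tau> B G \<Longrightarrow> int k \<le> \<tau> + int (l * \<sigma>) \<Longrightarrow> dominated y c b
    \<Longrightarrow> (\<And>r. r \<le> R \<Longrightarrow> G' $ r = (G + mono_term l k c) $ r)
    \<Longrightarrow> B + \<alpha> ^ l * z ^ k * b \<le> B' \<Longrightarrow> expands \<tau> B' G'"

lemma expands_cong:
  assumes "expands \<tau> B G" "\<And>r. r \<le> R \<Longrightarrow> G' $ r = G $ r" "B \<le> B'"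
  shows "expands \<tau> B' G'"
  using assms(1)
proof cases
  case zero
  then show ?thesis using assms by (intro expands.zero) auto
next
  case (add B0 G0 k l c b)
  show ?thesis
    by (rule expands.add[OF add(1,2,3)]) (use add assms in auto)
qed

lemma expands_mono_shift: "expands \<tau> B G \<Longrightarrow> \<tau> \<le> \<tau>' \<Longrightarrow> expands \<tau>' B G"
proof (induction rule: expands.induct)
  case (zero B G \<tau>)
  then show ?case by (intro expands.zero)
next
  case (add \<tau> B G k l c b G' B')
  show ?case
    by (rule expands.add[OF add.IH[OF add.prems] _ add.hyps(3)]) (use add in auto)
qed

lemma term_bound_nonneg: "dominated y c b \<Longrightarrow> 0 \<le> \<alpha> ^ l * z ^ k * b"
  using dominated_nonneg z \<alpha> by (simp add: less_imp_le)

lemma expands_nonneg: "expands \<tau> B G \<Longrightarrow> 0 \<le> B"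
proof (induction rule: expands.induct)
  case (add \<tau> B G k l c b G' B')
  then show ?case using term_bound_nonneg[OF add.hyps(3), of l k] by linarith
qed

lemma expands_add:
  assumes "expands \<tau> B G" "expands \<tau> B' G'"
  shows "expands \<tau> (B + B') (G + G')"
  using assms
proof (induction rule: expands.induct)
  case (zero B G \<tau>)
  show ?case by (rule expands_cong[OF zero(3)]) (use zero in auto)
next
  case (add \<tau> B0 G0 k l c b G1 B1)
  show ?case
    by (rule expands.add[OF add.IH[OF add.prems] add.hyps(2,3)]) (use add in auto)
qed

lemma expands_0: "0 \<le> B \<Longrightarrow> expands \<tau> B 0"
  by (intro expands.zero) auto

lemma expands_sum:
  assumes "finite A" "\<And>x. x \<in> A \<Longrightarrow> expands \<tau> (B x) (G x)"
  shows "expands \<tau> (\<Sum>x\<in>A. B x) (\<Sum>x\<in>A. G x)"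
  using assms by (induction A rule: finite_induct) (auto intro: expands_add expands_0)

lemma expands_mono_term:
  assumes "int k \<le> \<tau> + int (l * \<sigma>)" "dominated y c b"
  shows "expands \<tau> (\<alpha> ^ l * z ^ k * b) (mono_term l k c)"
  by (rule expands.add[OF expands_0[OF order_refl] assms]) auto

lemma mono_term_mult: "mono_term l k c * mono_term l' k' c' = mono_term (l + l') (k + k') (c * c')"
  by (simp add: mono_term_def power_add fps_compose_mult_distrib[OF Y0] mult_ac
      flip: fps_const_mult)

lemma expands_mult_mono_term:
  assumes "expands \<tau> B G" and k': "int k' \<le> \<tau>' + int (l' * \<sigma>)" and c': "dominated y c' b'"
  shows "expands (\<tau> + \<tau>') (B * (\<alpha> ^ l' * z ^ k' * b')) (G * mono_term l' k' c')"
  using assms(1)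
proof (induction rule: expands.induct)
  case (zero B G \<tau>)
  show ?case
  proof (rule expands.zero)
    show "0 \<le> B * (\<alpha> ^ l' * z ^ k' * b')" using zero term_bound_nonneg[OF c', of l' k'] by simp
    show "(G * mono_term l' k' c') $ r = 0" if "r \<le> R" for r
      using zero that by (simp add: fps_mult_nth)
  qed
next
  case (add \<tau> B0 G0 k l c b G1 B1)
  show ?case
  proof (rule expands.add[OF add.IH _ dominated_mult[OF add.hyps(3) c' y]])
    show "int (k + k') \<le> \<tau> + \<tau>' + int ((l + l') * \<sigma>)" using add.hyps(2) k' by (simp add: algebra_simps)
    show "(G1 * mono_term l' k' c') $ r = (G0 * mono_term l' k' c' + mono_term (l + l') (k + k') (c * c')) $ r"
      if "r \<le> R" for r
    proof -
      have "(G1 * mono_term l' k' c') $ r = ((G0 + mono_term l k c) * mono_term l' k' c') $ r"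
        using add.hyps(4) that by (simp add: fps_mult_nth)
      then show ?thesis by (simp add: distrib_right mono_term_mult)
    qed
    have "(B0 + \<alpha> ^ l * z ^ k * b) * (\<alpha> ^ l' * z ^ k' * b') \<le> B1 * (\<alpha> ^ l' * z ^ k' * b')"
      using add.hyps(5) term_bound_nonneg[OF c', of l' k'] by (rule mult_right_mono)
    then show "B0 * (\<alpha> ^ l' * z ^ k' * b') + \<alpha> ^ (l + l') * z ^ (k + k') * (b * b') \<le> B1 * (\<alpha> ^ l' * z ^ k' * b')"
      by (simp add: algebra_simps power_add)
  qed
qed

lemma expands_mult:
  assumes G: "expands \<tau> B G" and G': "expands \<tau>' B' G'"
  shows "expands (\<tau> + \<tau>') (B * B') (G * G')"
  using G'
proof (induction rule: expands.induct)
  case (zero B' G' \<tau>')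
  show ?case
  proof (rule expands.zero)
    show "0 \<le> B * B'" using zero expands_nonneg[OF G] by simp
    show "(G * G') $ r = 0" if "r \<le> R" for r
      using zero that by (simp add: fps_mult_nth)
  qed
next
  case (add \<tau>' B0 G0 k l c b G1 B1)
  show ?case
  proof (rule expands_cong[OF expands_add[OF add.IH expands_mult_mono_term[OF G add.hyps(2,3)]]])
    show "(G * G1) $ r = (G * G0 + G * mono_term l k c) $ r" if "r \<le> R" for r
    proof -
      have "(G * G1) $ r = (G * (G0 + mono_term l k c)) $ r"
        using add.hyps(4) that by (simp add: fps_mult_nth)
      then show ?thesis by (simp add: distrib_left)
    qed
    have "B * (B0 + \<alpha> ^ l * z ^ k * b) \<le> B * B1"
      using add.hyps(5) expands_nonneg[OF G] by (rule mult_left_mono)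
    then show "B * B0 + B * (\<alpha> ^ l * z ^ k * b) \<le> B * B1" by (simp add: algebra_simps)
  qed
qed

lemma expands_1: "expands 0 1 1"
proof -
  have "dominated y 1 1"
    by (auto simp: dominated_def fps_one_nth if_distrib[of "\<lambda>x. x * _"] sum.delta cong: if_cong)
  from expands_mono_term[OF _ this, of 0 0 0] show ?thesis by (simp add: mono_term_def)
qed

lemma expands_power:
  assumes "expands \<tau> B G"
  shows "expands (int m * \<tau>) (B ^ m) (G ^ m)"
proof (induction m)
  case (Suc m)
  then show ?case using expands_mult[OF assms, of "int m * \<tau>" "B ^ m" "G ^ m"]
    by (simp add: algebra_simps)
qed (simp add: expands_1)

lemma expands_const_compose:
  assumes "dominated y c b"
  shows "expands 0 b (fps_const (c oo Y))"
  using expands_mono_term[OF _ assms, of 0 0 0] by (simp add: mono_term_def)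

lemma expands_const_X: "expands 1 z (fps_const fps_X)"
proof -
  have "dominated y 1 1"
    by (auto simp: dominated_def fps_one_nth if_distrib[of "\<lambda>x. x * _"] sum.delta cong: if_cong)
  from expands_mono_term[OF _ this, of 1 1 0] show ?thesis by (simp add: mono_term_def)
qed

lemma expands_Y: "expands 0 y (fps_const Y)"
proof -
  have "dominated y fps_X y"
    unfolding dominated_def
  proof (intro conjI allI)
    fix M
    have "(\<Sum>N\<le>M. fps_X $ N * y ^ N) = (\<Sum>N\<le>M. if N = 1 then y else 0)"
      by (intro sum.cong) (auto simp: fps_X_nth)
    then show "(\<Sum>N\<le>M. fps_X $ N * y ^ N) \<le> y" using y by (simp add: sum.delta)
  qed (simp add: fps_X_nth)
  from expands_const_compose[OF this] show ?thesis by (simp add: Y0)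
qed

lemma mono_term_nth_nth:
  "mono_term l k c $ r $ n = (if r = l \<and> k \<le> n then (\<Sum>N\<le>n - k. c $ N * (Y ^ N) $ (n - k)) else 0)"
  by (auto simp: mono_term_def fps_X_power_mult_nth fps_compose_nth atLeast0AtMost)

text \<open>The only place where forests are counted. For the series of trees,
  \<open>(Y ^ N) $ (n - k)\<close> is the weight of the forests that remain after \<open>k\<close>
  vertices are cut out; a bound for the degrees that occur turns each monomial into its value at the
  evaluation point.\<close>

lemma expands_bound:
  assumes "expands \<tau> B G" "r \<le> R" "\<tau> + int (r * \<sigma>) \<le> int s" "0 \<le> A"
    and bound: "\<And>k N. k \<le> s \<Longrightarrow> k \<le> n \<Longrightarrow> (Y ^ N) $ (n - k) \<le> A * (z ^ k * y ^ N)"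
  shows "G $ r $ n * \<alpha> ^ r \<le> A * B"
  using assms(1-3)
proof (induction rule: expands.induct)
  case (zero B G \<tau>)
  then show ?case using assms(4) by simp
next
  case (add \<tau> B0 G0 k l c b G1 B1)
  have b: "0 \<le> \<alpha> ^ l * z ^ k * b" by (rule term_bound_nonneg[OF add.hyps(3)])
  have t: "mono_term l k c $ r $ n * \<alpha> ^ r \<le> A * (\<alpha> ^ l * z ^ k * b)"
  proof (cases "r = l \<and> k \<le> n")
    case True
    have "(\<Sum>N\<le>n - k. c $ N * (Y ^ N) $ (n - k)) \<le> (\<Sum>N\<le>n - k. c $ N * (A * (z ^ k * y ^ N)))"
      using add.hyps(2,3) add.prems(2) True bound[of k]
      by (intro sum_mono mult_left_mono) (auto simp: dominated_def)
    also have "\<dots> = A * z ^ k * (\<Sum>N\<le>n - k. c $ N * y ^ N)"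
      by (simp add: sum_distrib_left mult_ac)
    also have "\<dots> \<le> A * z ^ k * b"
      using add.hyps(3) assms(4) z by (intro mult_left_mono) (auto simp: dominated_def)
    finally have "(\<Sum>N\<le>n - k. c $ N * (Y ^ N) $ (n - k)) * \<alpha> ^ r \<le> A * z ^ k * b * \<alpha> ^ r"
      using \<alpha> by (intro mult_right_mono) auto
    then show ?thesis using True by (simp add: mono_term_nth_nth mult_ac)
  next
    case False
    then have "mono_term l k c $ r $ n = 0" by (auto simp: mono_term_nth_nth)
    then show ?thesis using mult_nonneg_nonneg[OF assms(4) b] by simp
  qed
  have "G1 $ r $ n * \<alpha> ^ r = G0 $ r $ n * \<alpha> ^ r + mono_term l k c $ r $ n * \<alpha> ^ r"
    using add.hyps(4) add.prems(1) by (simp add: distrib_right)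
  also have "\<dots> \<le> A * B0 + A * (\<alpha> ^ l * z ^ k * b)"
    using add.IH[OF add.prems] t by (rule add_mono)
  also have "\<dots> \<le> A * B1"
    using mult_left_mono[OF add.hyps(5) assms(4)] by (simp add: distrib_left)
  finally show ?case .
qed

end

section \<open>Formal moment generating functions along levels and along the spine\<close>

lemma fps_exp_sum:
  "finite A \<Longrightarrow> fps_exp (\<Sum>x\<in>A. f x :: real) = (\<Prod>x\<in>A. fps_exp (f x))"
  by (induction A rule: finite_induct) (simp_all add: fps_exp_add_mult)

lemma fps_exp_sum_list: "fps_exp (sum_list (map f xs) :: real) = prod_list (map (\<lambda>x. fps_exp (f x)) xs)"
  by (induction xs) (simp_all add: fps_exp_add_mult)

lemma prod_list_fps_const: "prod_list (map (\<lambda>x. fps_const (f x :: 'a::comm_ring_1)) xs) = fps_const (prod_list (map f xs))"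
  by (induction xs) simp_all

lemma prod_fps_const: "(\<Prod>x\<in>A. fps_const (f x :: 'a::comm_ring_1)) = fps_const (\<Prod>x\<in>A. f x)"
  by (induction A rule: infinite_finite_induct) simp_all

lemma prod_list_map_mult:
  "prod_list (map (\<lambda>x. f x * g x :: 'a::comm_monoid_mult) xs) = prod_list (map f xs) * prod_list (map g xs)"
  by (induction xs) (simp_all add: mult_ac)

text \<open>A formal exponential encodes all moments at once and turns sums over subtrees into
  products. Convergence is no issue.\<close>

definition lev_gen :: "(nat \<Rightarrow> real) \<Rightarrow> nat \<Rightarrow> ptree \<Rightarrow> real fps" where
  "lev_gen w j t = fps_const (tree_wt w t) * fps_exp (real (level_size j t))"

definition spine_gen :: "(nat \<Rightarrow> real) \<Rightarrow> nat \<Rightarrow> nat \<Rightarrow> ptree \<Rightarrow> real fps" where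
  "spine_gen w i h t = fps_const (tree_wt w t) *
     (\<Sum>v\<in>verts t. if length v = h then fps_exp (real (at_dist i t v)) else 0)"

text \<open>The factor of a sibling of the spine at height \<open>h + 1\<close>: its vertices at distance \<open>i\<close> from
  the end of the spine have height \<open>i - h - 2\<close> in the sibling's subtree.\<close>

definition sibling_gen :: "(nat \<Rightarrow> real) \<Rightarrow> nat \<Rightarrow> nat \<Rightarrow> ptree \<Rightarrow> real fps" where
  "sibling_gen w i h t = (if i < h + 2 then fps_const (tree_wt w t) else lev_gen w (i - h - 2) t)"

lemma lev_gen_Suc:
  "lev_gen w (Suc j) (Node ts) = fps_const (w (length ts)) * prod_list (map (lev_gen w j) ts)"
proof -
  have "real (level_size (Suc j) (Node ts)) = sum_list (map (\<lambda>t. real (level_size j t)) ts)"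
    by (simp add: level_size_Suc) (induction ts, simp_all)
  then show ?thesis
    by (simp add: lev_gen_def[abs_def] fps_exp_sum_list prod_list_map_mult prod_list_fps_const
      flip: fps_const_mult)
qed

lemma spine_gen_0: "spine_gen w i 0 t = lev_gen w i t"
proof -
  have "(\<Sum>v\<in>verts t. if length v = 0 then fps_exp (real (at_dist i t v)) else 0)
      = (\<Sum>v\<in>verts t. if v = [] then fps_exp (real (level_size i t)) else 0)"
    by (intro sum.cong refl) (simp add: at_dist_Nil)
  then show ?thesis by (simp add: spine_gen_def lev_gen_def sum.delta)
qed

text \<open>The exponential of \<open>at_dist_Cons\<close>. The factor \<open>fps_exp 1\<close> is
  the root, which is at distance \<open>i\<close> from the end of the spine exactly when that end
  has height \<open>i\<close>.\<close>

lemma spine_gen_Suc: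
  "spine_gen w i (Suc h) (Node ts) = ((if i = Suc h then fps_exp 1 else 1) * fps_const (w (length ts)))
     * one_marked (spine_gen w i h) (sibling_gen w i h) ts"
proof -
  let ?\<epsilon> = "if i = Suc h then fps_exp 1 else (1 :: real fps)"
  let ?n = "\<lambda>l. if i < h + 2 then 0 else level_size (i - h - 2) (ts ! l)"
  let ?L = "\<lambda>j. {..<length ts} - {j}"
  have 1: "fps_exp (real (at_dist i (Node ts) (j # v)))
      = ?\<epsilon> * fps_exp (real (at_dist i (ts ! j) v)) * (\<Prod>l\<in>?L j. fps_exp (real (?n l)))"
    if "j < length ts" "length v = h" for j v
  proof -
    have "real (at_dist i (Node ts) (j # v))
      = real (if i = Suc h then 1 else 0) + real (at_dist i (ts ! j) v) + (\<Sum>l\<in>?L j. real (?n l))"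
      unfolding at_dist_Cons[OF that(1)] that(2) of_nat_add of_nat_sum ..
    then show ?thesis
      by (cases "i = Suc h") (simp_all only: fps_exp_add_mult fps_exp_sum finite_Diff finite_lessThan
        if_True if_False of_nat_1 of_nat_0 fps_exp_0 simp_thms)
  qed
  have 2: "tree_wt w (Node ts) = w (length ts) * (tree_wt w (ts ! j) * (\<Prod>l\<in>?L j. tree_wt w (ts ! l)))"
    if "j < length ts" for j
  proof -
    have "prod_list (map (tree_wt w) ts) = (\<Prod>l<length ts. tree_wt w (ts ! l))"
      by (simp add: prod_nth_conv_prod_list)
    also have "\<dots> = tree_wt w (ts ! j) * (\<Prod>l\<in>?L j. tree_wt w (ts ! l))"
      using that by (intro prod.remove) auto
    finally show ?thesis by simp
  qed
  have 3: "sibling_gen w i h (ts ! l) = fps_const (tree_wt w (ts ! l)) * fps_exp (real (?n l))" for l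
    by (cases "i < h + 2") (simp_all add: sibling_gen_def lev_gen_def)
  have "spine_gen w i (Suc h) (Node ts) = fps_const (tree_wt w (Node ts)) *
     (\<Sum>j<length ts. \<Sum>v\<in>verts (ts ! j). if length v = h then fps_exp (real (at_dist i (Node ts) (j # v))) else 0)"
    by (simp add: spine_gen_def sum_verts)
  also have "\<dots> = (\<Sum>j<length ts. fps_const (tree_wt w (Node ts)) * (\<Sum>v\<in>verts (ts ! j).
      ?\<epsilon> * (if length v = h then fps_exp (real (at_dist i (ts ! j) v)) else 0) * (\<Prod>l\<in>?L j. fps_exp (real (?n l)))))"
  proof (subst sum_distrib_left, intro sum.cong refl arg_cong2[of _ _ _ _ "(*)"])
    fix j v assume "j \<in> {..<length ts}"
    then show "(if length v = h then fps_exp (real (at_dist i (Node ts) (j # v))) else 0)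
      = ?\<epsilon> * (if length v = h then fps_exp (real (at_dist i (ts ! j) v)) else 0) * (\<Prod>l\<in>?L j. fps_exp (real (?n l)))"
      by (cases "length v = h")
        (simp_all only: 1 lessThan_iff if_True if_False mult_zero_left mult_zero_right simp_thms)
  qed
  also have "\<dots> = (\<Sum>j<length ts. ?\<epsilon> * fps_const (w (length ts)) *
      (spine_gen w i h (ts ! j) * (\<Prod>l\<in>?L j. sibling_gen w i h (ts ! l))))"
  proof (intro sum.cong refl)
    fix j assume "j \<in> {..<length ts}"
    then have j: "j < length ts" by simp
    have "fps_const (tree_wt w (Node ts)) * (\<Sum>v\<in>verts (ts ! j).
      ?\<epsilon> * (if length v = h then fps_exp (real (at_dist i (ts ! j) v)) else 0) * (\<Prod>l\<in>?L j. fps_exp (real (?n l))))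
      = fps_const (tree_wt w (Node ts)) * (?\<epsilon> *
        (\<Sum>v\<in>verts (ts ! j). if length v = h then fps_exp (real (at_dist i (ts ! j) v)) else 0) * (\<Prod>l\<in>?L j. fps_exp (real (?n l))))"
      by (simp only: sum_distrib_left sum_distrib_right)
    also have "\<dots> = ?\<epsilon> * fps_const (w (length ts)) *
      (spine_gen w i h (ts ! j) * (\<Prod>l\<in>?L j. sibling_gen w i h (ts ! l)))"
      unfolding 2[OF j] 3 spine_gen_def prod.distrib prod_fps_const fps_const_mult[symmetric]
      by (simp only: mult_ac)
    finally show "fps_const (tree_wt w (Node ts)) * (\<Sum>v\<in>verts (ts ! j).
      ?\<epsilon> * (if length v = h then fps_exp (real (at_dist i (ts ! j) v)) else 0) * (\<Prod>l\<in>?L j. fps_exp (real (?n l))))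
      = ?\<epsilon> * fps_const (w (length ts)) *
      (spine_gen w i h (ts ! j) * (\<Prod>l\<in>?L j. sibling_gen w i h (ts ! l)))" .
  qed
  also have "\<dots> = (?\<epsilon> * fps_const (w (length ts))) * one_marked (spine_gen w i h) (sibling_gen w i h) ts"
    by (simp only: one_marked_def sum_distrib_left)
  finally show ?thesis .
qed

abbreviation const_fps :: "(nat \<Rightarrow> real) \<Rightarrow> real fps fps" where
  "const_fps c \<equiv> Abs_fps (\<lambda>d. fps_const (c d))"

text \<open>The number of siblings next to a vertex of the spine follows these weights; their
  generating function is the derivative of that of \<open>w\<close>.\<close>

definition size_biased :: "(nat \<Rightarrow> real) \<Rightarrow> nat \<Rightarrow> real" where
  "size_biased w d = real (Suc d) * w (Suc d)"

lemma tree_gf_lev_gen_Suc: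
  "tree_gf (lev_gen w (Suc j)) = fps_X * (const_fps w oo tree_gf (lev_gen w j))"
  by (rule tree_gf_rec) (rule lev_gen_Suc)

lemma tree_gf_wt: "tree_gf (tree_wt w) = fps_X * (Abs_fps w oo tree_gf (tree_wt w))"
  by (rule tree_gf_rec) simp

lemma tree_gf_spine_gen_Suc:
  "tree_gf (spine_gen w i (Suc h)) = fps_X * fps_const (if i = Suc h then fps_exp 1 else 1)
     * ((const_fps (size_biased w) oo tree_gf (sibling_gen w i h)) * tree_gf (spine_gen w i h))"
  (is "_ = fps_X * fps_const ?\<epsilon> * (?C * ?K)")
proof (rule fps_ext)
  fix n
  show "tree_gf (spine_gen w i (Suc h)) $ n = (fps_X * fps_const ?\<epsilon> * (?C * ?K)) $ n"
  proof (cases n)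
    case (Suc m)
    have "tree_gf (spine_gen w i (Suc h)) $ Suc m
        = (\<Sum>d\<le>m. of_nat (Suc d) * (?\<epsilon> * fps_const (w (Suc d))) * (?K * tree_gf (sibling_gen w i h) ^ d) $ m)"
      by (rule tree_gf_rec_marked) (rule spine_gen_Suc)
    also have "\<dots> = ?\<epsilon> * (\<Sum>d\<le>m. const_fps (size_biased w) $ d * (tree_gf (sibling_gen w i h) ^ d * ?K) $ m)"
      unfolding sum_distrib_left
      by (intro sum.cong refl)
        (simp only: size_biased_def fps_nth_Abs_fps fps_const_mult[symmetric] fps_of_nat mult_ac)
    also have "\<dots> = ?\<epsilon> * (?C * ?K) $ m"
      by (subst fps_compose_mult_nth) auto
    finally show ?thesis by (simp add: Suc mult.assoc)
  qed simp
qed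

lemma lev_gf_const: "fps_swap (tree_gf (lev_gen w j)) $ 0 = tree_gf (tree_wt w)"
  by (intro fps_ext) (simp add: tree_gf_def fps_sum_nth lev_gen_def)

lemma wt_gf_swap: "fps_swap (tree_gf (\<lambda>t. fps_const (tree_wt w t))) = fps_const (tree_gf (tree_wt w))"
  by (intro fps_ext) (auto simp: tree_gf_def fps_sum_nth)

lemma spine_gf_nth:
  "fps_swap (tree_gf (spine_gen w i h)) $ r $ n
    = (\<Sum>t\<in>trees n. tree_wt w t * (\<Sum>v\<in>verts t. if length v = h then real (at_dist i t v) ^ r else 0)) / fact r"
proof -
  have "spine_gen w i h t $ r = tree_wt w t * (\<Sum>v\<in>verts t. if length v = h then real (at_dist i t v) ^ r else 0) / fact r" for t
  proof -
    have "(\<Sum>v\<in>verts t. if length v = h then fps_exp (real (at_dist i t v)) else 0) $ r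
        = (\<Sum>v\<in>verts t. if length v = h then real (at_dist i t v) ^ r else 0) / fact r"
      unfolding fps_sum_nth sum_divide_distrib by (intro sum.cong refl) auto
    then show ?thesis by (simp add: spine_gen_def)
  qed
  then show ?thesis by (simp add: tree_gf_def fps_sum_nth sum_divide_distrib)
qed

text \<open>\<open>e j\<close> majorizes the excess over \<open>Y\<close> of the series for level
  \<open>j\<close>. One generation applies the Taylor series without its constant term and
  contributes the factor \<open>z\<close> for the parent; \<open>f\<close> and \<open>f'\<close>
  bound the Taylor coefficients of the offspring generating function and of its derivative.\<close>

locale tree_expansion = steiner_expansion "tree_gf (tree_wt w)" y z \<alpha> \<sigma> R
  for w :: "nat \<Rightarrow> real" and y z \<alpha> :: real and \<sigma> R :: nat +
  fixes f f' e :: "nat \<Rightarrow> real"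
  assumes f: "\<And>m. m \<in> {1..R} \<Longrightarrow> dominated y (taylor_coeff w m) (f m)"
    and f': "\<And>m. m \<le> R \<Longrightarrow> dominated y (taylor_coeff (size_biased w) m) (f' m)"
    and e_0: "y * (exp \<alpha> - 1) \<le> e 0"
    and e_Suc: "\<And>j. j < \<sigma> \<Longrightarrow> z * (\<Sum>m=1..R. f m * e j ^ m) \<le> e (Suc j)"
begin

abbreviation Y where "Y \<equiv> tree_gf (tree_wt w)"

lemma exp_partial_sum_le: "(\<Sum>l\<le>R. \<alpha> ^ l / fact l) \<le> exp \<alpha>"
proof -
  have s: "(\<lambda>l. \<alpha> ^ l / fact l) sums exp \<alpha>"
    using exp_converges[of \<alpha>] by (simp add: divide_inverse mult.commute)
  then show ?thesis using \<alpha> sum_le_suminf[OF sums_summable[OF s], of "{..R}"] by (simp add: sums_iff)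
qed

lemma dominated_const_X: "0 \<le> a \<Longrightarrow> dominated y (fps_const a * fps_X) (a * y)"
  unfolding dominated_def
proof (intro conjI allI)
  assume a: "0 \<le> a"
  fix M
  have "(\<Sum>N\<le>M. (fps_const a * fps_X) $ N * y ^ N) = (\<Sum>N\<le>M. if N = 1 then a * y else 0)"
    by (intro sum.cong) (auto simp: fps_X_nth)
  then show "(\<Sum>N\<le>M. (fps_const a * fps_X) $ N * y ^ N) \<le> a * y" using y a by (simp add: sum.delta)
qed (simp add: fps_X_nth)

lemma dominated_const: "0 \<le> a \<Longrightarrow> dominated y (fps_const a) a"
  unfolding dominated_def
proof (intro conjI allI)
  assume a: "0 \<le> a"
  fix M
  have "(\<Sum>N\<le>M. fps_const a $ N * y ^ N) = (\<Sum>N\<le>M. if N = 0 then a else 0)"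
    by (intro sum.cong) auto
  then show "(\<Sum>N\<le>M. fps_const a $ N * y ^ N) \<le> a" using a by (simp add: sum.delta)
qed auto

lemma fps_sum_X_power_nth:
  fixes c :: "nat \<Rightarrow> real fps"
  assumes "finite A"
  shows "(\<Sum>l\<in>A. fps_X ^ l * fps_const (c l)) $ r = (if r \<in> A then c r else 0)"
proof -
  have "(\<Sum>l\<in>A. fps_X ^ l * fps_const (c l)) $ r = (\<Sum>l\<in>A. if r = l then c l else 0)"
    unfolding fps_sum_nth by (intro sum.cong refl) (auto simp: fps_X_power_mult_nth)
  then show ?thesis using assms by simp
qed

lemma expands_exp: "expands 0 (exp \<alpha>) (fps_swap (fps_const (fps_exp 1)))"
proof (rule expands_cong)
  show "expands 0 (\<Sum>l\<le>R. \<alpha> ^ l * z ^ 0 * (1 / fact l)) (\<Sum>l\<le>R. mono_term l 0 (fps_const (1 / fact l)))"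
    by (intro expands_sum expands_mono_term dominated_const) auto
  show "fps_swap (fps_const (fps_exp 1)) $ r = (\<Sum>l\<le>R. mono_term l 0 (fps_const (1 / fact l))) $ r"
    if "r \<le> R" for r
    using that by (simp add: mono_term_def fps_sum_X_power_nth fps_swap_const)
  show "(\<Sum>l\<le>R. \<alpha> ^ l * z ^ 0 * (1 / fact l)) \<le> exp \<alpha>" using exp_partial_sum_le by simp
qed

text \<open>A marked root is not cut out: its tree stays in the forest as one factor
  \<open>Y\<close>, so \<open>k = 0\<close>. As a mark is present, \<open>l \<ge> 1\<close> pays for
  the negative offset.\<close>

lemma expands_lev_0: "expands (- int \<sigma>) (e 0) (fps_swap (tree_gf (lev_gen w 0)) - fps_const Y)"
proof (rule expands_cong)
  let ?c = "\<lambda>l. fps_const (1 / fact l) * fps_X :: real fps"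
  show "expands (- int \<sigma>) (\<Sum>l=1..R. \<alpha> ^ l * z ^ 0 * (1 / fact l * y)) (\<Sum>l=1..R. mono_term l 0 (?c l))"
  proof (intro expands_sum expands_mono_term dominated_const_X)
    fix l assume "l \<in> {1..R}"
    then have "1 * \<sigma> \<le> l * \<sigma>" by (intro mult_right_mono) auto
    then have "int \<sigma> \<le> int (l * \<sigma>)" by (simp only: of_nat_le_iff mult_1)
    then show "int 0 \<le> - int \<sigma> + int (l * \<sigma>)" by linarith
  qed auto
  show "(fps_swap (tree_gf (lev_gen w 0)) - fps_const Y) $ r = (\<Sum>l=1..R. mono_term l 0 (?c l)) $ r"
    if "r \<le> R" for r
  proof (cases "r = 0")
    case True
    then show ?thesis by (simp add: lev_gf_const mono_term_def fps_sum_X_power_nth)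
  next
    case False
    have "fps_swap (tree_gf (lev_gen w 0)) $ r = fps_const (1 / fact r) * Y"
      by (rule fps_ext) (simp add: tree_gf_def fps_sum_nth lev_gen_def level_size_0 sum_divide_distrib)
    then show ?thesis using that False
      by (simp add: mono_term_def fps_sum_X_power_nth fps_compose_mult_distrib[OF Y0] Y0)
  qed
  have "(\<Sum>l=1..R. \<alpha> ^ l * z ^ 0 * (1 / fact l * y)) = y * (\<Sum>l=1..R. \<alpha> ^ l / fact l)"
    by (simp add: sum_distrib_left mult_ac)
  also have "(\<Sum>l=1..R. \<alpha> ^ l / fact l) = (\<Sum>l\<le>R. \<alpha> ^ l / fact l) - 1"
    by (simp add: atMost_atLeast0 sum.atLeast_Suc_atMost)
  also have "y * \<dots> \<le> y * (exp \<alpha> - 1)"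
    using exp_partial_sum_le y by (intro mult_left_mono) auto
  also note e_0
  finally show "(\<Sum>l=1..R. \<alpha> ^ l * z ^ 0 * (1 / fact l * y)) \<le> e 0" .
qed

text \<open>The offset says that the first marked vertex on level \<open>j\<close> costs
  \<open>j\<close> inner vertices and each further one at most \<open>\<sigma>\<close>. Since
  \<open>j \<le> \<sigma>\<close>, the offset is at most 0, and powers of the increment are no worse
  than the increment itself.\<close>

lemma expands_lev:
  "j \<le> \<sigma> \<Longrightarrow> expands (int j - int \<sigma>) (e j) (fps_swap (tree_gf (lev_gen w j)) - fps_const Y)"
proof (induction j)
  case 0
  then show ?case using expands_lev_0 by simp
next
  case (Suc j)
  let ?H = "fps_swap (tree_gf (lev_gen w j))"
  let ?X = "?H - fps_const Y"
  have IH: "expands (int j - int \<sigma>) (e j) ?X" using Suc by simp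
  let ?F = "\<Sum>m=1..R. fps_const (taylor_coeff w m oo Y) * ?X ^ m"
  have F: "expands (int j - int \<sigma>) (\<Sum>m=1..R. f m * e j ^ m) ?F"
  proof (intro expands_sum)
    fix m assume m: "m \<in> {1..R}"
    have "expands (0 + int m * (int j - int \<sigma>)) (f m * e j ^ m) (fps_const (taylor_coeff w m oo Y) * ?X ^ m)"
      by (intro expands_mult expands_const_compose f m expands_power IH)
    moreover have "int m * (int j - int \<sigma>) \<le> 1 * (int j - int \<sigma>)"
      using m Suc.prems by (intro mult_right_mono_neg) auto
    ultimately show "expands (int j - int \<sigma>) (f m * e j ^ m) (fps_const (taylor_coeff w m oo Y) * ?X ^ m)"
      using expands_mono_shift by simp
  qed simp
  have "expands (1 + (int j - int \<sigma>)) (z * (\<Sum>m=1..R. f m * e j ^ m)) (fps_const fps_X * ?F)"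
    by (rule expands_mult[OF expands_const_X F])
  then have "expands (1 + (int j - int \<sigma>)) (e (Suc j)) (fps_swap (tree_gf (lev_gen w (Suc j))) - fps_const Y)"
  proof (rule expands_cong)
    show "z * (\<Sum>m=1..R. f m * e j ^ m) \<le> e (Suc j)" using Suc.prems by (intro e_Suc) simp
    fix r assume r: "r \<le> R"
    have t0: "taylor_coeff w 0 = Abs_fps w" by (simp add: taylor_coeff_def)
    have "fps_swap (tree_gf (lev_gen w (Suc j))) $ r = fps_X * fps_swap (const_fps w oo tree_gf (lev_gen w j)) $ r"
      by (simp add: tree_gf_lev_gen_Suc fps_swap_mult fps_swap_X)
    also have "fps_swap (const_fps w oo tree_gf (lev_gen w j)) $ r
      = (\<Sum>m\<le>R. fps_const (taylor_coeff w m oo Y) * ?X ^ m) $ r"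
      using fps_swap_compose_taylor[OF _ r, of "tree_gf (lev_gen w j)" w] by (simp only: lev_gf_const tree_gf_nth_0)
    also have "(\<Sum>m\<le>R. fps_const (taylor_coeff w m oo Y) * ?X ^ m) = fps_const (Abs_fps w oo Y) + ?F"
      by (simp add: atMost_atLeast0 sum.atLeast_Suc_atMost t0)
    also have "fps_X * (fps_const (Abs_fps w oo Y) + ?F) $ r
        = (fps_const (fps_X * (Abs_fps w oo Y)) + fps_const fps_X * ?F) $ r"
      by (simp add: distrib_left)
    \<comment> \<open>The Taylor term of order 0 reproduces \<open>Y\<close> and cancels.\<close>
    also have "fps_X * (Abs_fps w oo Y) = Y" by (rule tree_gf_wt[symmetric])
    finally show "(fps_swap (tree_gf (lev_gen w (Suc j))) - fps_const Y) $ r = (fps_const fps_X * ?F) $ r"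
      by simp
  qed
  then show ?case by (simp add: algebra_simps)
qed

text \<open>The offset \<open>h\<close> is the spine itself. Siblings add nothing to it, as the
  level that matters in them is below \<open>\<sigma>\<close>. Once \<open>\<sigma> < h + 2\<close>
  they carry no marks and contribute the Taylor term of order 0 only.\<close>

lemma expands_spine:
  assumes \<kappa>_0: "y + e \<sigma> \<le> \<kappa> 0"
    and \<kappa>_Suc: "\<And>h. (z * (if \<sigma> = Suc h then exp \<alpha> else 1)) *
       ((\<Sum>m\<le>R. f' m * (if \<sigma> < h + 2 then 0 else e (\<sigma> - h - 2)) ^ m) * \<kappa> h) \<le> \<kappa> (Suc h)"
  shows "expands (int h) (\<kappa> h) (fps_swap (tree_gf (spine_gen w \<sigma> h)))"
proof (induction h)
  case 0
  have l: "expands 0 (e \<sigma>) (fps_swap (tree_gf (lev_gen w \<sigma>)) - fps_const Y)"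
    using expands_lev[OF order_refl] by simp
  have "expands 0 (y + e \<sigma>) (fps_const Y + (fps_swap (tree_gf (lev_gen w \<sigma>)) - fps_const Y))"
    by (rule expands_add[OF expands_Y l])
  then show ?case using expands_cong[OF _ _ \<kappa>_0] by (simp add: spine_gen_0[abs_def])
next
  case (Suc h)
  let ?x = "if \<sigma> < h + 2 then 0 else e (\<sigma> - h - 2)"
  let ?S = "fps_swap (tree_gf (sibling_gen w \<sigma> h))"
  let ?F = "\<Sum>m\<le>R. fps_const (taylor_coeff (size_biased w) m oo Y) * (?S - fps_const Y) ^ m"
  have S0: "?S $ 0 = Y" and Sx: "expands 0 ?x (?S - fps_const Y)"
  proof -
    show "?S $ 0 = Y" unfolding sibling_gen_def
      by (cases "\<sigma> < h + 2") (simp_all add: lev_gf_const wt_gf_swap)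
    show "expands 0 ?x (?S - fps_const Y)"
    proof (cases "\<sigma> < h + 2")
      case True
      then show ?thesis unfolding sibling_gen_def by (simp add: wt_gf_swap expands_0)
    next
      case False
      then show ?thesis unfolding sibling_gen_def
        using expands_mono_shift[OF expands_lev[of "\<sigma> - h - 2"], of 0] by simp
    qed
  qed
  have F: "expands 0 (\<Sum>m\<le>R. f' m * ?x ^ m) ?F"
  proof (intro expands_sum)
    fix m assume m: "m \<in> {..R}"
    show "expands 0 (f' m * ?x ^ m) (fps_const (taylor_coeff (size_biased w) m oo Y) * (?S - fps_const Y) ^ m)"
      using expands_mult[OF expands_const_compose[OF f'] expands_power[OF Sx]] m by simp
  qed simp
  have E: "expands 0 (if \<sigma> = Suc h then exp \<alpha> else 1) (fps_swap (fps_const (if \<sigma> = Suc h then fps_exp 1 else 1)))"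
    using expands_exp expands_1 by (auto simp: fps_const_1_eq_1)
  have "expands ((1 + 0) + (0 + int h)) ((z * (if \<sigma> = Suc h then exp \<alpha> else 1)) * ((\<Sum>m\<le>R. f' m * ?x ^ m) * \<kappa> h))
     ((fps_const fps_X * fps_swap (fps_const (if \<sigma> = Suc h then fps_exp 1 else 1))) * (?F * fps_swap (tree_gf (spine_gen w \<sigma> h))))"
    by (intro expands_mult expands_const_X E F Suc)
  then have "expands ((1 + 0) + (0 + int h)) (\<kappa> (Suc h)) (fps_swap (tree_gf (spine_gen w \<sigma> (Suc h))))"
  proof (rule expands_cong[OF _ _ \<kappa>_Suc])
    fix r assume r: "r \<le> R"
    have "fps_swap (const_fps (size_biased w) oo tree_gf (sibling_gen w \<sigma> h)) $ r' = ?F $ r'" if "r' \<le> R" for r'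
      using fps_swap_compose_taylor[OF _ that, of "tree_gf (sibling_gen w \<sigma> h)" "size_biased w"]
      by (simp only: S0 tree_gf_nth_0)
    then have 1: "(fps_swap (const_fps (size_biased w) oo tree_gf (sibling_gen w \<sigma> h)) * fps_swap (tree_gf (spine_gen w \<sigma> h))) $ r'
       = (?F * fps_swap (tree_gf (spine_gen w \<sigma> h))) $ r'" if "r' \<le> R" for r'
      unfolding fps_mult_nth[of "fps_swap (const_fps _ oo _)"] fps_mult_nth[of ?F] using that by (intro sum.cong refl) auto
    show "fps_swap (tree_gf (spine_gen w \<sigma> (Suc h))) $ r
      = ((fps_const fps_X * fps_swap (fps_const (if \<sigma> = Suc h then fps_exp 1 else 1))) * (?F * fps_swap (tree_gf (spine_gen w \<sigma> h)))) $ r"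
      unfolding tree_gf_spine_gen_Suc fps_swap_mult fps_swap_X
        fps_mult_nth[of "fps_const fps_X * fps_swap _"]
      using r 1 by (intro sum.cong refl) auto
  qed
  then show ?case by (simp add: algebra_simps)
qed

end

section \<open>Local limit theorem\<close>

lemma pmf_nat_expectation_sums:
  fixes f :: "nat \<Rightarrow> 'b::{banach, second_countable_topology}"
  assumes "integrable (measure_pmf p) f"
  shows "(\<lambda>k. pmf p k *\<^sub>R f k) sums measure_pmf.expectation p f"
proof -
  have "integrable (count_space UNIV) (\<lambda>k. pmf p k *\<^sub>R f k)"
    using assms unfolding measure_pmf_eq_density by (subst (asm) integrable_density) auto
  from sums_integral_count_space_nat[OF this] show ?thesis
    unfolding measure_pmf_eq_density by (subst integral_density) auto
qed

lemma pmf_nat_sums_1: "pmf (p :: nat pmf) sums 1"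
  using pmf_nat_expectation_sums[of p "\<lambda>_. 1::real"] by simp

lemma summable_pmf_nat: "summable (pmf (p :: nat pmf))"
  using pmf_nat_sums_1 sums_summable by blast

text \<open>Real arguments serve the tail bounds, complex ones Fourier inversion.\<close>

definition pgf :: "nat pmf \<Rightarrow> 'b::real_normed_field \<Rightarrow> 'b" where
  "pgf p z = (\<Sum>d. of_real (pmf p d) * z ^ d)"

lemma fps_power_nonneg:
  fixes A :: "real fps"
  assumes "\<And>n. 0 \<le> A $ n"
  shows "0 \<le> (A ^ m) $ n"
proof (induction m arbitrary: n)
  case (Suc m)
  then show ?case using assms by (auto simp: fps_mult_nth intro!: sum_nonneg mult_nonneg_nonneg)
qed auto

lemma pmf_fps_power_nonneg [simp]: "0 \<le> (Abs_fps (pmf p) ^ m) $ n"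
  by (rule fps_power_nonneg) simp

lemma summable_pmf_fps_power: "summable (\<lambda>j. (Abs_fps (pmf p) ^ m) $ j)"
proof (induction m)
  case 0
  have "(\<lambda>j. (Abs_fps (pmf p) ^ 0) $ j) = (\<lambda>j. if j = 0 then 1 else 0)" by auto
  then show ?case using sums_summable[OF sums_single[of 0 "\<lambda>_. 1::real"]] by simp
next
  case (Suc m)
  have "summable (\<lambda>k. \<Sum>i\<le>k. pmf p i * (Abs_fps (pmf p) ^ m) $ (k - i))"
    using Suc summable_pmf_nat[of p] by (intro summable_Cauchy_product) auto
  then show ?case by (simp add: fps_mult_nth atLeast0AtMost)
qed

lemma pmf_fps_power_sums:
  fixes z :: "'b::{real_normed_field, banach}"
  assumes z: "norm z \<le> 1"
  shows "summable (\<lambda>j. norm (of_real ((Abs_fps (pmf p) ^ m) $ j) * z ^ j))"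
    and "(\<lambda>j. of_real ((Abs_fps (pmf p) ^ m) $ j) * z ^ j) sums pgf p z ^ m"
proof -
  show sm: "summable (\<lambda>j. norm (of_real ((Abs_fps (pmf p) ^ m) $ j) * z ^ j))" for m
  proof (rule summable_comparison_test'[OF summable_pmf_fps_power[of p m]])
    fix n show "norm (norm (of_real ((Abs_fps (pmf p) ^ m) $ n) * z ^ n)) \<le> (Abs_fps (pmf p) ^ m) $ n"
      using z by (auto simp: norm_mult norm_power intro!: mult_left_le power_le_one)
  qed
  show "(\<lambda>j. of_real ((Abs_fps (pmf p) ^ m) $ j) * z ^ j) sums pgf p z ^ m"
  proof (induction m)
    case 0
    have "(\<lambda>j. of_real ((Abs_fps (pmf p) ^ 0) $ j) * z ^ j) = (\<lambda>j. if j = 0 then 1 else 0)"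
      by auto
    then show ?case using sums_single[of 0 "\<lambda>_. 1::'b"] by simp
  next
    case (Suc m)
    let ?a = "\<lambda>j. of_real (pmf p j) * z ^ j" and ?b = "\<lambda>j. of_real ((Abs_fps (pmf p) ^ m) $ j) * z ^ j"
    have "(\<lambda>k. \<Sum>i\<le>k. ?a i * ?b (k - i)) sums ((\<Sum>k. ?a k) * (\<Sum>k. ?b k))"
      using sm[of 1] sm[of m] by (intro Cauchy_product_sums) auto
    moreover have "(\<Sum>i\<le>k. ?a i * ?b (k - i)) = of_real ((Abs_fps (pmf p) ^ Suc m) $ k) * z ^ k" for k
    proof -
      have "?a i * ?b (k - i) = of_real (pmf p i * (Abs_fps (pmf p) ^ m) $ (k - i)) * z ^ k" if "i \<le> k" for i
      proof -
        have "?a i * ?b (k - i) = of_real (pmf p i * (Abs_fps (pmf p) ^ m) $ (k - i)) * (z ^ i * z ^ (k - i))"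
          by (simp add: mult_ac)
        then show ?thesis using that by (simp flip: power_add)
      qed
      then have "(\<Sum>i\<le>k. ?a i * ?b (k - i)) = (\<Sum>i\<le>k. of_real (pmf p i * (Abs_fps (pmf p) ^ m) $ (k - i)) * z ^ k)"
        by (intro sum.cong refl) (simp only: atMost_iff)
      then show ?thesis
        by (simp only: sum_distrib_right[symmetric] of_real_sum[symmetric] power_Suc fps_mult_nth
          atLeast0AtMost fps_nth_Abs_fps)
    qed
    ultimately show ?case using sums_unique[OF Suc] by (simp add: pgf_def)
  qed
qed

lemma pmf_fps_power_le_1: "(Abs_fps (pmf p) ^ m) $ j \<le> 1"
proof -
  have "(\<lambda>j. (Abs_fps (pmf p) ^ m) $ j) sums (pgf p 1 ^ m :: real)"
    using pmf_fps_power_sums(2)[of "1::real" p m] by simp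
  moreover have "pgf p (1::real) = 1"
    using sums_unique[OF pmf_nat_sums_1[of p]] by (simp add: pgf_def)
  ultimately have s: "(\<lambda>j. (Abs_fps (pmf p) ^ m) $ j) sums 1" by simp
  have "(\<Sum>j\<in>{j}. (Abs_fps (pmf p) ^ m) $ j) \<le> (\<Sum>j. (Abs_fps (pmf p) ^ m) $ j)"
    by (intro sum_le_suminf sums_summable[OF s]) auto
  then show ?thesis using sums_unique[OF s] by simp
qed

lemma cis_integral:
  fixes k :: int
  assumes "k \<noteq> 0"
  shows "((\<lambda>t. cis (real_of_int k * t)) has_integral 0) {-pi..pi}"
proof -
  have "((\<lambda>t. cis (real_of_int k * t)) has_integral
     (cis (of_int k * pi) / (\<i> * of_int k) - cis (of_int k * (- pi)) / (\<i> * of_int k))) {-pi..pi}"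
  proof (rule fundamental_theorem_of_calculus)
    fix t :: real
    let ?c = "\<i> * complex_of_int k"
    have c: "?c \<noteq> 0" using assms by simp
    have "((\<lambda>w. exp (d * w) / d) has_field_derivative exp (d * w0)) (at w0)" if "d \<noteq> 0" for d w0 :: complex
      using that by (auto intro!: derivative_eq_intros)
    from this[OF c, of "of_real t"]
    have "((\<lambda>w. exp (?c * w) / ?c) has_field_derivative exp (?c * of_real t)) (at (of_real t))" .
    from has_vector_derivative_real_field[OF this, of "{-pi..pi}"]
    show "((\<lambda>t. cis (of_int k * t) / (\<i> * of_int k)) has_vector_derivative
       cis (of_int k * t)) (at t within {-pi..pi})"
      by (simp add: cis_conv_exp mult.assoc)
  qed simp
  moreover have "cis (of_int k * pi) = cis (of_int k * (- pi))"
    by (auto simp: complex_eq_iff sin_times_pi_eq_0)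
  ultimately show ?thesis by simp
qed

text \<open>The series converges uniformly on the circle, so it can be integrated term by term, and
  orthogonality leaves the term \<open>j\<close>.\<close>

lemma pmf_fps_power_fourier:
  "((\<lambda>t. pgf p (cis t) ^ m * cis (- (real j * t))) has_integral (2 * pi * (Abs_fps (pmf p) ^ m) $ j)) {-pi..pi}"
proof -
  let ?a = "\<lambda>l. complex_of_real ((Abs_fps (pmf p) ^ m) $ l)"
  let ?f = "\<lambda>N t. (\<Sum>l<N. ?a l * cis t ^ l * cis (- (real j * t)))"
  let ?g = "\<lambda>t. pgf p (cis t) ^ m * cis (- (real j * t))"
  have g: "?g t = (\<Sum>l. ?a l * cis t ^ l * cis (- (real j * t)))" for t
    using pmf_fps_power_sums(2)[of "cis t" p m]
    by (simp add: sums_iff suminf_mult2[symmetric])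
  have ul: "uniform_limit {-pi..pi} ?f ?g sequentially"
    unfolding g
    by (rule Weierstrass_m_test[OF _ summable_pmf_fps_power[of p m]])
      (simp add: norm_mult norm_power)
  have cont: "continuous_on {-pi..pi} (?f N)" for N
    unfolding cis_conv_exp by (intro continuous_intros)
  obtain I J where I: "\<And>N. (?f N has_integral I N) {-pi..pi}" and J: "(?g has_integral J) {-pi..pi}"
      and lim: "I \<longlonglongrightarrow> J"
    using uniform_limit_integral[OF ul cont trivial_limit_sequentially] by blast
  have e: "cis t ^ l * cis (- (real j * t)) = cis (real_of_int (int l - int j) * t)" for l t
    by (simp add: Complex.DeMoivre cis_mult algebra_simps)
  have "((\<lambda>t. ?a l * cis t ^ l * cis (- (real j * t))) has_integral (if l = j then 2 * pi * ?a j else 0)) {-pi..pi}" for l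
  proof (cases "l = j")
    case True
    have "(\<lambda>t. ?a l * cis t ^ l * cis (- (real j * t))) = (\<lambda>t. ?a j)"
      using True e by (auto simp: mult.assoc)
    then show ?thesis using True has_integral_const_real[of "?a j" "-pi" pi]
      by (simp add: scaleR_conv_of_real)
  next
    case False
    have "(\<lambda>t. ?a l * cis t ^ l * cis (- (real j * t))) = (\<lambda>t. ?a l * cis (real_of_int (int l - int j) * t))"
      by (simp only: e mult.assoc)
    then show ?thesis
      using has_integral_mult_right[OF cis_integral[of "int l - int j"], of "?a l"] False by simp
  qed
  then have "(?f N has_integral (\<Sum>l<N. if l = j then 2 * pi * ?a j else 0)) {-pi..pi}" for N
    by (intro has_integral_sum) auto
  then have "I N = (\<Sum>l<N. if l = j then 2 * pi * ?a j else 0)" for N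
    using I has_integral_unique by blast
  then have "I N = 2 * pi * ?a j" if "N > j" for N using that by (simp add: sum.delta)
  then have "I \<longlonglongrightarrow> 2 * pi * ?a j"
    by (intro tendsto_eventually) (auto simp: eventually_sequentially intro!: exI[of _ "Suc j"])
  then have "J = 2 * pi * ?a j" using lim LIMSEQ_unique by blast
  then show ?thesis using J by simp
qed

section \<open>Decay of the characteristic function\<close>

lemma pgf_cis_eq_char: "pgf p (cis t) = char (distr (measure_pmf p) borel real) t"
proof -
  have "integrable (measure_pmf p) (\<lambda>k. cis (t * real k))"
    by (rule measure_pmf.integrable_const_bound[where B = 1]) auto
  from pmf_nat_expectation_sums[OF this]
  have "(\<lambda>k. pmf p k *\<^sub>R cis (t * real k)) sums char (distr (measure_pmf p) borel real) t"
    unfolding char_def by (simp add: integral_distr cis_conv_exp)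
  moreover have "(\<lambda>k. pmf p k *\<^sub>R cis (t * real k)) = (\<lambda>k. of_real (pmf p k) * cis t ^ k)"
    by (simp add: scaleR_conv_of_real Complex.DeMoivre mult.commute)
  ultimately show ?thesis by (simp add: pgf_def sums_iff)
qed

lemma continuous_on_pgf_cis: "continuous_on S (\<lambda>t. pgf p (cis t))"
proof -
  interpret real_distribution "distr (measure_pmf p) borel real"
    by (rule prob_space.real_distribution_distr[OF measure_pmf.prob_space_axioms]) simp
  show ?thesis unfolding pgf_cis_eq_char
    by (intro continuous_at_imp_continuous_on ballI isCont_char)
qed

text \<open>All atoms except 0 and \<open>b\<close> are estimated by their mass; the cancellation
  between these two is already enough.\<close>

lemma norm_pgf_cis_le:
  assumes "b > 0"
  shows "norm (pgf p (cis t))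
    \<le> 1 - (pmf p 0 + pmf p b) + norm (of_real (pmf p 0) + of_real (pmf p b) * cis (real b * t))"
proof -
  let ?f = "\<lambda>d. complex_of_real (pmf p d) * cis t ^ d"
  have sm: "?f sums pgf p (cis t)"
    using pmf_fps_power_sums(2)[of "cis t" p 1] by simp
  have 1: "(\<lambda>d. if d \<in> {0, b} then ?f d else 0) sums (\<Sum>d\<in>{0, b}. ?f d)"
    by (rule sums_If_finite_set) simp
  have 2: "(\<lambda>d. if d \<in> {0, b} then pmf p d else 0) sums (\<Sum>d\<in>{0, b}. pmf p d)"
    by (rule sums_If_finite_set) simp
  have g: "(\<lambda>d. ?f d - (if d \<in> {0, b} then ?f d else 0)) sums (pgf p (cis t) - (\<Sum>d\<in>{0, b}. ?f d))"
    by (rule sums_diff[OF sm 1])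
  have h: "(\<lambda>d. pmf p d - (if d \<in> {0, b} then pmf p d else 0)) sums (1 - (\<Sum>d\<in>{0, b}. pmf p d))"
    by (rule sums_diff[OF pmf_nat_sums_1 2])
  have eq: "norm (?f d - (if d \<in> {0, b} then ?f d else 0)) = pmf p d - (if d \<in> {0, b} then pmf p d else 0)" for d
    by (simp add: norm_mult norm_power)
  have "norm (pgf p (cis t) - (\<Sum>d\<in>{0, b}. ?f d)) \<le> 1 - (\<Sum>d\<in>{0, b}. pmf p d)"
    using summable_norm[of "\<lambda>d. ?f d - (if d \<in> {0, b} then ?f d else 0)"] g h
    unfolding eq by (auto simp: sums_iff)
  then have "norm (pgf p (cis t) - (\<Sum>d\<in>{0, b}. ?f d)) \<le> 1 - (pmf p 0 + pmf p b)"
    using assms by simp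
  moreover have "norm (pgf p (cis t)) \<le> norm (pgf p (cis t) - (\<Sum>d\<in>{0, b}. ?f d)) + norm (\<Sum>d\<in>{0, b}. ?f d)"
    by (metis diff_add_cancel norm_triangle_ineq)
  moreover have "(\<Sum>d\<in>{0, b}. ?f d) = of_real (pmf p 0) + of_real (pmf p b) * cis (real b * t)"
    using assms by (simp add: Complex.DeMoivre)
  ultimately show ?thesis by simp
qed

text \<open>With \<open>s = \<alpha> + \<beta>\<close> and
  \<open>q = \<alpha> * \<beta> * (1 - cos \<tau>)\<close> the squared modulus is
  \<open>s\<^sup>2 - 2 * q\<close>, which is at most \<open>(s - q / s)\<^sup>2\<close>.\<close>

lemma norm_two_point_le:
  fixes \<alpha> \<beta> :: real
  assumes "\<alpha> > 0" "\<beta> > 0"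
  shows "norm (of_real \<alpha> + of_real \<beta> * cis \<tau>) \<le> (\<alpha> + \<beta>) - \<alpha> * \<beta> / (\<alpha> + \<beta>) * (1 - cos \<tau>)"
proof (rule power2_le_imp_le)
  let ?s = "\<alpha> + \<beta>" and ?q = "\<alpha> * \<beta> * (1 - cos \<tau>)"
  have s: "?s > 0" using assms by simp
  have "(norm (of_real \<alpha> + of_real \<beta> * cis \<tau>))\<^sup>2 = (\<alpha> + \<beta> * cos \<tau>)\<^sup>2 + (\<beta> * sin \<tau>)\<^sup>2"
    by (simp add: cmod_power2)
  also have "\<dots> = \<alpha>\<^sup>2 + 2 * \<alpha> * \<beta> * cos \<tau> + \<beta>\<^sup>2 * ((sin \<tau>)\<^sup>2 + (cos \<tau>)\<^sup>2)"
    by algebra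
  also have "\<dots> = ?s\<^sup>2 - 2 * ?q"
    unfolding sin_cos_squared_add by (simp add: power2_eq_square algebra_simps)
  also have "\<dots> \<le> (?s - ?q / ?s)\<^sup>2"
  proof -
    have "(x - q / x)\<^sup>2 = x\<^sup>2 - 2 * q + (q / x)\<^sup>2" if "x > 0" for x q :: real
      using that by (simp add: power2_diff)
    from this[OF s, of ?q] show ?thesis by simp
  qed
  finally show "(norm (of_real \<alpha> + of_real \<beta> * cis \<tau>))\<^sup>2 \<le> (?s - \<alpha> * \<beta> / ?s * (1 - cos \<tau>))\<^sup>2"
    by simp
  have "?q \<le> \<alpha> * \<beta> * 2"
    using assms by (intro mult_left_mono) (use cos_ge_minus_one[of \<tau>] in auto)
  also have "\<dots> \<le> ?s * ?s" using assms by (simp add: algebra_simps)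
  finally have "?q / ?s \<le> ?s" using s by (simp add: divide_le_eq)
  then show "0 \<le> ?s - \<alpha> * \<beta> / ?s * (1 - cos \<tau>)" by simp
qed

text \<open>As 0 is an atom, the span of the lattice that carries the distribution is the greatest
  common divisor of its atoms.\<close>

locale span_one =
  fixes a :: "nat pmf"
  assumes pmf_0: "pmf a 0 > 0"
    and span: "\<And>d. (\<And>k. pmf a k > 0 \<Longrightarrow> d dvd k) \<Longrightarrow> d = 1"
begin

lemma ex_pos_atom: obtains b where "b > 0" "pmf a b > 0"
proof -
  have "\<exists>b>0. pmf a b > 0"
  proof (rule ccontr)
    assume no: "\<not> ?thesis"
    have "2 dvd k" if "pmf a k > 0" for k proof -
      have "k = 0" using that no by (metis neq0_conv)
      then show ?thesis by simp
    qed
    then show False using span[of 2] by simp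
  qed
  then show ?thesis using that by blast
qed

text \<open>Modulus 1 forces every atom into phase with the atom 0, so
  \<open>cis (k * t) = 1\<close> for all atoms \<open>k\<close>. The numbers with this property are
  closed under remainders; the least positive one divides all atoms, hence is 1.\<close>

lemma norm_pgf_cis_less_1:
  assumes "t \<noteq> 0" "\<bar>t\<bar> \<le> pi"
  shows "norm (pgf a (cis t)) < 1"
proof (rule ccontr)
  assume "\<not> ?thesis"
  then have ge: "norm (pgf a (cis t)) \<ge> 1" by simp
  have one: "cis (real k * t) = 1" if k: "pmf a k > 0" for k
  proof (cases "k = 0")
    case False
    then have "norm (pgf a (cis t)) \<le> 1 - pmf a 0 * pmf a k / (pmf a 0 + pmf a k) * (1 - cos (real k * t))"
      using norm_pgf_cis_le[of k a t] norm_two_point_le[OF pmf_0 k, of "real k * t"] by simp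
    then have "pmf a 0 * pmf a k / (pmf a 0 + pmf a k) * (1 - cos (real k * t)) \<le> 0"
      using ge by simp
    moreover have "pmf a 0 * pmf a k / (pmf a 0 + pmf a k) > 0" using pmf_0 k by simp
    ultimately have "1 - cos (real k * t) \<le> 0" using mult_pos_pos not_less by blast
    then have "cos (real k * t) = 1" using cos_le_one[of "real k * t"] by simp
    then show ?thesis using sin_cos_squared_add[of "real k * t"] by (simp add: complex_eq_iff)
  qed simp
  obtain b where b: "b > 0" "pmf a b > 0" by (rule ex_pos_atom)
  define g where "g = (LEAST g. g > 0 \<and> cis (real g * t) = 1)"
  have g: "g > 0 \<and> cis (real g * t) = 1"
    unfolding g_def by (rule LeastI[of _ b]) (use b one in auto)
  have least: "g \<le> k" if "k > 0" "cis (real k * t) = 1" for k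
    unfolding g_def using that by (intro Least_le) simp
  have "g dvd k" if k: "pmf a k > 0" for k
  proof (rule ccontr)
    assume "\<not> g dvd k"
    then have r: "k mod g > 0" "k mod g < g" using g by (auto simp: dvd_eq_mod_eq_0)
    have "real k * t = real (k div g) * (real g * t) + real (k mod g) * t"
    proof -
      have "real k = real (k div g) * real g + real (k mod g)"
        using div_mult_mod_eq[of k g] by (metis of_nat_add of_nat_mult)
      then show ?thesis by (simp add: algebra_simps)
    qed
    then have "cis (real k * t) = cis (real g * t) ^ (k div g) * cis (real (k mod g) * t)"
      by (simp add: Complex.DeMoivre cis_mult)
    then have "cis (real (k mod g) * t) = 1" using one[OF k] g by simp
    then show False using least[OF r(1)] r(2) by simp
  qed
  then have "g = 1" by (rule span)
  then have "cos t = 1" using g by (simp add: complex_eq_iff)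
  then obtain n :: int where n: "t = of_int n * 2 * pi" by (auto simp: cos_one_2pi_int)
  then have "n \<noteq> 0" using assms(1) by auto
  then have "\<bar>real_of_int n\<bar> \<ge> 1" by linarith
  then have "1 * (2 * pi) \<le> \<bar>real_of_int n\<bar> * (2 * pi)"
    by (intro mult_right_mono) auto
  then have "\<bar>t\<bar> \<ge> 2 * pi" unfolding n by (simp add: abs_mult)
  then show False using assms(2) pi_gt_zero by linarith
qed

text \<open>Near 0 the two-point bound for a single atom \<open>b\<close> is quadratic in
  \<open>t\<close>. On the rest of the interval the modulus stays below 1 by compactness.\<close>

lemma norm_pgf_cis_bound:
  obtains c where "c > 0" "\<And>t. \<bar>t\<bar> \<le> pi \<Longrightarrow> norm (pgf a (cis t)) \<le> 1 - c * t\<^sup>2"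
proof -
  obtain b where b: "b > 0" "pmf a b > 0" by (rule ex_pos_atom)
  define q where "q = pmf a 0 * pmf a b / (pmf a 0 + pmf a b)"
  have q: "q > 0" using b pmf_0 by (simp add: q_def)
  have "((\<lambda>t::real. (1 - cos t) / t\<^sup>2) \<longlongrightarrow> 1/2) (at 0)" by real_asymp
  then have "eventually (\<lambda>t::real. (1 - cos t) / t\<^sup>2 > 1/4) (at 0)"
    by (rule order_tendstoD) simp
  then obtain d where d: "d > 0" "\<And>t::real. t \<noteq> 0 \<Longrightarrow> \<bar>t\<bar> < d \<Longrightarrow> (1 - cos t) / t\<^sup>2 > 1/4"
    unfolding eventually_at by (auto simp: dist_real_def)
  have near: "norm (pgf a (cis t)) \<le> 1 - q * (real b)\<^sup>2 / 4 * t\<^sup>2" if "\<bar>t\<bar> < d / real b" for t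
  proof (cases "t = 0")
    case True
    then show ?thesis using norm_pgf_cis_le[of b a 0] b(1) by (simp flip: of_real_add)
  next
    case False
    have "\<bar>real b * t\<bar> < d" using that b by (simp add: abs_mult field_simps)
    then have "1 - cos (real b * t) \<ge> (real b * t)\<^sup>2 / 4"
      using d(2)[of "real b * t"] False b by (simp add: less_divide_eq)
    then have "q * (1 - cos (real b * t)) \<ge> q * ((real b * t)\<^sup>2 / 4)" using q by simp
    moreover have "norm (pgf a (cis t)) \<le> 1 - q * (1 - cos (real b * t))"
      using norm_pgf_cis_le[OF b(1), of a t] norm_two_point_le[OF pmf_0 b(2), of "real b * t"]
      by (simp add: q_def)
    ultimately show ?thesis by (simp add: power_mult_distrib)
  qed
  define K where "K = {t. d / real b \<le> \<bar>t\<bar> \<and> \<bar>t\<bar> \<le> pi}"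
  have "K = cball 0 pi - ball 0 (d / real b)" by (auto simp: K_def)
  then have K: "compact K" by (simp add: compact_diff)
  have "\<exists>e>0. \<forall>t\<in>K. norm (pgf a (cis t)) \<le> 1 - e"
  proof (cases "K = {}")
    case False
    obtain t0 where t0: "t0 \<in> K" "\<And>t. t \<in> K \<Longrightarrow> norm (pgf a (cis t)) \<le> norm (pgf a (cis t0))"
      using continuous_attains_sup[OF K False, of "\<lambda>t. norm (pgf a (cis t))"]
        continuous_on_norm[OF continuous_on_pgf_cis] by blast
    have "d / real b > 0" using d b by simp
    then have "norm (pgf a (cis t0)) < 1"
      using t0(1) by (intro norm_pgf_cis_less_1) (auto simp: K_def)
    then show ?thesis using t0(2) by (intro exI[of _ "1 - norm (pgf a (cis t0))"]) auto
  qed (auto intro: exI[of _ 1])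
  then obtain e where e: "e > 0" "\<And>t. t \<in> K \<Longrightarrow> norm (pgf a (cis t)) \<le> 1 - e" by blast
  define c where "c = min (q * (real b)\<^sup>2 / 4) (e / pi\<^sup>2)"
  show ?thesis
  proof
    show "c > 0" using q b e by (simp add: c_def)
    fix t :: real assume t: "\<bar>t\<bar> \<le> pi"
    show "norm (pgf a (cis t)) \<le> 1 - c * t\<^sup>2"
    proof (cases "\<bar>t\<bar> < d / real b")
      case True
      have "c * t\<^sup>2 \<le> q * (real b)\<^sup>2 / 4 * t\<^sup>2" 
        unfolding c_def by (intro mult_right_mono min.cobounded1) simp
      then show ?thesis using near[OF True] by linarith
    next
      case False
      have "c * t\<^sup>2 \<le> e / pi\<^sup>2 * pi\<^sup>2"
        using e t by (intro mult_mono) (auto simp: c_def abs_le_square_iff[symmetric])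
      then have "c * t\<^sup>2 \<le> e" by simp
      then show ?thesis using e(2)[of t] False t by (auto simp: K_def)
    qed
  qed
qed

end

section \<open>Concentration and the local limit\<close>

lemma gaussian_has_integral:
  assumes "k > 0"
  shows "((\<lambda>x. exp (- k * x\<^sup>2)) has_integral sqrt (pi / k)) (UNIV :: real set)"
proof -
  define \<sigma> where "\<sigma> = sqrt (1 / (2 * k))"
  have \<sigma>: "\<sigma> > 0" "\<sigma>\<^sup>2 = 1 / (2 * k)" using assms by (auto simp: \<sigma>_def)
  have "(normal_density 0 \<sigma> has_integral 1) UNIV"
    using has_integral_integral_lborel[of "normal_density 0 \<sigma>"] \<sigma>(1)
    by (simp add: integrable_normal_density integral_normal_density)
  from has_integral_mult_right[OF this, of "sqrt (pi / k)"]
  have "((\<lambda>x. sqrt (pi / k) * normal_density 0 \<sigma> x) has_integral sqrt (pi / k)) UNIV" by simp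
  moreover have "sqrt (pi / k) * normal_density 0 \<sigma> x = exp (- k * x\<^sup>2)" for x
    using assms by (simp add: normal_density_def \<sigma>(2) field_simps)
  ultimately show ?thesis by simp
qed

context span_one begin

text \<open>Uniform concentration: in the inversion integral the \<open>m\<close>-th power is
  dominated by a Gaussian whose integral is of order \<open>1 / sqrt m\<close>.\<close>

lemma pmf_fps_power_le_inv_sqrt:
  obtains C where "C > 0" "\<And>m j. m \<ge> 1 \<Longrightarrow> (Abs_fps (pmf a) ^ m) $ j \<le> C / sqrt (real m)"
proof -
  obtain c where c: "c > 0" "\<And>t. \<bar>t\<bar> \<le> pi \<Longrightarrow> norm (pgf a (cis t)) \<le> 1 - c * t\<^sup>2"
    by (rule norm_pgf_cis_bound) blast
  have "(Abs_fps (pmf a) ^ m) $ j \<le> sqrt (pi / c) / sqrt (real m)" if m: "m \<ge> 1" for m j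
  proof -
    have le: "norm (pgf a (cis t) ^ m * cis (- (real j * t))) \<le> exp (- (real m * c) * t\<^sup>2)"
      if t: "t \<in> {-pi..pi}" for t
    proof -
      have "norm (pgf a (cis t)) \<le> exp (- (c * t\<^sup>2))"
      proof -
        have "\<bar>t\<bar> \<le> pi" using t by (auto simp: abs_le_iff)
        from c(2)[OF this] show ?thesis using exp_ge_add_one_self[of "- (c * t\<^sup>2)"] by simp
      qed
      then have "norm (pgf a (cis t)) ^ m \<le> exp (- (c * t\<^sup>2)) ^ m" by (intro power_mono) auto
      then show ?thesis by (simp add: norm_mult norm_power exp_of_nat_mult[symmetric] mult_ac)
    qed
    have g: "((\<lambda>x. exp (- (real m * c) * x\<^sup>2)) has_integral sqrt (pi / (real m * c))) UNIV"
      using m c by (intro gaussian_has_integral) simp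
    have gi: "(\<lambda>x. exp (- (real m * c) * x\<^sup>2)) integrable_on {-pi..pi}"
      by (intro integrable_continuous_real continuous_intros)
    have "2 * pi * (Abs_fps (pmf a) ^ m) $ j = norm (complex_of_real (2 * pi * (Abs_fps (pmf a) ^ m) $ j))"
      by (simp add: norm_mult)
    also have "\<dots> \<le> integral {-pi..pi} (\<lambda>x. exp (- (real m * c) * x\<^sup>2))"
      using integral_norm_bound_integral[OF has_integral_integrable[OF pmf_fps_power_fourier] gi le]
      unfolding integral_unique[OF pmf_fps_power_fourier] by simp
    also have "\<dots> \<le> integral UNIV (\<lambda>x. exp (- (real m * c) * x\<^sup>2))"
      by (rule integral_subset_le) (use gi g in auto)
    also have "\<dots> = sqrt (pi / c) / sqrt (real m)"
      unfolding integral_unique[OF g] by (simp add: real_sqrt_divide real_sqrt_mult)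
    finally have "2 * pi * (Abs_fps (pmf a) ^ m) $ j \<le> sqrt (pi / c) / sqrt (real m)" .
    moreover have "1 * (Abs_fps (pmf a) ^ m) $ j \<le> 2 * pi * (Abs_fps (pmf a) ^ m) $ j"
      using pi_ge_two by (intro mult_right_mono) auto
    ultimately show ?thesis by simp
  qed
  then show ?thesis using that[of "sqrt (pi / c)"] c by auto
qed

end

text \<open>The central limit theorem on the side of characteristic functions. The remainder after
  second order, a minimum of a square and a small multiple of a cube, vanishes by dominated
  convergence, so two moments suffice.\<close>

lemma (in prob_space) char_power_tendsto:
  fixes X :: "'a \<Rightarrow> real"
  assumes X: "random_variable borel X" and X2: "integrable M (\<lambda>x. (X x)\<^sup>2)"
    and mean: "expectation X = 0" and var: "expectation (\<lambda>x. (X x)\<^sup>2) = v"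
  shows "(\<lambda>m. char (distr M borel X) (s / sqrt (real m)) ^ m) \<longlonglongrightarrow> of_real (exp (- (v * s\<^sup>2 / 2)))"
proof -
  note [measurable] = X
  have X1: "integrable M X" by (rule square_integrable_imp_integrable[OF X X2])
  interpret D: real_distribution "distr M borel X" by (rule real_distribution_distr[OF X])
  let ?\<psi> = "char (distr M borel X)" and ?t = "\<lambda>m. s / sqrt (real m)"
  let ?r = "\<lambda>t. expectation (\<lambda>x. min (6 * (X x)\<^sup>2) (\<bar>t\<bar> * \<bar>X x\<bar> ^ 3))"
  have v: "variance X = v" using mean var by simp
  have t0: "?t \<longlonglongrightarrow> 0" by real_asymp
  have "(\<lambda>m. ?r (?t m)) \<longlonglongrightarrow> expectation (\<lambda>x. 0)"
  proof (rule integral_dominated_convergence[where w = "\<lambda>x. 6 * (X x)\<^sup>2"])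
    show "AE x in M. (\<lambda>m. min (6 * (X x)\<^sup>2) (\<bar>?t m\<bar> * \<bar>X x\<bar> ^ 3)) \<longlonglongrightarrow> 0"
    proof (rule AE_I2)
      fix x
      have "(\<lambda>m. min (6 * (X x)\<^sup>2) (\<bar>?t m\<bar> * \<bar>X x\<bar> ^ 3)) \<longlonglongrightarrow> min (6 * (X x)\<^sup>2) (\<bar>0\<bar> * \<bar>X x\<bar> ^ 3)"
        by (intro tendsto_intros t0)
      then show "(\<lambda>m. min (6 * (X x)\<^sup>2) (\<bar>?t m\<bar> * \<bar>X x\<bar> ^ 3)) \<longlonglongrightarrow> 0" by simp
    qed
  qed (use X2 in auto)
  then have r0: "(\<lambda>m. s\<^sup>2 / 6 * ?r (?t m)) \<longlonglongrightarrow> 0"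
    using tendsto_mult_right_zero[of "\<lambda>m. ?r (?t m)"] by simp
  have lim: "(\<lambda>m. complex_of_real ((1 + (- (v * s\<^sup>2 / 2)) / real m) ^ m)) \<longlonglongrightarrow> of_real (exp (- (v * s\<^sup>2 / 2)))"
    by (intro tendsto_of_real tendsto_exp_limit_sequentially)
  have "(\<lambda>m. (v * s\<^sup>2 / 2) / real m) \<longlonglongrightarrow> 0" by (rule lim_const_over_n)
  then have ev: "eventually (\<lambda>m. (v * s\<^sup>2 / 2) / real m < 1) sequentially"
    by (rule order_tendstoD) simp
  have "eventually (\<lambda>m. norm (?\<psi> (?t m) ^ m - of_real ((1 + (- (v * s\<^sup>2 / 2)) / real m) ^ m))
      \<le> s\<^sup>2 / 6 * ?r (?t m)) sequentially"
    using ev eventually_gt_at_top[of 0]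
  proof eventually_elim
    case (elim m)
    have v0: "v \<ge> 0" unfolding var[symmetric] by simp
    have "0 \<le> (v * s\<^sup>2 / 2) / real m" using v0 by simp
    then have n1: "norm (complex_of_real (1 + (- (v * s\<^sup>2 / 2)) / real m)) \<le> 1"
      unfolding norm_of_real using elim(1) by (simp add: abs_le_iff)
    have sq: "(?t m)\<^sup>2 = s\<^sup>2 / real m" using elim by (simp add: power_divide)
    have "norm (?\<psi> (?t m) ^ m - of_real (1 + (- (v * s\<^sup>2 / 2)) / real m) ^ m)
        \<le> real m * norm (?\<psi> (?t m) - of_real (1 + (- (v * s\<^sup>2 / 2)) / real m))"
      by (rule norm_power_diff[OF D.cmod_char_le_1 n1])
    also have "\<dots> \<le> real m * ((?t m)\<^sup>2 / 6 * ?r (?t m))"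
    proof (intro mult_left_mono)
      have e: "1 + (- (v * s\<^sup>2 / 2)) / real m = 1 - (?t m)\<^sup>2 * v / 2"
        unfolding sq by (simp add: mult.commute)
      show "norm (?\<psi> (?t m) - of_real (1 + (- (v * s\<^sup>2 / 2)) / real m)) \<le> (?t m)\<^sup>2 / 6 * ?r (?t m)"
        unfolding e by (rule char_approx3'[OF X X1 X2 mean v refl])
    qed simp
    also have "real m * ((?t m)\<^sup>2 / 6 * ?r (?t m)) = s\<^sup>2 / 6 * ?r (?t m)"
      unfolding sq using elim by simp
    finally show ?case unfolding of_real_power .
  qed
  then have "(\<lambda>m. ?\<psi> (?t m) ^ m - of_real ((1 + (- (v * s\<^sup>2 / 2)) / real m) ^ m)) \<longlonglongrightarrow> 0"
    using r0 by (rule Lim_null_comparison)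
  from tendsto_add[OF this lim] show ?thesis by simp
qed

text \<open>In the rescaled inversion integral the integrand converges to a Gaussian and is
  dominated by another one. A target within 1 of the mean adds a phase of order
  \<open>s / sqrt m\<close>, which disappears in the limit; so \<open>sqrt m\<close> times the
  coefficient has a positive limit.\<close>

theorem (in span_one) local_limit_lower_bound:
  fixes j :: "nat \<Rightarrow> nat"
  assumes sq: "integrable (measure_pmf a) (\<lambda>k. (real k)\<^sup>2)"
    and var: "measure_pmf.variance a real > 0"
    and j: "\<And>m. \<bar>real (j m) - real m * measure_pmf.expectation a real\<bar> \<le> 1"
  shows "\<exists>c>0. eventually (\<lambda>m. (Abs_fps (pmf a) ^ m) $ j m \<ge> c / sqrt (real m)) sequentially"
proof -
  define \<mu> where "\<mu> = measure_pmf.expectation a real"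
  define v where "v = measure_pmf.variance a real"
  have v: "v > 0" using var by (simp add: v_def)
  define X where "X = (\<lambda>k. real k - \<mu>)"
  define \<psi> where "\<psi> = char (distr (measure_pmf a) borel X)"
  define \<delta> where "\<delta> m = real (j m) - real m * \<mu>" for m
  have i1: "integrable (measure_pmf a) real"
    by (rule measure_pmf.square_integrable_imp_integrable[OF _ sq]) simp
  have X2: "integrable (measure_pmf a) (\<lambda>k. (X k)\<^sup>2)"
    unfolding X_def power2_diff using i1 sq by auto
  have X0: "measure_pmf.expectation a X = 0"
    unfolding X_def using i1 by (simp add: \<mu>_def)
  have Xv: "measure_pmf.expectation a (\<lambda>k. (X k)\<^sup>2) = v"
    by (simp add: X_def v_def \<mu>_def)
  have \<psi>: "\<psi> t = pgf a (cis t) * cis (- (\<mu> * t))" for t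
  proof -
    have "\<psi> t = measure_pmf.expectation a (\<lambda>k. iexp (t * real k) * cis (- (\<mu> * t)))"
      unfolding \<psi>_def char_def
      by (subst integral_distr) (auto simp: X_def cis_conv_exp exp_add[symmetric] algebra_simps)
    also have "\<dots> = pgf a (cis t) * cis (- (\<mu> * t))"
      unfolding pgf_cis_eq_char char_def by (simp add: integral_distr)
    finally show ?thesis .
  qed
  have lim\<psi>: "(\<lambda>m. \<psi> (s / sqrt (real m)) ^ m) \<longlonglongrightarrow> of_real (exp (- (v * s\<^sup>2 / 2)))" for s
    unfolding \<psi>_def by (rule measure_pmf.char_power_tendsto) (use X2 X0 Xv in auto)
  obtain c where c: "c > 0" "\<And>t. \<bar>t\<bar> \<le> pi \<Longrightarrow> norm (pgf a (cis t)) \<le> 1 - c * t\<^sup>2"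
    by (rule norm_pgf_cis_bound) blast
  let ?S = "\<lambda>m. {- (pi * sqrt (real m))..pi * sqrt (real m)}"
  \<comment> \<open>Extension by 0 beyond the stretched interval gives all integrals the same
    domain, as dominated convergence requires.\<close>
  define F where "F m s = (if s \<in> ?S m then \<psi> (s / sqrt (real m)) ^ m * cis (- (\<delta> m * (s / sqrt (real m)))) else 0)" for m s
  have F_int: "(F m has_integral (sqrt (real m) * (2 * pi * (Abs_fps (pmf a) ^ m) $ j m))) UNIV" if m: "m \<ge> 1" for m
  proof -
    have sm: "sqrt (real m) > 0" using m by simp
    have "((\<lambda>x. pgf a (cis ((1 / sqrt (real m)) *\<^sub>R x + 0)) ^ m * cis (- (real (j m) * ((1 / sqrt (real m)) *\<^sub>R x + 0))))
       has_integral complex_of_real (2 * pi * (Abs_fps (pmf a) ^ m) $ j m) /\<^sub>R (1 / sqrt (real m)) ^ DIM(real))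
       (cbox ((- pi - 0) /\<^sub>R (1 / sqrt (real m))) ((pi - 0) /\<^sub>R (1 / sqrt (real m))))"
      by (rule has_integral_affinity') (use pmf_fps_power_fourier[of a m "j m"] sm in auto)
    then have "((\<lambda>s. pgf a (cis (s / sqrt (real m))) ^ m * cis (- (real (j m) * (s / sqrt (real m)))))
       has_integral complex_of_real (sqrt (real m) * (2 * pi * (Abs_fps (pmf a) ^ m) $ j m))) (?S m)"
      by (simp add: scaleR_conv_of_real mult_ac)
    moreover have "pgf a (cis t) ^ m * cis (- (real (j m) * t)) = \<psi> t ^ m * cis (- (\<delta> m * t))" for t
      unfolding \<psi> \<delta>_def power_mult_distrib Complex.DeMoivre mult.assoc cis_mult
      by (simp add: algebra_simps)
    ultimately have "((\<lambda>s. \<psi> (s / sqrt (real m)) ^ m * cis (- (\<delta> m * (s / sqrt (real m)))))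
       has_integral complex_of_real (sqrt (real m) * (2 * pi * (Abs_fps (pmf a) ^ m) $ j m))) (?S m)"
      by (simp only:)
    then show ?thesis unfolding F_def has_integral_restrict_UNIV .
  qed
  have F_le: "norm (F m s) \<le> exp (- c * s\<^sup>2)" if m: "m \<ge> 1" for m s
  proof (cases "s \<in> ?S m")
    case True
    let ?t = "s / sqrt (real m)"
    have sm: "sqrt (real m) > 0" using m by simp
    have t: "\<bar>?t\<bar> \<le> pi" using True sm by (auto simp: abs_le_iff field_simps)
    have "norm (\<psi> ?t) \<le> exp (- (c * ?t\<^sup>2))"
      using c(2)[OF t] exp_ge_add_one_self[of "- (c * ?t\<^sup>2)"] by (simp add: \<psi> norm_mult)
    then have "norm (\<psi> ?t) ^ m \<le> exp (- (c * ?t\<^sup>2)) ^ m" by (intro power_mono) auto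
    also have "\<dots> = exp (- c * s\<^sup>2)" using m by (simp add: exp_of_nat_mult[symmetric] power_divide)
    finally show ?thesis using True by (simp add: F_def norm_mult norm_power)
  qed (auto simp: F_def)
  have F_lim: "(\<lambda>m. F (Suc m) s) \<longlonglongrightarrow> of_real (exp (- (v * s\<^sup>2 / 2)))" for s
  proof -
    have t0: "(\<lambda>m. s / sqrt (real m)) \<longlonglongrightarrow> 0" by real_asymp
    have d0: "(\<lambda>m. \<delta> m * (s / sqrt (real m))) \<longlonglongrightarrow> 0"
    proof (rule Lim_null_comparison[OF always_eventually])
      show "\<forall>m. norm (\<delta> m * (s / sqrt (real m))) \<le> \<bar>s / sqrt (real m)\<bar>"
      proof
        fix m
        have "\<bar>\<delta> m\<bar> * \<bar>s / sqrt (real m)\<bar> \<le> 1 * \<bar>s / sqrt (real m)\<bar>"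
          using j[of m] by (intro mult_right_mono) (simp_all add: \<delta>_def \<mu>_def)
        then show "norm (\<delta> m * (s / sqrt (real m))) \<le> \<bar>s / sqrt (real m)\<bar>"
          by (simp only: real_norm_def abs_mult mult_1)
      qed
      show "(\<lambda>m. \<bar>s / sqrt (real m)\<bar>) \<longlonglongrightarrow> 0" using tendsto_rabs_zero[OF t0] .
    qed
    have "(\<lambda>m. cis (- (\<delta> m * (s / sqrt (real m))))) \<longlonglongrightarrow> cis (- 0)"
      unfolding cis_conv_exp by (intro tendsto_intros d0)
    from tendsto_mult[OF lim\<psi>[of s] this]
    have l: "(\<lambda>m. \<psi> (s / sqrt (real m)) ^ m * cis (- (\<delta> m * (s / sqrt (real m))))) \<longlonglongrightarrow> of_real (exp (- (v * s\<^sup>2 / 2)))"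
      by simp
    have "eventually (\<lambda>m. pi * sqrt (real m) \<ge> \<bar>s\<bar>) sequentially" by real_asymp
    then have "eventually (\<lambda>m. \<psi> (s / sqrt (real m)) ^ m * cis (- (\<delta> m * (s / sqrt (real m)))) = F m s) sequentially"
      by eventually_elim (auto simp: F_def abs_le_iff)
    then have "(\<lambda>m. F m s) \<longlonglongrightarrow> of_real (exp (- (v * s\<^sup>2 / 2)))"
      using l by (rule Lim_transform_eventually[rotated])
    then show ?thesis by (rule LIMSEQ_Suc)
  qed
  have int_lim: "(\<lambda>m. integral UNIV (F (Suc m))) \<longlonglongrightarrow> integral UNIV (\<lambda>s. complex_of_real (exp (- (v * s\<^sup>2 / 2))))"
  proof (rule dominated_convergence(2)[where h = "\<lambda>s. exp (- c * s\<^sup>2)"])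
    show "F (Suc m) integrable_on UNIV" for m using F_int[of "Suc m"] by (auto intro: has_integral_integrable)
    show "(\<lambda>s. exp (- c * s\<^sup>2)) integrable_on UNIV"
      using gaussian_has_integral[OF c(1)] by (rule has_integral_integrable)
  qed (use F_le F_lim in auto)
  have "((\<lambda>s. complex_of_real (exp (- (v/2) * s\<^sup>2))) has_integral of_real (sqrt (pi / (v/2)))) UNIV"
    using has_integral_linear[OF gaussian_has_integral[of "v/2"] bounded_linear_of_real[where 'a = complex]] v
    by (simp add: o_def)
  then have G: "integral UNIV (\<lambda>s. complex_of_real (exp (- (v * s\<^sup>2 / 2)))) = of_real (sqrt (pi / (v/2)))"
    by (simp add: integral_unique)
  have "(\<lambda>m. complex_of_real (sqrt (real (Suc m)) * (2 * pi * (Abs_fps (pmf a) ^ Suc m) $ j (Suc m))))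
      \<longlonglongrightarrow> of_real (sqrt (pi / (v/2)))"
    using int_lim unfolding G by (subst (asm) integral_unique[OF F_int]) auto
  then have "(\<lambda>m. sqrt (real (Suc m)) * (2 * pi * (Abs_fps (pmf a) ^ Suc m) $ j (Suc m))) \<longlonglongrightarrow> sqrt (pi / (v/2))"
    unfolding tendsto_of_real_iff .
  then have "(\<lambda>m. sqrt (real m) * (2 * pi * (Abs_fps (pmf a) ^ m) $ j m)) \<longlonglongrightarrow> sqrt (pi / (v/2))"
    by (rule LIMSEQ_imp_Suc)
  moreover have "sqrt (pi / (v/2)) > sqrt (pi / (v/2)) / 2" using v by simp
  ultimately have "eventually (\<lambda>m. sqrt (real m) * (2 * pi * (Abs_fps (pmf a) ^ m) $ j m) > sqrt (pi / (v/2)) / 2) sequentially"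
    by (rule order_tendstoD)
  then have "eventually (\<lambda>m. (Abs_fps (pmf a) ^ m) $ j m \<ge> (sqrt (pi / (v/2)) / (4 * pi)) / sqrt (real m)) sequentially"
    using eventually_gt_at_top[of 0]
    by eventually_elim (simp add: field_simps)
  then show ?thesis using v by (intro exI[of _ "sqrt (pi / (v/2)) / (4 * pi)"]) auto
qed

section \<open>Sizes of Galton--Watson forests\<close>

text \<open>The root of the first tree is revealed: with \<open>d\<close> children, it leaves
  \<open>d + N\<close> trees and one vertex fewer.\<close>

lemma fps_power_Suc_compose_rec:
  fixes Y P :: "'a::comm_ring_1 fps"
  assumes Y0: "Y $ 0 = 0" and Y: "Y = fps_X * (P oo Y)"
  shows "(Y ^ Suc N) $ Suc m = (\<Sum>d\<le>m. P $ d * (Y ^ (d + N)) $ m)"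
proof -
  have "(Y ^ Suc N) $ Suc m = ((P oo Y) * Y ^ N) $ m"
    by (subst power_Suc, subst Y) (simp add: mult.assoc)
  then show ?thesis by (simp add: fps_compose_mult_nth[OF Y0] power_add)
qed

text \<open>Lagrange inversion in the form of Otter and Dwass; the induction on \<open>m\<close> reveals one vertex of
  the forest, and the derivative of \<open>P ^ Suc m\<close> takes the place of exchangeability.\<close>

lemma otter_dwass:
  fixes Y P :: "real fps"
  assumes Y0: "Y $ 0 = 0" and Y: "Y = fps_X * (P oo Y)" and "N \<le> m"
  shows "real m * (Y ^ N) $ m = real N * (P ^ m) $ (m - N)"
  using \<open>N \<le> m\<close>
proof (induction m arbitrary: N)
  case (Suc m)
  show ?case
  proof (cases N)
    case 0
    then show ?thesis by simp
  next
    case (Suc N')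
    show ?thesis
    \<comment> \<open>The other case ends with a division by \<open>m\<close>.\<close>
    proof (cases "m = 0")
      case True
      then show ?thesis using Suc Suc.prems fps_power_Suc_compose_rec[OF Y0 Y, of N' 0] by simp
    next
      case False
      define M where "M = m - N'"
      have N': "N' \<le> m" using Suc Suc.prems by simp
      have rec: "(Y ^ N) $ Suc m = (\<Sum>d\<le>m. P $ d * (Y ^ (d + N')) $ m)"
        unfolding Suc by (rule fps_power_Suc_compose_rec[OF Y0 Y])
      \<comment> \<open>For \<open>d > M\<close> there are more than \<open>m\<close> trees and the
        coefficient vanishes; for the remaining \<open>d\<close> the induction hypothesis
        applies.\<close>
      also have "\<dots> = (\<Sum>d\<le>M. P $ d * (Y ^ (d + N')) $ m)"
        using fps_power_nth_less[OF Y0] by (intro sum.mono_neutral_right) (auto simp: M_def)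
      finally have "real m * (Y ^ N) $ Suc m = (\<Sum>d\<le>M. P $ d * (real m * (Y ^ (d + N')) $ m))"
        by (simp add: sum_distrib_left mult_ac)
      also have "\<dots> = (\<Sum>d\<le>M. P $ d * (real (d + N') * (P ^ m) $ (M - d)))"
        using N' by (intro sum.cong refl) (simp add: Suc.IH M_def add.commute)
      also have "\<dots> = real N' * (\<Sum>d\<le>M. P $ d * (P ^ m) $ (M - d)) + (\<Sum>d\<le>M. real d * P $ d * (P ^ m) $ (M - d))"
        by (simp add: sum_distrib_left sum.distrib[symmetric] algebra_simps)
      also have "(\<Sum>d\<le>M. P $ d * (P ^ m) $ (M - d)) = (P ^ Suc m) $ M"
        by (simp add: fps_mult_nth atLeast0AtMost)
      also have "(\<Sum>d\<le>M. real d * P $ d * (P ^ m) $ (M - d)) = (fps_X * fps_deriv P * P ^ m) $ M"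
        by (simp add: fps_mult_nth[of "fps_X * fps_deriv P"] atLeast0AtMost fps_X_mult_nth)
          (intro sum.cong refl, auto)
      finally have 1: "real m * (Y ^ N) $ Suc m = real N' * (P ^ Suc m) $ M + (fps_X * fps_deriv P * P ^ m) $ M" .
      have "fps_X * fps_deriv (P ^ Suc m) = fps_const (real (Suc m)) * (fps_X * fps_deriv P * P ^ m)"
        by (simp only: fps_deriv_power diff_Suc_1 mult_ac)
      then have "(fps_X * fps_deriv (P ^ Suc m)) $ M = real (Suc m) * (fps_X * fps_deriv P * P ^ m) $ M"
        by (simp only: fps_mult_left_const_nth)
      moreover have "(fps_X * fps_deriv (P ^ Suc m)) $ M = real M * (P ^ Suc m) $ M"
        by (cases M) (simp_all del: power_Suc)
      ultimately have 2: "real (Suc m) * (fps_X * fps_deriv P * P ^ m) $ M = real M * (P ^ Suc m) $ M" by simp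
      have "real m * (real (Suc m) * (Y ^ N) $ Suc m)
          = (real (Suc m) * real N' + real M) * (P ^ Suc m) $ M"
        using 1 2 by (simp only: mult.left_commute[of "real m"] distrib_left distrib_right mult.assoc)
      also have "real (Suc m) * real N' + real M = real m * real N"
        using N' by (simp add: M_def Suc algebra_simps of_nat_diff)
      finally have "real (Suc m) * (Y ^ N) $ Suc m = real N * (P ^ Suc m) $ M"
        using False by (simp del: power_Suc)
      then show ?thesis by (simp add: M_def Suc)
    qed
  qed
qed simp

section \<open>Critical offspring and reduction to span one\<close>

lemma fps_compose_X_power_nth:
  fixes A :: "'a::comm_ring_1 fps"
  assumes "h > 0"
  shows "(A oo fps_X ^ h) $ n = (if h dvd n then A $ (n div h) else 0)"
proof -
  have "(A oo fps_X ^ h) $ n = (\<Sum>i\<in>{0..n}. if n = h * i then A $ i else 0)"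
    unfolding fps_compose_nth power_mult[symmetric] fps_X_power_nth
    by (intro sum.cong refl) auto
  also have "\<dots> = (\<Sum>i\<in>{0..n}. if i = n div h then (if h dvd n then A $ i else 0) else 0)"
    using assms by (intro sum.cong refl) auto
  also have "\<dots> = (if h dvd n then A $ (n div h) else 0)"
    by (simp add: sum.delta)
  finally show ?thesis .
qed

locale critical_offspring =
  fixes p :: "nat pmf"
  assumes second_moment: "integrable (measure_pmf p) (\<lambda>k. (real k)\<^sup>2)"
    and mean: "measure_pmf.expectation p real = 1"
    and variance: "measure_pmf.variance p real > 0"
begin

abbreviation P :: "real fps" where "P \<equiv> Abs_fps (pmf p)"

lemma first_moment: "integrable (measure_pmf p) real"
  by (rule measure_pmf.square_integrable_imp_integrable[OF _ second_moment]) simp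

lemma mean_sums: "(\<lambda>k. pmf p k * real k) sums 1"
  using pmf_nat_expectation_sums[OF first_moment] mean by simp

definition S :: real where "S = measure_pmf.expectation p (\<lambda>k. (real k)\<^sup>2)"

lemma second_moment_sums: "(\<lambda>k. pmf p k * (real k)\<^sup>2) sums S"
  using pmf_nat_expectation_sums[OF second_moment] by (simp add: S_def)

lemma S_nonneg: "S \<ge> 0"
  unfolding S_def by simp

text \<open>Otherwise mean 1 would put all mass on 1, and the variance would be 0.\<close>

lemma ex_atom_ge_2: "\<exists>k\<ge>2. pmf p k > 0"
proof (rule ccontr)
  assume "\<not> ?thesis"
  then have z: "pmf p k = 0" if "k \<ge> 2" for k
    using that by (meson linorder_neqE_linordered_idom not_less pmf_nonneg)
  have "(\<lambda>k. pmf p k * real k) sums (\<Sum>k\<in>{0, 1}. pmf p k * real k)"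
    by (rule sums_finite) (use z in \<open>auto simp: numeral_2_eq_2 not_less_eq_eq le_Suc_eq\<close>)
  then have p1: "pmf p 1 = 1" using mean_sums sums_unique2 by fastforce
  have "AE k in measure_pmf p. k = 1"
  proof -
    have "(\<Sum>k\<in>{0, 1}. pmf p k) \<le> 1"
      using sum_le_suminf[OF summable_pmf_nat, of "{0,1}" p] sums_unique[OF pmf_nat_sums_1[of p]] by simp
    then have p0: "pmf p 0 = 0" using p1 pmf_nonneg[of p 0] by simp
    have "k = 1" if "k \<in> set_pmf p" for k
    proof -
      have "k \<noteq> 0" "\<not> k \<ge> 2" using that p0 z[of k] by (metis less_irrefl pmf_positive)+
      then show ?thesis by linarith
    qed
    then show ?thesis by (auto simp: AE_measure_pmf_iff)
  qed
  then have "measure_pmf.variance p real = measure_pmf.expectation p (\<lambda>_. 0)"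
    unfolding mean by (intro integral_cong_AE) auto
  then show False using variance by simp
qed

text \<open>Without an atom at 0 the variable \<open>k - 1\<close> would be nonnegative with
  expectation 0, yet positive at the atom above 1.\<close>

lemma pmf_0_pos: "pmf p 0 > 0"
proof (rule ccontr)
  assume "\<not> ?thesis"
  then have z: "pmf p 0 = 0" using pmf_nonneg[of p 0] by linarith
  obtain k where k: "k \<ge> 2" "pmf p k > 0" using ex_atom_ge_2 by blast
  have s: "(\<lambda>k. pmf p k * real k - pmf p k) sums (1 - 1)"
    by (rule sums_diff[OF mean_sums pmf_nat_sums_1])
  have "(\<Sum>j\<in>{k}. pmf p j * real j - pmf p j) \<le> (\<Sum>j. pmf p j * real j - pmf p j)"
  proof (rule sum_le_suminf[OF sums_summable[OF s]])
    fix n show "0 \<le> pmf p n * real n - pmf p n"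
      using z by (cases "n = 0") (auto simp: mult_le_cancel_left1 intro: mult_left_mono[of 1 "real n" "pmf p n", simplified])
  qed simp
  then have "pmf p k * real k \<le> pmf p k" using sums_unique[OF s] by simp
  then have "real k \<le> 1" using k by simp
  then show False using k by simp
qed

text \<open>The size \<open>n\<close> has positive probability only if this number divides
  \<open>n - 1\<close>; the local limit theorem is therefore applied to the offspring number divided
  by it.\<close>

definition lattice_span :: nat where "lattice_span = Gcd {k. pmf p k > 0}"

lemma lattice_span_dvd: "pmf p k > 0 \<Longrightarrow> lattice_span dvd k"
  by (simp add: lattice_span_def Gcd_dvd)

lemma lattice_span_pos: "lattice_span > 0"
proof -
  obtain k where k: "k \<ge> 2" "pmf p k > 0" using ex_atom_ge_2 by blast
  then have "lattice_span dvd k" by (intro lattice_span_dvd)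
  then show ?thesis using k by (intro Nat.gr0I) auto
qed

definition reduced :: "nat pmf" where "reduced = map_pmf (\<lambda>k. k div lattice_span) p"

lemma pmf_reduced: "pmf reduced k = pmf p (lattice_span * k)"
proof (cases "pmf p (lattice_span * k) > 0")
  case True
  have inj: "inj_on (\<lambda>k. k div lattice_span) (set_pmf p)"
    using lattice_span_dvd lattice_span_pos by (intro inj_onI) (metis dvd_div_mult_self pmf_positive)
  have "pmf (map_pmf (\<lambda>k. k div lattice_span) p) ((\<lambda>k. k div lattice_span) (lattice_span * k)) = pmf p (lattice_span * k)"
    using True inj by (intro pmf_map_inj) (auto simp: set_pmf_iff)
  then show ?thesis using lattice_span_pos by (simp add: reduced_def)
next
  case False
  have "k \<notin> set_pmf reduced"
  proof
    assume "k \<in> set_pmf reduced"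
    then obtain l where l: "l \<in> set_pmf p" "k = l div lattice_span" by (auto simp: reduced_def)
    then have "lattice_span * k = l" using lattice_span_dvd[of l] by (simp add: pmf_positive)
    then show False using False l by (simp add: pmf_positive)
  qed
  then show ?thesis using False pmf_nonneg[of p "lattice_span * k"] by (simp add: set_pmf_iff)
qed

sublocale red: span_one reduced
proof
  show "pmf reduced 0 > 0" using pmf_0_pos by (simp add: pmf_reduced)
  fix d assume d: "\<And>k. pmf reduced k > 0 \<Longrightarrow> d dvd k"
  have "lattice_span * d dvd k" if k: "pmf p k > 0" for k
  proof -
    obtain l where l: "k = lattice_span * l" using lattice_span_dvd[OF k] by auto
    then have "d dvd l" using d[of l] k by (simp add: pmf_reduced)
    then show ?thesis using l by simp
  qed
  then have "lattice_span * d dvd lattice_span" unfolding lattice_span_def by (intro Gcd_greatest) auto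
  then show "d = 1" using lattice_span_pos by (simp add: nat_mult_dvd_cancel1[of lattice_span d 1, simplified])
qed

lemma P_eq_compose: "P = Abs_fps (pmf reduced) oo fps_X ^ lattice_span"
proof (rule fps_ext)
  fix n
  have "pmf p n = 0" if "\<not> lattice_span dvd n" using lattice_span_dvd[of n] that pmf_nonneg[of p n] by linarith
  then show "P $ n = (Abs_fps (pmf reduced) oo fps_X ^ lattice_span) $ n"
    using lattice_span_pos by (auto simp: fps_compose_X_power_nth pmf_reduced)
qed

lemma P_power_nth: "(P ^ m) $ n = (if lattice_span dvd n then (Abs_fps (pmf reduced) ^ m) $ (n div lattice_span) else 0)"
proof -
  have "P ^ m = Abs_fps (pmf reduced) ^ m oo fps_X ^ lattice_span"
    unfolding P_eq_compose using lattice_span_pos by (subst fps_compose_power) auto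
  then show ?thesis using lattice_span_pos by (simp add: fps_compose_X_power_nth)
qed

lemma P_power_le_inv_sqrt:
  obtains C where "C > 0" "\<And>m j. m \<ge> 1 \<Longrightarrow> (P ^ m) $ j \<le> C / sqrt (real m)"
proof -
  obtain C where C: "C > 0" "\<And>m j. m \<ge> 1 \<Longrightarrow> (Abs_fps (pmf reduced) ^ m) $ j \<le> C / sqrt (real m)"
    by (rule red.pmf_fps_power_le_inv_sqrt) blast
  have "(P ^ m) $ j \<le> C / sqrt (real m)" if "m \<ge> 1" for m j
    using C(2)[OF that] C(1) unfolding P_power_nth by auto
  then show ?thesis using that C(1) by blast
qed

lemma reduced_real: "measure_pmf.expectation reduced f = measure_pmf.expectation p (\<lambda>k. f (k div lattice_span) :: real)"
  by (simp add: reduced_def)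

lemma AE_div_lattice_span: "AE k in measure_pmf p. real (k div lattice_span) = real k / real lattice_span"
  by (auto simp: AE_measure_pmf_iff real_of_nat_div lattice_span_dvd pmf_positive)

text \<open>The reduced distribution has mean \<open>1 / lattice_span\<close>, so the rounded target
  \<open>(m - 1) div lattice_span\<close> is within 1 of \<open>m\<close> times the mean, as the
  local limit theorem demands.\<close>

lemma P_power_lower_bound:
  "\<exists>c>0. \<exists>N. \<forall>m\<ge>N. lattice_span dvd m - 1 \<longrightarrow> (P ^ m) $ (m - 1) \<ge> c / sqrt (real m)"
proof -
  have e1: "measure_pmf.expectation reduced real = 1 / real lattice_span"
  proof -
    have "measure_pmf.expectation reduced real = measure_pmf.expectation p (\<lambda>k. real k / real lattice_span)"
      unfolding reduced_real by (intro integral_cong_AE AE_div_lattice_span) auto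
    then show ?thesis by (simp add: mean)
  qed
  have i2: "integrable (measure_pmf reduced) (\<lambda>k. (real k)\<^sup>2)"
  proof -
    have "integrable (measure_pmf p) (\<lambda>k. (real k)\<^sup>2 / (real lattice_span)\<^sup>2)" using second_moment by simp
    then have "integrable (measure_pmf p) (\<lambda>k. (real (k div lattice_span))\<^sup>2)"
      by (rule integrable_cong_AE_imp) (use AE_div_lattice_span in \<open>auto simp: power_divide\<close>)
    then show ?thesis by (simp add: reduced_def integrable_map_pmf_eq)
  qed
  have v: "measure_pmf.variance reduced real = measure_pmf.variance p real / (real lattice_span)\<^sup>2"
  proof -
    have "measure_pmf.variance reduced real = measure_pmf.expectation p (\<lambda>k. (real k - 1)\<^sup>2 / (real lattice_span)\<^sup>2)"
      unfolding e1 unfolding reduced_real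
      by (intro integral_cong_AE)
        (use AE_div_lattice_span in \<open>auto simp: diff_divide_distrib[symmetric] power_divide\<close>)
    then show ?thesis by (simp add: mean)
  qed
  have j: "\<bar>real ((m - 1) div lattice_span) - real m * (1 / real lattice_span)\<bar> \<le> 1" for m
  proof (cases m)
    case (Suc n)
    have "real n = real (n div lattice_span) * real lattice_span + real (n mod lattice_span)"
      by (metis div_mult_mod_eq of_nat_add of_nat_mult)
    moreover have "real (n mod lattice_span) + 1 \<le> real lattice_span" using lattice_span_pos
      by (metis mod_less_divisor Suc_leI of_nat_Suc of_nat_le_iff add.commute)
    ultimately have "real (n div lattice_span) * real lattice_span \<le> real m" "real m \<le> real (n div lattice_span) * real lattice_span + real lattice_span"
      using Suc by auto
    then have "real (n div lattice_span) \<le> real m / real lattice_span" "real m / real lattice_span \<le> real (n div lattice_span) + 1"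
      using lattice_span_pos by (auto simp: field_simps)
    then show ?thesis using Suc by (simp add: abs_le_iff)
  qed simp
  have "\<exists>c>0. eventually (\<lambda>m. (Abs_fps (pmf reduced) ^ m) $ ((m - 1) div lattice_span) \<ge> c / sqrt (real m)) sequentially"
    by (rule red.local_limit_lower_bound[OF i2]) (use v variance lattice_span_pos e1 j in auto)
  then obtain c N where "c > 0" "\<And>m. m \<ge> N \<Longrightarrow> (Abs_fps (pmf reduced) ^ m) $ ((m - 1) div lattice_span) \<ge> c / sqrt (real m)"
    unfolding eventually_sequentially by blast
  then show ?thesis unfolding P_power_nth by (intro exI[of _ c] conjI exI[of _ N]) auto
qed

text \<open>For a single tree the Otter--Dwass formula reads
  \<open>n * Y $ n = (P ^ n) $ (n - 1)\<close>, so a lower bound \<open>c / sqrt n\<close> on the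
  right suffices. The finitely many sizes before the local limit theorem takes effect are absorbed
  by a minimum.\<close>

lemma fixed_point_lower_bound:
  assumes Y0: "Y $ 0 = 0" and Y: "Y = fps_X * (P oo Y)"
  shows "\<exists>c>0. \<forall>n. Y $ n > 0 \<longrightarrow> Y $ n \<ge> c / (real n * sqrt (real n))"
proof -
  obtain c N where c: "c > 0" and N: "\<And>m. m \<ge> N \<Longrightarrow> lattice_span dvd m - 1 \<Longrightarrow> (P ^ m) $ (m - 1) \<ge> c / sqrt (real m)"
    using P_power_lower_bound by blast
  have od: "real n * Y $ n = (P ^ n) $ (n - 1)" if "n \<ge> 1" for n
    using otter_dwass[OF Y0 Y that] by simp
  define A where "A = insert c ((\<lambda>n. Y $ n * (real n * sqrt (real n))) ` {n. n < N \<and> Y $ n > 0})"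
  have pos: "n \<ge> 1" if "Y $ n > 0" for n using that Y0 by (cases n) auto
  have fA: "finite A" "A \<noteq> {}" by (auto simp: A_def)
  have Apos: "Min A > 0" using fA c pos by (auto simp: A_def Suc_le_eq)
  have "Y $ n \<ge> Min A / (real n * sqrt (real n))" if n: "Y $ n > 0" for n
  proof (cases "n < N")
    case True
    then have "Min A \<le> Y $ n * (real n * sqrt (real n))" using n fA by (intro Min_le) (auto simp: A_def)
    then show ?thesis using pos[OF n] by (simp add: divide_le_eq Suc_le_eq)
  next
    case False
    have n1: "n \<ge> 1" by (rule pos[OF n])
    then have "(P ^ n) $ (n - 1) > 0" using od[OF n1] n by (metis mult_pos_pos of_nat_0_less_iff less_eq_Suc_le One_nat_def)
    then have "lattice_span dvd n - 1" unfolding P_power_nth by (metis less_irrefl)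
    then have "c / sqrt (real n) \<le> real n * Y $ n" using N[of n] False od[OF n1] by simp
    moreover have "Min A \<le> c" using fA by (intro Min_le) (auto simp: A_def)
    ultimately show ?thesis using n1 by (simp add: field_simps)
  qed
  then show ?thesis using Apos by blast
qed

end

section \<open>Left tails and Gaussian bounds for forests\<close>

lemma one_minus_power_le:
  assumes "0 \<le> x" "x \<le> (1::real)"
  shows "(1 - x) ^ k \<le> 1 - real k * x + (real k)\<^sup>2 * x\<^sup>2"
proof (induction k)
  case (Suc k)
  have "(1 - x) ^ Suc k \<le> (1 - x) * (1 - real k * x + (real k)\<^sup>2 * x\<^sup>2)"
    unfolding power_Suc using Suc assms by (intro mult_left_mono) auto
  also have "\<dots> = 1 - real (Suc k) * x + (real (Suc k))\<^sup>2 * x\<^sup>2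
      - (real k + 1) * x\<^sup>2 - (real k)\<^sup>2 * x\<^sup>2 * x"
    by (simp add: power2_eq_square algebra_simps)
  also have "\<dots> \<le> 1 - real (Suc k) * x + (real (Suc k))\<^sup>2 * x\<^sup>2"
  proof -
    have "0 \<le> (real k + 1) * x\<^sup>2" "0 \<le> (real k)\<^sup>2 * x\<^sup>2 * x" using assms by simp_all
    then show ?thesis by linarith
  qed
  finally show ?case .
qed simp

text \<open>Half of the exponent absorbs the factor \<open>t\<close>; the constant comes from
  expanding \<open>(1 - sqrt (c / 2) * t)\<^sup>2 \<ge> 0\<close>.\<close>

lemma mult_exp_neg_square_le:
  fixes c t :: real
  assumes "c > 0"
  shows "t * exp (- c * t\<^sup>2) \<le> exp (- (c / 2) * t\<^sup>2) / sqrt (2 * c)"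
proof -
  have "0 \<le> (1 - sqrt (c / 2) * t)\<^sup>2" by simp
  also have "\<dots> = 1 + c / 2 * t\<^sup>2 - 2 * sqrt (c / 2) * t"
    using assms by (simp add: power2_diff power_mult_distrib)
  finally have "2 * sqrt (c / 2) * t \<le> 1 + c / 2 * t\<^sup>2" by simp
  also have "\<dots> \<le> exp (c / 2 * t\<^sup>2)" using exp_ge_add_one_self[of "c / 2 * t\<^sup>2"] by simp
  also have "2 * sqrt (c / 2) = sqrt (2 * c)"
    by (rule real_sqrt_unique[symmetric]) (use assms in \<open>auto simp: power_mult_distrib\<close>)
  finally have *: "t * sqrt (2 * c) \<le> exp (c / 2 * t\<^sup>2)" by (simp add: mult.commute)
  have "t * exp (- c * t\<^sup>2) * sqrt (2 * c) = (t * sqrt (2 * c)) * exp (- c * t\<^sup>2)"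
    by simp
  also have "\<dots> \<le> exp (c / 2 * t\<^sup>2) * exp (- c * t\<^sup>2)" using * by (intro mult_right_mono) auto
  also have "\<dots> = exp (- (c / 2) * t\<^sup>2)" by (simp add: exp_add[symmetric] algebra_simps)
  finally show ?thesis using assms by (simp add: le_divide_eq)
qed

context critical_offspring begin

lemma pgf_one_minus_le:
  assumes "0 \<le> x" "x \<le> 1"
  shows "pgf p (1 - x) \<le> 1 - x + S * x\<^sup>2"
proof -
  have s1: "(\<lambda>k. pmf p k * (1 - x) ^ k) sums pgf p (1 - x)"
    using pmf_fps_power_sums(2)[of "1 - x" p 1] assms by simp
  have s2: "(\<lambda>k. pmf p k - pmf p k * real k * x + pmf p k * (real k)\<^sup>2 * x\<^sup>2) sums (1 - 1 * x + S * x\<^sup>2)"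
    by (intro sums_add sums_diff sums_mult2 pmf_nat_sums_1 mean_sums second_moment_sums)
  have "pgf p (1 - x) \<le> 1 - 1 * x + S * x\<^sup>2"
  proof (rule sums_le[OF _ s1 s2])
    fix k
    have "pmf p k * (1 - x) ^ k \<le> pmf p k * (1 - real k * x + (real k)\<^sup>2 * x\<^sup>2)"
      using one_minus_power_le[OF assms] by (intro mult_left_mono) auto
    then show "pmf p k * (1 - x) ^ k \<le> pmf p k - pmf p k * real k * x + pmf p k * (real k)\<^sup>2 * x\<^sup>2"
      by (simp add: algebra_simps)
  qed
  then show ?thesis by simp
qed

text \<open>Chernoff's bound with the weights \<open>(1 - x) ^ j\<close>. Offspring numbers are
  bounded below, so a second moment gives Gaussian decay on this side for all deviations.\<close>

lemma left_tail:
  assumes m: "m \<ge> 1" and s: "0 \<le> s" "s \<le> real m" and J: "finite J" "\<And>j. j \<in> J \<Longrightarrow> real j \<le> real m - s"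
  shows "(\<Sum>j\<in>J. (P ^ m) $ j) \<le> exp (- s\<^sup>2 / (4 * (S + 2) * real m))"
proof -
  \<comment> \<open>The minimizer of the final exponent
    \<open>- s * x + (S + 2) * m * x\<^sup>2\<close>. There \<open>S\<close> stems from the
    generating function and 2 from the lower bound for \<open>ln (1 - x)\<close>;
    \<open>s \<le> m\<close> keeps \<open>x\<close> below \<open>1 / 2\<close>.\<close>
  define x where "x = s / (2 * (S + 2) * real m)"
  have S2: "S + 2 > 0" using S_nonneg by simp
  have x0: "0 \<le> x" using s S2 by (simp add: x_def)
  have "x \<le> real m / (2 * (S + 2) * real m)" unfolding x_def using s S2 by (intro divide_right_mono) auto
  also have "\<dots> = 1 / (2 * (S + 2))" using m by simp
  also have "\<dots> \<le> 1 / 2" using S_nonneg by (intro divide_left_mono) auto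
  finally have x1: "x \<le> 1 / 2" .
  have u: "0 < 1 - x" "1 - x \<le> 1" using x0 x1 by auto
  have pg: "(\<lambda>j. (P ^ m) $ j * (1 - x) ^ j) sums pgf p (1 - x) ^ m"
    using pmf_fps_power_sums(2)[of "1 - x" p m] x0 x1 by simp
  have "(\<Sum>j\<in>J. (P ^ m) $ j) * (1 - x) powr (real m - s) = (\<Sum>j\<in>J. (P ^ m) $ j * (1 - x) powr (real m - s))"
    by (simp add: sum_distrib_right)
  also have "\<dots> \<le> (\<Sum>j\<in>J. (P ^ m) $ j * (1 - x) ^ j)"
  proof (intro sum_mono mult_left_mono)
    fix j assume "j \<in> J"
    then have "(1 - x) powr (real m - s) \<le> (1 - x) powr real j"
      using J(2)[of j] u by (intro powr_mono') auto
    then show "(1 - x) powr (real m - s) \<le> (1 - x) ^ j" using u by (simp add: powr_realpow)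
  qed simp
  also have "\<dots> \<le> pgf p (1 - x) ^ m"
    using sum_le_suminf[OF sums_summable[OF pg] J(1)] u sums_unique[OF pg] by simp
  also have "\<dots> \<le> exp (- x + S * x\<^sup>2) ^ m"
  proof (rule power_mono)
    show "pgf p (1 - x) \<le> exp (- x + S * x\<^sup>2)"
      using pgf_one_minus_le[of x] x0 x1 exp_ge_add_one_self[of "- x + S * x\<^sup>2"] by linarith
    show "0 \<le> pgf p (1 - x)" unfolding pgf_def
      using u pmf_fps_power_sums(2)[of "1 - x" p 1] x0
      by (intro suminf_nonneg) (auto simp: sums_iff)
  qed
  also have "\<dots> = exp (real m * (- x + S * x\<^sup>2))" by (simp add: exp_of_nat_mult)
  finally have 1: "(\<Sum>j\<in>J. (P ^ m) $ j) * (1 - x) powr (real m - s) \<le> exp (real m * (- x + S * x\<^sup>2))" .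
  have ln: "ln (1 - x) \<ge> - x - 2 * x\<^sup>2"
    using ln_one_minus_pos_lower_bound[OF x0 x1] by simp
  have "exp ((real m - s) * (- x - 2 * x\<^sup>2)) \<le> (1 - x) powr (real m - s)"
    using u s ln by (simp add: powr_def mult_left_mono)
  then have "(\<Sum>j\<in>J. (P ^ m) $ j) * exp ((real m - s) * (- x - 2 * x\<^sup>2)) \<le> exp (real m * (- x + S * x\<^sup>2))"
    using 1 by (meson mult_left_mono order_trans sum_nonneg pmf_fps_power_nonneg)
  then have "(\<Sum>j\<in>J. (P ^ m) $ j) \<le> exp (real m * (- x + S * x\<^sup>2)) / exp ((real m - s) * (- x - 2 * x\<^sup>2))"
    by (simp add: le_divide_eq)
  also have "\<dots> = exp (real m * (- x + S * x\<^sup>2) - (real m - s) * (- x - 2 * x\<^sup>2))"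
    by (simp add: exp_diff)
  also have "\<dots> \<le> exp (- s\<^sup>2 / (4 * (S + 2) * real m))"
  proof -
    have "real m * (- x + S * x\<^sup>2) - (real m - s) * (- x - 2 * x\<^sup>2) = - s * x + (S + 2) * real m * x\<^sup>2 - 2 * s * x\<^sup>2"
      by (simp add: algebra_simps)
    also have "\<dots> \<le> - s * x + (S + 2) * real m * x\<^sup>2" using s by simp
    also have "\<dots> = - s\<^sup>2 / (4 * (S + 2) * real m)"
    proof -
      have "- s * (s / (2 * K)) + K * (s / (2 * K))\<^sup>2 = - s\<^sup>2 / (4 * K)" if "K > 0" for K
        using that by (simp add: power2_eq_square field_simps)
      moreover have "(S + 2) * real m > 0" using S2 m by simp
      ultimately have "- s * (s / (2 * ((S + 2) * real m))) + (S + 2) * real m * (s / (2 * ((S + 2) * real m)))\<^sup>2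
        = - s\<^sup>2 / (4 * ((S + 2) * real m))" by blast
      then show ?thesis by (simp only: x_def mult.assoc)
    qed
    finally show ?thesis by simp
  qed
  finally show ?thesis .
qed

text \<open>The sum is split into two halves. If it falls short of its mean \<open>m\<close> by
  \<open>N\<close>, one half falls short by at least \<open>N / 2\<close>: that half pays with its
  left tail, while the other supplies \<open>1 / sqrt m\<close> by concentration.\<close>

lemma P_power_gaussian_bound:
  obtains C c where "C > 0" "c > 0"
    "\<And>m N. m \<ge> 1 \<Longrightarrow> N \<le> m \<Longrightarrow> (P ^ m) $ (m - N) \<le> C / sqrt (real m) * exp (- c * (real N)\<^sup>2 / real m)"
proof -
  obtain D where D: "D > 0" "\<And>m j. m \<ge> 1 \<Longrightarrow> (P ^ m) $ j \<le> D / sqrt (real m)"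
    by (rule P_power_le_inv_sqrt) blast
  \<comment> \<open>The exponent of \<open>left_tail\<close> at \<open>s = N / 2\<close>.\<close>
  define c where "c = 1 / (16 * (S + 2))"
  have S2: "S + 2 > 0" using S_nonneg by simp
  have c: "c > 0" using S2 by (simp add: c_def)
  define C where "C = max (exp c) (2 * sqrt 3 * D)"
  have C: "C > 0" unfolding C_def by (simp add: less_max_iff_disj)
  have "(P ^ m) $ (m - N) \<le> C / sqrt (real m) * exp (- c * (real N)\<^sup>2 / real m)"
    if m: "m \<ge> 1" and N: "N \<le> m" for m N
  \<comment> \<open>A single variable cannot be halved; as \<open>N \<le> 1\<close>, the constant
    \<open>exp c\<close> makes the claim trivial.\<close>
  proof (cases "m = 1")
    case True
    have "(real N)\<^sup>2 \<le> 1" using N True by (simp add: abs_square_le_1)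
    then have "exp c * exp (- c * (real N)\<^sup>2) \<ge> 1"
      using c by (simp add: exp_add[symmetric])
    moreover have "exp c * exp (- c * (real N)\<^sup>2) \<le> C * exp (- c * (real N)\<^sup>2)"
      by (intro mult_right_mono) (auto simp: C_def)
    ultimately have "1 \<le> C * exp (- c * (real N)\<^sup>2)" by linarith
    then show ?thesis using pmf_fps_power_le_1[of p m "m - N"] True by simp
  next
    case False
    define m1 m2 where "m1 = m div 2" and "m2 = m - m div 2"
    have m12: "m = m1 + m2" "m1 \<ge> 1" "m2 \<ge> 1" "m \<le> 3 * m1" "m \<le> 3 * m2"
      using m False by (auto simp: m1_def m2_def)
    let ?E = "exp (- c * (real N)\<^sup>2 / real m)"
    have tail: "(\<Sum>i\<in>J. (P ^ k) $ i) \<le> ?E"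
      if k: "k \<ge> 1" "k \<le> m" and J: "finite J" "\<And>j. j \<in> J \<Longrightarrow> real j \<le> real k - real N / 2" for k J
    proof (cases "J = {}")
      case False
      then obtain j where "j \<in> J" by blast
      then have "real N / 2 \<le> real k" using J(2)[of j] by simp
      then have "(\<Sum>i\<in>J. (P ^ k) $ i) \<le> exp (- (real N / 2)\<^sup>2 / (4 * (S + 2) * real k))"
        using k J by (intro left_tail) auto
      also have "\<dots> = exp (- c * (real N)\<^sup>2 / real k)"
        by (simp add: c_def power_divide field_simps)
      also have "\<dots> \<le> ?E"
        using k c by (simp add: divide_left_mono)
      finally show ?thesis .
    qed simp
    have sq: "D / sqrt (real k) \<le> sqrt 3 * D / sqrt (real m)" if "k \<ge> 1" "m \<le> 3 * k" for k
    proof -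
      have "sqrt (real m) \<le> sqrt (3 * real k)" using that by (intro real_sqrt_le_mono) linarith
      then have "D * sqrt (real m) \<le> D * (sqrt 3 * sqrt (real k))"
        using D(1) by (intro mult_left_mono) (auto simp: real_sqrt_mult)
      then show ?thesis using that m D(1) by (simp add: field_simps)
    qed
    let ?I1 = "{i. i \<le> m - N \<and> real i \<le> real m1 - real N / 2}"
    let ?I2 = "{i. i \<le> m - N \<and> real (m - N - i) \<le> real m2 - real N / 2}"
    have fin: "finite ?I1" "finite ?I2" by auto
    have cover: "{..m - N} \<subseteq> ?I1 \<union> ?I2"
    proof
      fix i assume "i \<in> {..m - N}"
      then show "i \<in> ?I1 \<union> ?I2" using N m12(1) by (auto simp: of_nat_diff)
    qed
    let ?B = "sqrt 3 * D / sqrt (real m)"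
    have "(P ^ m) $ (m - N) = (\<Sum>i\<le>m - N. (P ^ m1) $ i * (P ^ m2) $ (m - N - i))"
      unfolding m12(1) power_add fps_mult_nth atLeast0AtMost by simp
    also have "\<dots> \<le> (\<Sum>i\<in>?I1 \<union> ?I2. (P ^ m1) $ i * (P ^ m2) $ (m - N - i))"
      using cover fin by (intro sum_mono2) auto
    also have "\<dots> \<le> (\<Sum>i\<in>?I1. (P ^ m1) $ i * (P ^ m2) $ (m - N - i)) + (\<Sum>i\<in>?I2. (P ^ m1) $ i * (P ^ m2) $ (m - N - i))"
      using sum.union_inter[OF fin, of "\<lambda>i. (P ^ m1) $ i * (P ^ m2) $ (m - N - i)"]
        sum_nonneg[of "?I1 \<inter> ?I2" "\<lambda>i. (P ^ m1) $ i * (P ^ m2) $ (m - N - i)"] by simp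
    also have "(\<Sum>i\<in>?I1. (P ^ m1) $ i * (P ^ m2) $ (m - N - i)) \<le> (\<Sum>i\<in>?I1. (P ^ m1) $ i * ?B)"
      using D(2)[OF m12(3)] sq[OF m12(3,5)] by (intro sum_mono mult_left_mono) (auto intro: order_trans)
    also have "\<dots> = (\<Sum>i\<in>?I1. (P ^ m1) $ i) * ?B" by (rule sum_distrib_right[symmetric])
    also have "\<dots> \<le> ?E * ?B" using m12 D(1) by (intro mult_right_mono tail) auto
    also have "(\<Sum>i\<in>?I2. (P ^ m1) $ i * (P ^ m2) $ (m - N - i)) \<le> (\<Sum>i\<in>?I2. ?B * (P ^ m2) $ (m - N - i))"
      using D(2)[OF m12(2)] sq[OF m12(2,4)] by (intro sum_mono mult_right_mono) (auto intro: order_trans)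
    also have "\<dots> = ?B * (\<Sum>i\<in>?I2. (P ^ m2) $ (m - N - i))" by (rule sum_distrib_left[symmetric])
    also have "(\<Sum>i\<in>?I2. (P ^ m2) $ (m - N - i)) = (\<Sum>i\<in>(\<lambda>i. m - N - i) ` ?I2. (P ^ m2) $ i)"
      by (subst sum.reindex) (auto simp: inj_on_def)
    also have "?B * \<dots> \<le> ?B * ?E" using m12 D(1) by (intro mult_left_mono tail) auto
    finally have "(P ^ m) $ (m - N) \<le> (2 * sqrt 3 * D) / sqrt (real m) * ?E"
      by (simp add: mult_ac)
    also have "\<dots> \<le> C / sqrt (real m) * ?E"
      by (intro mult_right_mono divide_right_mono) (auto simp: C_def)
    finally show ?thesis .
  qed
  then show ?thesis using that C c by blast
qed

text \<open>By Otter--Dwass the coefficient is \<open>N / m\<close> times a Gaussian bound of order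
  \<open>1 / sqrt m\<close>; half of the exponent absorbs \<open>N / sqrt m\<close> and
  \<open>1 / m\<close> remains. The condition \<open>2 * k \<le> n\<close> keeps
  \<open>m = n - k\<close> comparable with \<open>n\<close>.\<close>

lemma fixed_point_power_bound:
  assumes Y0: "Y $ 0 = 0" and Y: "Y = fps_X * (P oo Y)"
  obtains C c where "C > 0" "c > 0"
    "\<And>n k N. n \<ge> 1 \<Longrightarrow> 2 * k \<le> n \<Longrightarrow> (Y ^ N) $ (n - k) \<le> C / real n * exp (- c * (real N)\<^sup>2 / real n)"
proof -
  obtain D d where Dd: "D > 0" "d > 0"
    "\<And>m N. m \<ge> 1 \<Longrightarrow> N \<le> m \<Longrightarrow> (P ^ m) $ (m - N) \<le> D / sqrt (real m) * exp (- d * (real N)\<^sup>2 / real m)"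
    by (rule P_power_gaussian_bound) blast
  define C where "C = 2 * D / sqrt (2 * d)"
  have C: "C > 0" using Dd by (simp add: C_def)
  have "(Y ^ N) $ (n - k) \<le> C / real n * exp (- (d / 2) * (real N)\<^sup>2 / real n)"
    if n: "n \<ge> 1" and k: "2 * k \<le> n" for n k N
  proof (cases "N \<le> n - k")
    case True
    define m where "m = n - k"
    have m: "m \<ge> 1" "m \<le> n" "n \<le> 2 * m" "N \<le> m" using n k True by (auto simp: m_def)
    have "real m * (Y ^ N) $ m = real N * (P ^ m) $ (m - N)"
      by (rule otter_dwass[OF Y0 Y m(4)])
    also have "\<dots> \<le> real N * (D / sqrt (real m) * exp (- d * (real N)\<^sup>2 / real m))"
      using Dd(3)[OF m(1,4)] by (intro mult_left_mono) auto
    also have "\<dots> = D * ((real N / sqrt (real m)) * exp (- d * (real N / sqrt (real m))\<^sup>2))"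
      using m by (simp add: power_divide)
    also have "\<dots> \<le> D * (exp (- (d / 2) * (real N / sqrt (real m))\<^sup>2) / sqrt (2 * d))"
      using Dd by (intro mult_left_mono mult_exp_neg_square_le) auto
    also have "\<dots> = C / 2 * exp (- (d / 2) * (real N)\<^sup>2 / real m)"
      using m by (simp add: C_def power_divide)
    also have "\<dots> \<le> C / 2 * exp (- (d / 2) * (real N)\<^sup>2 / real n)"
      using m C Dd(2) by (intro mult_left_mono) (auto simp: divide_left_mono)
    finally have "(Y ^ N) $ m \<le> C / (2 * real m) * exp (- (d / 2) * (real N)\<^sup>2 / real n)"
      using m by (simp add: field_simps)
    also have "\<dots> \<le> C / real n * exp (- (d / 2) * (real N)\<^sup>2 / real n)"
      using m C n by (intro mult_right_mono divide_left_mono) auto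
    finally show ?thesis by (simp add: m_def)
  next
    case False
    then show ?thesis using fps_power_nth_less[OF Y0, of "n - k" N] C by simp
  qed
  then show ?thesis using that[of C "d / 2"] C Dd by auto
qed

end

section \<open>Moments of the number of vertices at a given distance\<close>

text \<open>The value at \<open>y\<close> of the series of \<open>taylor_coeff c m\<close>, indexed
  as the original series; for \<open>d < m\<close> the binomial coefficient is 0.\<close>

definition taylor_val :: "(nat \<Rightarrow> real) \<Rightarrow> nat \<Rightarrow> real \<Rightarrow> real" where
  "taylor_val c m y = (\<Sum>d. c d * (real (d choose m) * y ^ (d - m)))"

lemma binomial_mult_power_le:
  assumes "0 \<le> y" "0 \<le> t"
  shows "(\<Sum>m\<le>R. real (d choose m) * y ^ (d - m) * t ^ m) \<le> (y + t) ^ d"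
proof -
  have "(\<Sum>m\<le>R. real (d choose m) * y ^ (d - m) * t ^ m)
      = (\<Sum>m\<in>{..R} \<inter> {..d}. real (d choose m) * y ^ (d - m) * t ^ m)"
    by (intro sum.mono_neutral_right) (auto simp: binomial_eq_0)
  also have "\<dots> \<le> (\<Sum>m\<le>d. real (d choose m) * y ^ (d - m) * t ^ m)"
    using assms by (intro sum_mono2) auto
  also have "\<dots> = (t + y) ^ d"
    unfolding binomial_ring by (intro sum.cong refl) simp
  finally show ?thesis by (simp add: add.commute)
qed

context
  fixes c :: "nat \<Rightarrow> real" and y :: real
  assumes c: "\<And>d. 0 \<le> c d" "summable c" and y: "0 \<le> y" "y < 1"
begin

text \<open>By the binomial theorem \<open>(d choose m) * y ^ (d - m) * (1 - y) ^ m \<le> 1\<close>,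
  so inside the disc summability of \<open>c\<close> yields all derivatives.\<close>

lemma summable_taylor_val: "summable (\<lambda>d. c d * (real (d choose m) * y ^ (d - m)))"
proof (rule summable_comparison_test')
  show "summable (\<lambda>d. c d * (1 / (1 - y) ^ m))" by (intro summable_mult2 c)
  fix d
  have "(\<Sum>k\<in>{m}. real (d choose k) * y ^ (d - k) * (1 - y) ^ k) \<le> (\<Sum>k\<le>m. real (d choose k) * y ^ (d - k) * (1 - y) ^ k)"
    using y by (intro sum_mono2) auto
  also have "\<dots> \<le> (y + (1 - y)) ^ d"
    using y by (intro binomial_mult_power_le) auto
  finally have "real (d choose m) * y ^ (d - m) \<le> 1 / (1 - y) ^ m"
    using y by (simp add: le_divide_eq)
  then have "c d * (real (d choose m) * y ^ (d - m)) \<le> c d * (1 / (1 - y) ^ m)"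
    by (rule mult_left_mono[OF _ c(1)])
  then show "norm (c d * (real (d choose m) * y ^ (d - m))) \<le> c d * (1 / (1 - y) ^ m)"
    using c(1)[of d] y by (simp only: real_norm_def abs_of_nonneg mult_nonneg_nonneg of_nat_0_le_iff zero_le_power)
qed

lemma dominated_taylor_coeff: "dominated y (taylor_coeff c m) (taylor_val c m y)"
  unfolding dominated_def
proof (intro conjI allI)
  fix M
  have "(\<Sum>N\<le>M. taylor_coeff c m $ N * y ^ N)
      = (\<Sum>d\<in>(\<lambda>N. N + m) ` {..M}. c d * (real (d choose m) * y ^ (d - m)))"
    by (subst sum.reindex) (auto simp: taylor_coeff_def mult_ac)
  also have "\<dots> \<le> taylor_val c m y"
    unfolding taylor_val_def using c y by (intro sum_le_suminf summable_taylor_val) auto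
  finally show "(\<Sum>N\<le>M. taylor_coeff c m $ N * y ^ N) \<le> taylor_val c m y" .
qed (simp add: taylor_coeff_def c)

text \<open>Taylor's formula with nonnegative coefficients. It controls all Taylor coefficients at
  once, without estimates for the individual ones.\<close>

lemma sum_taylor_val_le:
  assumes t: "0 \<le> t" "y + t \<le> 1"
  shows "(\<Sum>m\<le>R. taylor_val c m y * t ^ m) \<le> (\<Sum>d. c d * (y + t) ^ d)"
proof -
  have s: "summable (\<lambda>d. c d * (y + t) ^ d)"
    by (rule summable_comparison_test'[OF c(2)])
      (use c t y in \<open>auto intro!: mult_left_le power_le_one\<close>)
  have "(\<Sum>m\<le>R. taylor_val c m y * t ^ m) = (\<Sum>m\<le>R. \<Sum>d. c d * (real (d choose m) * y ^ (d - m)) * t ^ m)"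
    unfolding taylor_val_def by (intro sum.cong refl suminf_mult2 summable_taylor_val)
  also have "\<dots> = (\<Sum>d. \<Sum>m\<le>R. c d * (real (d choose m) * y ^ (d - m)) * t ^ m)"
    by (intro suminf_sum[symmetric] summable_mult2 summable_taylor_val)
  also have "\<dots> \<le> (\<Sum>d. c d * (y + t) ^ d)"
  proof (intro suminf_le s summable_sum summable_mult2 summable_taylor_val)
    fix d
    have "(\<Sum>m\<le>R. c d * (real (d choose m) * y ^ (d - m)) * t ^ m)
        = c d * (\<Sum>m\<le>R. real (d choose m) * y ^ (d - m) * t ^ m)"
      by (simp add: sum_distrib_left mult.assoc)
    also have "\<dots> \<le> c d * (y + t) ^ d"
      using c y t by (intro mult_left_mono binomial_mult_power_le) auto
    finally show "(\<Sum>m\<le>R. c d * (real (d choose m) * y ^ (d - m)) * t ^ m) \<le> c d * (y + t) ^ d" .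
  qed
  finally show ?thesis .
qed

lemma taylor_val_nonneg: "0 \<le> taylor_val c m y"
  unfolding taylor_val_def using c y by (intro suminf_nonneg summable_taylor_val) auto

lemma taylor_val_0: "taylor_val c 0 y = (\<Sum>d. c d * y ^ d)"
  by (simp add: taylor_val_def)

lemma taylor_val_le_moment:
  assumes "summable (\<lambda>d. c d * real (d choose m))"
  shows "taylor_val c m y \<le> (\<Sum>d. c d * real (d choose m))"
  unfolding taylor_val_def
proof (intro suminf_le assms summable_taylor_val)
  fix d
  have "real (d choose m) * y ^ (d - m) \<le> real (d choose m)"
    using y by (intro mult_left_le power_le_one) auto
  then show "c d * (real (d choose m) * y ^ (d - m)) \<le> c d * real (d choose m)"
    using c by (intro mult_left_mono) auto
qed

end

lemma exp_neg_double_le: "(0::real) \<le> x \<Longrightarrow> x \<le> 1/2 \<Longrightarrow> exp (- 2 * x) \<le> 1 - x"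
proof -
  assume x: "0 \<le> x" "x \<le> 1/2"
  have "x * x \<le> x * (1/2)" using x by (intro mult_left_mono) auto
  then have "- 2 * x \<le> - x - 2 * x\<^sup>2" by (simp add: power2_eq_square)
  also have "\<dots> \<le> ln (1 - x)" using ln_one_minus_pos_lower_bound[OF x] by simp
  finally have "exp (- 2 * x) \<le> exp (ln (1 - x))" by (simp only: exp_le_cancel_iff)
  then show ?thesis using x by simp
qed

section \<open>The generating function inside its disc of convergence\<close>

context critical_offspring begin

abbreviation wt :: "ptree \<Rightarrow> real" where "wt \<equiv> tree_wt (pmf p)"
abbreviation "Y \<equiv> tree_gf wt"
abbreviation "biased \<equiv> size_biased (pmf p)"

text \<open>The division by the probability of the size \<open>n\<close> is postponed to
  \<open>profile_sum n i r / Y $ n\<close>.\<close>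

definition profile_moment :: "nat \<Rightarrow> nat \<Rightarrow> nat \<Rightarrow> nat \<Rightarrow> real" where
  "profile_moment n i h r = (\<Sum>t\<in>trees n. wt t *
     (\<Sum>v\<in>verts t. if length v = h then real (at_dist i t v) ^ r else 0))"

lemma profile_moment_eq: "profile_moment n i h r = fact r * fps_swap (tree_gf (spine_gen (pmf p) i h)) $ r $ n"
  unfolding spine_gf_nth profile_moment_def by simp

lemma Y_fixed_point: "Y $ 0 = 0" "Y = fps_X * (P oo Y)"
  by (simp_all add: tree_gf_wt[of "pmf p", symmetric])

lemma biased_nonneg: "0 \<le> biased d"
  by (simp add: size_biased_def)

lemma biased_sums: "biased sums 1"
proof -
  have "(\<lambda>k. pmf p (Suc k) * real (Suc k)) sums (1 - pmf p 0 * real 0)"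
    using mean_sums by (subst sums_Suc_iff) simp
  then show ?thesis by (simp add: size_biased_def[abs_def] mult.commute)
qed

lemmas summable_biased = sums_summable[OF biased_sums]

abbreviation pg :: "real \<Rightarrow> real" where "pg u \<equiv> (\<Sum>d. pmf p d * u ^ d)"
abbreviation pd :: "real \<Rightarrow> real" where "pd u \<equiv> (\<Sum>d. biased d * u ^ d)"

lemma pg_eq_pgf: "pg u = pgf p u" by (simp add: pgf_def)

lemma summable_pg: "0 \<le> u \<Longrightarrow> u \<le> 1 \<Longrightarrow> summable (\<lambda>d. pmf p d * u ^ d)"
  by (rule summable_comparison_test'[OF summable_pmf_nat[of p]]) (auto intro!: mult_left_le power_le_one)

lemma summable_pd: "0 \<le> u \<Longrightarrow> u \<le> 1 \<Longrightarrow> summable (\<lambda>d. biased d * u ^ d)"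
  by (rule summable_comparison_test'[OF summable_biased])
    (auto intro!: mult_left_le power_le_one simp: biased_nonneg abs_mult)

lemma pg_ge:
  assumes "0 \<le> x" "x \<le> 1"
  shows "1 - x \<le> pg (1 - x)"
proof -
  have s: "(\<lambda>k. pmf p k - pmf p k * real k * x) sums (1 - 1 * x)"
    by (intro sums_diff sums_mult2 pmf_nat_sums_1 mean_sums)
  have "(1 - 1 * x) \<le> pg (1 - x)"
  proof (rule sums_le[OF _ s summable_sums[OF summable_pg]])
    fix k
    have "1 + real k * (- x) \<le> (1 + (- x)) ^ k"
      using assms by (intro Bernoulli_inequality) auto
    then have "pmf p k * (1 - real k * x) \<le> pmf p k * (1 - x) ^ k"
      by (intro mult_left_mono) auto
    then show "pmf p k - pmf p k * real k * x \<le> pmf p k * (1 - x) ^ k"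
      by (simp add: algebra_simps)
  qed (use assms in auto)
  then show ?thesis by simp
qed

lemma pg_convex:
  assumes "0 \<le> y" "y \<le> u" "u \<le> 1" "y < 1"
  shows "pg u \<le> (1 - u) / (1 - y) * pg y + (u - y) / (1 - y)"
proof -
  define l where "l = (u - y) / (1 - y)"
  have l: "0 \<le> l" "l \<le> 1" using assms by (auto simp: l_def)
  have l1: "1 - l = (1 - u) / (1 - y)" using assms by (simp add: l_def field_simps)
  have "l * (1 - y) = u - y" using assms by (simp add: l_def)
  then have u: "u = (1 - l) * y + l * 1" by (simp add: algebra_simps)
  have s: "(\<lambda>d. (1 - l) * (pmf p d * y ^ d) + l * pmf p d) sums ((1 - l) * pg y + l * 1)"
    using assms by (intro sums_add sums_mult pmf_nat_sums_1 summable_sums summable_pg) auto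
  have "pg u \<le> (1 - l) * pg y + l * 1"
  proof (rule sums_le[OF _ summable_sums[OF summable_pg] s])
    fix d
    have "((1 - l) * y + l * 1) ^ d \<le> (1 - l) * y ^ d + l * 1 ^ d"
    proof -
      have "convex_on {0::real..} (\<lambda>x. x ^ d)"
        by (cases "even d") (auto intro: convex_power_odd convex_on_subset[OF convex_power_even])
      from convex_onD[OF this, of l y 1] show ?thesis using l assms by simp
    qed
    then have "pmf p d * u ^ d \<le> pmf p d * ((1 - l) * y ^ d + l)"
      unfolding u[symmetric] by (intro mult_left_mono) auto
    then show "pmf p d * u ^ d \<le> (1 - l) * (pmf p d * y ^ d) + l * pmf p d"
      by (simp add: algebra_simps)
  qed (use assms in auto)
  then show ?thesis unfolding l1 by (simp add: l_def)
qed

text \<open>The source of the decay in the height: the derivative of the generating function is 1 at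
  the point 1, and one atom \<open>k \<ge> 2\<close> makes it drop linearly to the left.\<close>

lemma pd_le:
  obtains c where "c > 0" "\<And>u. 0 \<le> u \<Longrightarrow> u \<le> 1 \<Longrightarrow> pd u \<le> 1 - c * (1 - u)"
proof -
  obtain k where k: "k \<ge> 2" "pmf p k > 0" using ex_atom_ge_2 by blast
  define c where "c = biased (k - 1)"
  have c: "c > 0" using k by (simp add: c_def size_biased_def)
  have "pd u \<le> 1 - c * (1 - u)" if u: "0 \<le> u" "u \<le> 1" for u
  proof -
    have s: "(\<lambda>d. biased d - biased d * u ^ d) sums (1 - pd u)"
      using u by (intro sums_diff biased_sums summable_sums summable_pd) auto
    have "(\<Sum>d\<in>{k - 1}. biased d - biased d * u ^ d) \<le> (\<Sum>d. biased d - biased d * u ^ d)"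
    proof (rule sum_le_suminf[OF sums_summable[OF s]])
      fix d show "0 \<le> biased d - biased d * u ^ d"
        using u biased_nonneg[of d] by (simp add: mult_left_le power_le_one)
    qed simp
    then have "c * (1 - u ^ (k - 1)) \<le> 1 - pd u"
      using sums_unique[OF s] by (simp add: c_def right_diff_distrib)
    moreover have "u ^ (k - 1) \<le> u ^ 1" using u k by (intro power_decreasing) auto
    then have "c * (1 - u) \<le> c * (1 - u ^ (k - 1))" using c by (intro mult_left_mono) auto
    ultimately show ?thesis by linarith
  qed
  then show ?thesis using that c by blast
qed

lemma pd_mono: "0 \<le> u \<Longrightarrow> u \<le> v \<Longrightarrow> v \<le> 1 \<Longrightarrow> pd u \<le> pd v"
  by (intro suminf_le summable_pd mult_left_mono power_mono biased_nonneg) auto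

lemma pd_nonneg: "0 \<le> u \<Longrightarrow> u \<le> 1 \<Longrightarrow> 0 \<le> pd u"
  by (intro suminf_nonneg summable_pd mult_nonneg_nonneg biased_nonneg) auto

text \<open>The weight per vertex for which \<open>1 - x\<close> solves the equation of the tree
  series. By criticality it differs from 1 by a term of order \<open>x\<^sup>2\<close> only, so
  \<open>n\<close> vertices cost no more than \<open>exp (2 * S * x\<^sup>2 * n)\<close>.\<close>

definition zval :: "real \<Rightarrow> real" where "zval x = (1 - x) / pg (1 - x)"

context
  fixes x :: real
  assumes x: "0 < x" "x \<le> 1/2"
begin

lemma zval_bounds: "0 < zval x" "zval x \<le> 1" "exp (- (2 * S * x\<^sup>2)) \<le> zval x"
  "zval x * pg (1 - x) = 1 - x"
proof -
  have pg1: "1 - x \<le> pg (1 - x)" using pg_ge[of x] x by simp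
  have pg0: "pg (1 - x) > 0" using pg1 x by linarith
  show "0 < zval x" using pg0 x by (simp add: zval_def)
  show "zval x \<le> 1" using pg0 pg1 by (simp add: zval_def)
  show "zval x * pg (1 - x) = 1 - x" using pg0 by (simp add: zval_def)
  have "pg (1 - x) \<le> (1 - x) + S * x\<^sup>2" using pgf_one_minus_le[of x] x by (simp add: pg_eq_pgf)
  also have "\<dots> \<le> (1 - x) + (1 - x) * (2 * S * x\<^sup>2)"
  proof -
    have "(1/2) * (2 * S * x\<^sup>2) \<le> (1 - x) * (2 * S * x\<^sup>2)"
      using x S_nonneg by (intro mult_right_mono) auto
    then show ?thesis by simp
  qed
  also have "\<dots> = (1 - x) * (1 + 2 * S * x\<^sup>2)" by (simp add: algebra_simps)
  also have "\<dots> \<le> (1 - x) * exp (2 * S * x\<^sup>2)"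
    using x exp_ge_add_one_self by (intro mult_left_mono) auto
  finally show "exp (- (2 * S * x\<^sup>2)) \<le> zval x"
    using pg0 by (simp add: zval_def exp_minus field_simps)
qed

text \<open>The convex map \<open>u \<mapsto> zval x * pg u\<close> meets the diagonal at
  \<open>1 - x\<close> and is at most 1 at the point 1, so between them it stays below the diagonal.
  Iteration thus never increases such a \<open>u\<close>.\<close>

lemma zval_pg_le: "1 - x \<le> u \<Longrightarrow> u \<le> 1 \<Longrightarrow> zval x * pg u \<le> u"
proof -
  assume u: "1 - x \<le> u" "u \<le> 1"
  have "pg u \<le> (1 - u) / x * pg (1 - x) + (u - (1 - x)) / x"
    using pg_convex[of "1 - x" u] u x by simp
  then have "zval x * pg u \<le> zval x * ((1 - u) / x * pg (1 - x) + (u - (1 - x)) / x)"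
    using zval_bounds by (intro mult_left_mono) auto
  also have "\<dots> = (1 - u) / x * (zval x * pg (1 - x)) + zval x * ((u - (1 - x)) / x)"
    by (simp add: algebra_simps)
  also have "\<dots> \<le> (1 - u) / x * (1 - x) + 1 * ((u - (1 - x)) / x)"
    using zval_bounds u x by (intro add_mono mult_right_mono) auto
  also have "\<dots> = u" using x by (simp add: field_simps)
  finally show ?thesis .
qed

text \<open>The number \<open>1 - x\<close> is a fixed point of \<open>u \<mapsto> zval x * pg u\<close>, so it dominates the generating
  function \<open>Y\<close> at \<open>zval x\<close>.\<close>

lemma Y_power_le: "(Y ^ N) $ m * zval x ^ m \<le> (1 - x) ^ N"
proof (induction m arbitrary: N)
  case 0
  then show ?case using x by (cases "N = 0") (auto simp: fps_nth_power_0)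
next
  case (Suc m)
  show ?case
  proof (cases N)
    case 0
    then show ?thesis by simp
  next
    case (Suc N')
    have "(Y ^ N) $ Suc m * zval x ^ Suc m = zval x * (\<Sum>d\<le>m. pmf p d * ((Y ^ (d + N')) $ m * zval x ^ m))"
      unfolding Suc fps_power_Suc_compose_rec[OF Y_fixed_point]
      by (simp add: sum_distrib_left sum_distrib_right mult_ac)
    also have "\<dots> \<le> zval x * (\<Sum>d\<le>m. pmf p d * (1 - x) ^ (d + N'))"
      using zval_bounds by (intro mult_left_mono sum_mono Suc.IH) auto
    also have "\<dots> = zval x * (\<Sum>d\<le>m. pmf p d * (1 - x) ^ d) * (1 - x) ^ N'"
      by (simp only: sum_distrib_right power_add mult.assoc)
    also have "\<dots> \<le> zval x * pg (1 - x) * (1 - x) ^ N'"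
      using zval_bounds x by (intro mult_right_mono mult_left_mono sum_le_suminf summable_pg) auto
    also have "\<dots> = (1 - x) ^ N" by (simp add: zval_bounds Suc)
    finally show ?thesis .
  qed
qed

text \<open>For all \<open>k \<le> n\<close>, but without the factor \<open>1 / n\<close>: it serves
  heights at which the Steiner tree may exceed \<open>n / 2\<close>.\<close>

lemma Y_power_le_crude:
  assumes "k \<le> n"
  shows "(Y ^ N) $ (n - k) \<le> exp (2 * S * x\<^sup>2 * real n) * (zval x ^ k * (1 - x) ^ N)"
proof -
  have "(Y ^ N) $ (n - k) * zval x ^ n = ((Y ^ N) $ (n - k) * zval x ^ (n - k)) * zval x ^ k"
    using assms by (simp add: mult.assoc flip: power_add)
  also have "\<dots> \<le> (1 - x) ^ N * zval x ^ k"
    using zval_bounds by (intro mult_right_mono Y_power_le) auto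
  finally have 1: "(Y ^ N) $ (n - k) * zval x ^ n \<le> zval x ^ k * (1 - x) ^ N" by (simp add: mult.commute)
  have z: "1 \<le> exp (2 * S * x\<^sup>2 * real n) * zval x ^ n"
  proof -
    have "1 = exp (2 * S * x\<^sup>2 * real n) * exp (- (2 * S * x\<^sup>2)) ^ n"
      by (simp add: exp_of_nat_mult[symmetric] exp_add[symmetric] mult_ac)
    also have "\<dots> \<le> exp (2 * S * x\<^sup>2 * real n) * zval x ^ n"
      using zval_bounds by (intro mult_left_mono power_mono) auto
    finally show ?thesis .
  qed
  have Y0: "0 \<le> (Y ^ N) $ (n - k)"
    by (intro fps_power_nonneg) (auto simp: tree_gf_def intro!: sum_nonneg tree_wt_nonneg)
  have "(Y ^ N) $ (n - k) * 1 \<le> (Y ^ N) $ (n - k) * (exp (2 * S * x\<^sup>2 * real n) * zval x ^ n)"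
    using z Y0 by (rule mult_left_mono)
  also have "\<dots> \<le> exp (2 * S * x\<^sup>2 * real n) * (zval x ^ k * (1 - x) ^ N)"
    using mult_left_mono[OF 1, of "exp (2 * S * x\<^sup>2 * real n)"] by (simp add: mult_ac)
  finally show ?thesis by simp
qed

text \<open>An expansion can only absorb geometric weights. The Gaussian in \<open>N\<close> is
  bounded by one through \<open>c * N\<^sup>2 / n \<ge> 2 * x * N - x\<^sup>2 * n / c\<close>, which
  is \<open>(c * N - x * n)\<^sup>2 \<ge> 0\<close>.\<close>

lemma gaussian_le_zval:
  assumes c: "c > 0" and n: "n \<ge> 1" and k: "k \<le> n"
  shows "exp (- c * (real N)\<^sup>2 / real n)
    \<le> exp ((2 * S + 1 / c) * x\<^sup>2 * real n) * (zval x ^ k * (1 - x) ^ N)"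
proof -
  have "exp (- (2 * S * x\<^sup>2 * real n)) \<le> exp (- (2 * S * x\<^sup>2 * real k))"
    using k S_nonneg by (simp add: mult_left_mono)
  also have "\<dots> = exp (- (2 * S * x\<^sup>2)) ^ k" by (simp add: exp_of_nat_mult[symmetric] mult_ac)
  also have "\<dots> \<le> zval x ^ k" using zval_bounds by (intro power_mono) auto
  finally have z: "exp (- (2 * S * x\<^sup>2 * real n)) \<le> zval x ^ k" .
  have "exp (- (2 * x * real N)) = exp (- 2 * x) ^ N" by (simp add: exp_of_nat_mult[symmetric] mult_ac)
  also have "\<dots> \<le> (1 - x) ^ N" using exp_neg_double_le[of x] x by (intro power_mono) auto
  finally have y: "exp (- (2 * x * real N)) \<le> (1 - x) ^ N" .
  have "0 \<le> (c * real N - x * real n)\<^sup>2 / (c * real n)" using c n by simp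
  also have "\<dots> = c * (real N)\<^sup>2 / real n - 2 * x * real N + x\<^sup>2 * real n / c"
    using c n by (simp add: power2_diff power_mult_distrib field_simps power2_eq_square)
  finally have "- c * (real N)\<^sup>2 / real n \<le> (2 * S + 1 / c) * x\<^sup>2 * real n + (- (2 * S * x\<^sup>2 * real n) + - (2 * x * real N))"
    by (simp add: algebra_simps)
  then have "exp (- c * (real N)\<^sup>2 / real n) \<le> exp ((2 * S + 1 / c) * x\<^sup>2 * real n) *
      (exp (- (2 * S * x\<^sup>2 * real n)) * exp (- (2 * x * real N)))"
    unfolding exp_add[symmetric] by (simp only: exp_le_cancel_iff)
  also have "\<dots> \<le> exp ((2 * S + 1 / c) * x\<^sup>2 * real n) * (zval x ^ k * (1 - x) ^ N)"
    using z y x zval_bounds by (intro mult_left_mono mult_mono) auto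
  finally show ?thesis .
qed

end

end

section \<open>Moments under a finite variance\<close>

lemma sqrt_one_minus_bounds:
  assumes "0 < x" "x \<le> (1/2::real)"
  shows "1 - x \<le> sqrt (1 - x)" "sqrt (1 - x) \<le> 1 - x / 2"
proof -
  have "(1 - x)\<^sup>2 \<le> 1 * (1 - x)"
    unfolding power2_eq_square using assms by (intro mult_right_mono) auto
  then show "1 - x \<le> sqrt (1 - x)" by (intro real_le_rsqrt) simp
  have "1 - x \<le> (1 - x / 2)\<^sup>2" by (simp add: power2_diff)
  then show "sqrt (1 - x) \<le> 1 - x / 2" using assms by (intro real_le_lsqrt) auto
qed

context critical_offspring begin

lemma dominated_pmf:
  "0 \<le> y \<Longrightarrow> y < 1 \<Longrightarrow> dominated y (taylor_coeff (pmf p) m) (taylor_val (pmf p) m y)"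
  by (rule dominated_taylor_coeff) (auto simp: summable_pmf_nat)

lemma dominated_biased:
  "0 \<le> y \<Longrightarrow> y < 1 \<Longrightarrow> dominated y (taylor_coeff biased m) (taylor_val biased m y)"
  by (rule dominated_taylor_coeff) (auto simp: biased_nonneg summable_biased)

context
  fixes x :: real
  assumes x: "0 < x" "x \<le> 1/2"
begin

text \<open>Without moment assumptions: at \<open>exp \<alpha> = (1 - x) powr (- 1 / 2)\<close> the generating functions of the
  level sizes all lie between the fixed point \<open>1 - x\<close> and \<open>sqrt (1 - x)\<close>.\<close>

lemma spine_expansion:
  fixes \<sigma> R :: nat and c :: real
  assumes c: "c > 0" "\<And>u. 0 \<le> u \<Longrightarrow> u \<le> 1 \<Longrightarrow> pd u \<le> 1 - c * (1 - u)"
  defines "\<alpha> \<equiv> - ln (1 - x) / 2"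
  shows "steiner_expansion.expands Y (1 - x) (zval x) \<alpha> \<sigma> R (int h)
    (2 * exp (- (c * x * real h / 2))) (fps_swap (tree_gf (spine_gen (pmf p) \<sigma> h)))"
proof -
  let ?s = "sqrt (1 - x)" and ?y = "1 - x"
  note z = zval_bounds[OF x] and s = sqrt_one_minus_bounds[OF x]
  have y: "0 < ?y" "?y < 1" using x by auto
  have \<alpha>: "\<alpha> > 0" using x by (simp add: \<alpha>_def)
  have "exp \<alpha> = 1 / ?s"
  proof -
    have "?s = exp (ln ?y / 2)" using y by (simp add: ln_sqrt[symmetric] exp_ln)
    then show ?thesis unfolding \<alpha>_def by (simp add: exp_minus inverse_eq_divide)
  qed
  then have ye: "?y * exp \<alpha> = ?s" and e2: "exp \<alpha> \<le> 2"
  proof -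
    assume e: "exp \<alpha> = 1 / ?s"
    show "?y * exp \<alpha> = ?s" unfolding e using y by (simp add: real_div_sqrt)
    have "1 / ?s \<le> 1 / (1 / 2)" using s x by (intro divide_left_mono) auto
    then show "exp \<alpha> \<le> 2" unfolding e by simp
  qed
  interpret T: tree_expansion "pmf p" ?y "zval x" \<alpha> \<sigma> R
    "\<lambda>m. taylor_val (pmf p) m ?y" "\<lambda>m. taylor_val biased m ?y" "\<lambda>_. ?s - ?y"
  proof
    show "Y $ 0 = 0" by simp
    show "0 \<le> ?y" "0 \<le> zval x" "0 < \<alpha>" using y z \<alpha> by auto
    show "dominated ?y (taylor_coeff (pmf p) m) (taylor_val (pmf p) m ?y)" for m
      using y by (intro dominated_pmf) auto
    show "dominated ?y (taylor_coeff biased m) (taylor_val biased m ?y)" for m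
      using y by (intro dominated_biased) auto
    show "?y * (exp \<alpha> - 1) \<le> ?s - ?y" using ye by (simp add: right_diff_distrib)
    have "(\<Sum>m\<le>R. taylor_val (pmf p) m ?y * (?s - ?y) ^ m) \<le> pg (?y + (?s - ?y))"
      using s x by (intro sum_taylor_val_le) (auto simp: summable_pmf_nat)
    \<comment> \<open>The term of order 0 is separated since \<open>zval x * pg ?y = ?y\<close>
      cancels the \<open>?y\<close> in the constant majorant \<open>?s - ?y\<close>.\<close>
    then have "pg ?y + (\<Sum>m=1..R. taylor_val (pmf p) m ?y * (?s - ?y) ^ m) \<le> pg ?s"
      using taylor_val_0[of "pmf p" ?y] x
      by (simp add: atMost_atLeast0 sum.atLeast_Suc_atMost summable_pmf_nat)
    then have "zval x * (pg ?y + (\<Sum>m=1..R. taylor_val (pmf p) m ?y * (?s - ?y) ^ m)) \<le> zval x * pg ?s"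
      using z by (intro mult_left_mono) auto
    also have "\<dots> \<le> ?s" using s x by (intro zval_pg_le x) auto
    finally show "zval x * (\<Sum>m=1..R. taylor_val (pmf p) m ?y * (?s - ?y) ^ m) \<le> ?s - ?y"
      using z by (simp add: distrib_left)
  qed
  \<comment> \<open>All arguments of the derivative along the spine are at most
    \<open>sqrt (1 - x) \<le> 1 - x / 2\<close>.\<close>
  define \<rho> where "\<rho> = 1 - c * (x / 2)"
  have pds: "pd ?s \<le> \<rho>"
  proof -
    have "pd ?s \<le> 1 - c * (1 - ?s)" using s x by (intro c) auto
    also have "\<dots> \<le> \<rho>" unfolding \<rho>_def using s c by (intro diff_left_mono mult_left_mono) auto
    finally show ?thesis .
  qed
  have \<rho>0: "0 \<le> \<rho>" using pds pd_nonneg[of ?s] s x by simp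
  have g: "(\<Sum>m\<le>R. taylor_val biased m ?y * (if \<sigma> < h + 2 then 0 else ?s - ?y) ^ m) \<le> \<rho>" for h
  proof -
    let ?t = "if \<sigma> < h + 2 then 0 else ?s - ?y"
    have t: "0 \<le> ?t" "?y + ?t \<le> ?s" using s by auto
    have "(\<Sum>m\<le>R. taylor_val biased m ?y * ?t ^ m) \<le> pd (?y + ?t)"
      using s x t by (intro sum_taylor_val_le) (auto simp: biased_nonneg summable_biased)
    also have "\<dots> \<le> pd ?s" using t s x by (intro pd_mono) auto
    finally show ?thesis using pds by linarith
  qed
  \<comment> \<open>The extra factor \<open>exp \<alpha>\<close> is the ancestor at distance
    \<open>\<sigma>\<close> from the end of the spine, which exists once the height reaches
    \<open>\<sigma>\<close>.\<close>
  define \<kappa> where "\<kappa> h = (if \<sigma> \<le> h then exp \<alpha> else 1) * \<rho> ^ h" for h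
  have \<kappa>0: "0 \<le> \<kappa> h" for h using \<rho>0 by (simp add: \<kappa>_def)
  have "T.expands (int h) (\<kappa> h) (fps_swap (tree_gf (spine_gen (pmf p) \<sigma> h)))"
  proof (rule T.expands_spine)
    have "1 < exp \<alpha>" using \<alpha> by simp
    then have "?s \<le> exp \<alpha>" using s x by linarith
    then show "?y + (?s - ?y) \<le> \<kappa> 0" using s x by (simp add: \<kappa>_def)
    fix h
    let ?E = "if \<sigma> = Suc h then exp \<alpha> else 1"
    have "(zval x * ?E) * ((\<Sum>m\<le>R. taylor_val biased m ?y * (if \<sigma> < h + 2 then 0 else ?s - ?y) ^ m) * \<kappa> h)
      \<le> (1 * ?E) * (\<rho> * \<kappa> h)"
      using z g \<rho>0 \<kappa>0 s x
      by (intro mult_mono mult_nonneg_nonneg sum_nonneg taylor_val_nonneg zero_le_power)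
        (auto simp: biased_nonneg summable_biased)
    also have "\<dots> = \<kappa> (Suc h)" by (auto simp: \<kappa>_def le_Suc_eq)
    finally show "(zval x * ?E) * ((\<Sum>m\<le>R. taylor_val biased m ?y * (if \<sigma> < h + 2 then 0 else ?s - ?y) ^ m) * \<kappa> h)
      \<le> \<kappa> (Suc h)" .
  qed
  moreover have "\<kappa> h \<le> 2 * exp (- (c * x * real h / 2))"
  proof -
    have "\<rho> \<le> exp (- (c * x / 2))" using exp_ge_add_one_self[of "- (c * x / 2)"] by (simp add: \<rho>_def)
    then have "\<rho> ^ h \<le> exp (- (c * x / 2)) ^ h" using \<rho>0 by (rule power_mono)
    also have "\<dots> = exp (- (c * x * real h / 2))" by (simp add: exp_of_nat_mult[symmetric] mult_ac)
    finally show ?thesis unfolding \<kappa>_def using e2 \<rho>0 by (intro mult_mono) auto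
  qed
  ultimately show ?thesis using T.expands_cong by blast
qed

end

text \<open>Each moment costs \<open>1 / \<alpha> \<le> 2 / x\<close>. The second estimate, for
  vertices counted without moments, rests on the crude forest bound and is kept for heights
  comparable with \<open>n\<close>.\<close>

lemma profile_moment_bounds:
  obtains C K c where "C > 0" "K > 0" "c > 0"
    "\<And>x n i h r. 0 < x \<Longrightarrow> x \<le> 1/2 \<Longrightarrow> n \<ge> 1 \<Longrightarrow> 2 * (h + r * i) \<le> n \<Longrightarrow>
      profile_moment n i h r \<le> fact r * (2 / x) ^ r * (C / real n * exp (K * x\<^sup>2 * real n - c * x * real h))"
    "\<And>x n i h. 0 < x \<Longrightarrow> x \<le> 1/2 \<Longrightarrow>
      profile_moment n i h 0 \<le> C * exp (K * x\<^sup>2 * real n - c * x * real h)"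
proof -
  obtain c where c: "c > 0" "\<And>u. 0 \<le> u \<Longrightarrow> u \<le> 1 \<Longrightarrow> pd u \<le> 1 - c * (1 - u)" by (rule pd_le) blast
  obtain C d where Cd: "C > 0" "d > 0"
    "\<And>n k N. n \<ge> 1 \<Longrightarrow> 2 * k \<le> n \<Longrightarrow> (Y ^ N) $ (n - k) \<le> C / real n * exp (- d * (real N)\<^sup>2 / real n)"
    using fixed_point_power_bound[OF Y_fixed_point] by blast
  define K where "K = 2 * S + 1 / d"
  have K: "K > 0" "2 * S \<le> K" using Cd S_nonneg by (auto simp: K_def add_nonneg_pos)
  have e: "exp (K * x\<^sup>2 * real n - c / 2 * x * real h) = exp (K * x\<^sup>2 * real n) * exp (- (c * x * real h / 2))" for x n h
    by (simp add: exp_add[symmetric])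
  have 1: "profile_moment n i h r \<le> fact r * (2 / x) ^ r * (2 * C / real n * exp (K * x\<^sup>2 * real n - c / 2 * x * real h))"
    if x: "0 < x" "x \<le> 1/2" and n: "n \<ge> 1" and deg: "2 * (h + r * i) \<le> n" for x n i h r
  proof -
    define \<alpha> where "\<alpha> = - ln (1 - x) / 2"
    have \<alpha>_ge: "\<alpha> \<ge> x / 2" "\<alpha> > 0"
      using ln_le_minus_one[of "1 - x"] x by (auto simp: \<alpha>_def)
    interpret steiner_expansion Y "1 - x" "zval x" \<alpha> i r
      by unfold_locales (use x \<alpha>_ge zval_bounds[OF x] in auto)
    let ?A = "C / real n * exp (K * x\<^sup>2 * real n)"
    have A: "0 \<le> ?A" using Cd by simp
    have "fps_swap (tree_gf (spine_gen (pmf p) i h)) $ r $ n * \<alpha> ^ r \<le> ?A * (2 * exp (- (c * x * real h / 2)))"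
    proof (rule expands_bound[OF spine_expansion[OF x c, of i r h, folded \<alpha>_def] order_refl _ A])
      show "int h + int (r * i) \<le> int (h + r * i)" by simp
      fix k N assume k: "k \<le> h + r * i" "k \<le> n"
      have "(Y ^ N) $ (n - k) \<le> C / real n * exp (- d * (real N)\<^sup>2 / real n)"
        using k deg n by (intro Cd(3)) auto
      also have "\<dots> \<le> C / real n * (exp (K * x\<^sup>2 * real n) * (zval x ^ k * (1 - x) ^ N))"
        unfolding K_def using Cd k n by (intro mult_left_mono gaussian_le_zval x) auto
      finally show "(Y ^ N) $ (n - k) \<le> ?A * (zval x ^ k * (1 - x) ^ N)" by simp
    qed
    then have "fps_swap (tree_gf (spine_gen (pmf p) i h)) $ r $ n \<le> ?A * (2 * exp (- (c * x * real h / 2))) / \<alpha> ^ r"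
      by (rule mult_imp_le_div_pos[OF zero_less_power[OF \<alpha>_ge(2)]])
    also have "\<dots> = (1 / \<alpha>) ^ r * (?A * (2 * exp (- (c * x * real h / 2))))"
      by (simp add: power_one_over)
    also have "\<dots> \<le> (2 / x) ^ r * (?A * (2 * exp (- (c * x * real h / 2))))"
      using \<alpha>_ge x A Cd(1) by (intro mult_right_mono power_mono) (auto simp: field_simps)
    also have "?A * (2 * exp (- (c * x * real h / 2))) = 2 * C / real n * exp (K * x\<^sup>2 * real n - c / 2 * x * real h)"
      by (simp only: e) (simp add: mult_ac)
    finally show ?thesis unfolding profile_moment_eq mult.assoc[of "fact r"] by (intro mult_left_mono) auto
  qed
  have 2: "profile_moment n i h 0 \<le> 2 * exp (K * x\<^sup>2 * real n - c / 2 * x * real h)"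
    if x: "0 < x" "x \<le> 1/2" for x n i h
  proof -
    define \<alpha> where "\<alpha> = - ln (1 - x) / 2"
    have \<alpha>: "\<alpha> > 0" using x by (auto simp: \<alpha>_def)
    interpret steiner_expansion Y "1 - x" "zval x" \<alpha> i 0
      by unfold_locales (use x \<alpha> zval_bounds[OF x] in auto)
    let ?A = "exp (2 * S * x\<^sup>2 * real n)"
    have "fps_swap (tree_gf (spine_gen (pmf p) i h)) $ 0 $ n * \<alpha> ^ 0 \<le> ?A * (2 * exp (- (c * x * real h / 2)))"
      by (rule expands_bound[OF spine_expansion[OF x c, of i 0 h, folded \<alpha>_def] order_refl])
        (auto intro!: Y_power_le_crude[OF x])
    also have "?A \<le> exp (K * x\<^sup>2 * real n)" using K by (simp add: mult_right_mono)
    also have "exp (K * x\<^sup>2 * real n) * (2 * exp (- (c * x * real h / 2))) = 2 * exp (K * x\<^sup>2 * real n - c / 2 * x * real h)"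
      by (simp only: e)
    finally show ?thesis by (simp add: profile_moment_eq)
  qed
  show ?thesis
  proof (rule that[of "max 2 (2 * C)" K "c / 2"])
    show "profile_moment n i h r \<le> fact r * (2 / x) ^ r * (max 2 (2 * C) / real n * exp (K * x\<^sup>2 * real n - c / 2 * x * real h))"
      if "0 < x" "x \<le> 1/2" "n \<ge> 1" "2 * (h + r * i) \<le> n" for x n i h r
      by (rule order_trans[OF 1[OF that]]) (use that in \<open>auto intro!: mult_left_mono mult_right_mono divide_right_mono\<close>)
    show "profile_moment n i h 0 \<le> max 2 (2 * C) * exp (K * x\<^sup>2 * real n - c / 2 * x * real h)"
      if "0 < x" "x \<le> 1/2" for x n i h
      by (rule order_trans[OF 2[OF that]]) (auto intro!: mult_right_mono)
  qed (use Cd K c in auto)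
qed

end

section \<open>Moments under \<open>r + 1\<close> finite offspring moments\<close>

lemma sum_power_le_geometric:
  assumes "0 \<le> q" "q < (1::real)"
  shows "(\<Sum>m<R. q ^ m) \<le> 1 / (1 - q)"
proof -
  have "(\<Sum>m<R. q ^ m) \<le> (\<Sum>m. q ^ m)"
    using assms by (intro sum_le_suminf) auto
  then show ?thesis using assms by (simp add: suminf_geometric)
qed

lemma sum_Suc_power_le_geometric:
  assumes "0 \<le> q" "q < (1::real)"
  shows "(\<Sum>m\<le>R. real (Suc m) * q ^ m) \<le> (1 / (1 - q))\<^sup>2"
proof -
  have "(1 - q)\<^sup>2 * (\<Sum>m\<le>R. real (Suc m) * q ^ m) = 1 - q ^ Suc R - real (Suc R) * q ^ Suc R * (1 - q)"
    by (induction R) (simp_all add: power2_eq_square algebra_simps)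
  also have "\<dots> \<le> 1"
  proof -
    have "0 \<le> q ^ Suc R" "0 \<le> real (Suc R) * q ^ Suc R * (1 - q)"
      using assms by (intro mult_nonneg_nonneg zero_le_power; simp)+
    then show ?thesis by linarith
  qed
  finally show ?thesis using assms by (simp add: power_one_over le_divide_eq mult.commute)
qed

lemma dominated_mono: "dominated y c b \<Longrightarrow> b \<le> b' \<Longrightarrow> dominated y c b'"
  unfolding dominated_def using order_trans by blast

context critical_offspring begin

text \<open>\<open>F m\<close> is the \<open>m\<close>-th Taylor coefficient at 1. Criticality,
  \<open>F 1 = 1\<close>, allows the exponent \<open>m - 1\<close>, and so a comparison map with
  derivative 1 at 0. The coefficient of order \<open>m\<close> of the derivative is
  \<open>Suc m * F (Suc m)\<close>, whence the \<open>1 + r\<close> moments.\<close>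

lemma binomial_moment_bound:
  assumes mom: "summable (\<lambda>k. real k ^ (1 + r) * pmf p k)"
  obtains b where "b \<ge> 1"
    "\<And>m y. 1 \<le> m \<Longrightarrow> m \<le> r \<Longrightarrow> 0 \<le> y \<Longrightarrow> y < 1 \<Longrightarrow> taylor_val (pmf p) m y \<le> b ^ (m - 1)"
    "\<And>m y. m \<le> r \<Longrightarrow> 0 \<le> y \<Longrightarrow> y < 1 \<Longrightarrow> taylor_val biased m y \<le> real (Suc m) * b ^ m"
proof -
  define F where "F m = (\<Sum>d. pmf p d * real (d choose m))" for m
  have sF: "summable (\<lambda>d. pmf p d * real (d choose m))" if m: "m \<le> Suc r" for m
  proof (rule summable_comparison_test')
    show "summable (\<lambda>d. pmf p d + real d ^ (1 + r) * pmf p d)"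
      by (intro summable_add summable_pmf_nat mom)
    fix d
    have "d choose m \<le> 1 + d ^ (1 + r)"
    proof (cases "1 \<le> d \<and> m \<le> d")
      case True
      then have "d choose m \<le> d ^ m" by (intro binomial_le_pow) simp
      also have "\<dots> \<le> d ^ (1 + r)" using True m by (intro power_increasing) auto
      finally show ?thesis by simp
    next
      case False
      then show ?thesis by (cases "d = 0"; cases "m = 0") (auto simp: binomial_eq_0)
    qed
    then have "real (d choose m) \<le> 1 + real d ^ (1 + r)" by (metis of_nat_1 of_nat_add of_nat_le_iff of_nat_power)
    then have "pmf p d * real (d choose m) \<le> pmf p d * (1 + real d ^ (1 + r))"
      by (intro mult_left_mono) auto
    then show "norm (pmf p d * real (d choose m)) \<le> pmf p d + real d ^ (1 + r) * pmf p d"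
      by (simp add: algebra_simps)
  qed
  have F0: "0 \<le> F m" if "m \<le> Suc r" for m
    unfolding F_def using that by (intro suminf_nonneg sF) auto
  have F1: "F 1 = 1" using sums_unique[OF mean_sums] by (simp add: F_def)
  define b where "b = 1 + (\<Sum>m\<le>Suc r. F m)"
  have "0 \<le> (\<Sum>m\<le>Suc r. F m)" by (intro sum_nonneg F0) auto
  then have b: "b \<ge> 1" by (simp only: b_def)
  have Fb: "F (Suc m) \<le> b ^ m" if "m \<le> r" for m
  proof (cases "m = 0")
    case True
    then show ?thesis using F1 by simp
  next
    case False
    have "F (Suc m) \<le> (\<Sum>m\<le>Suc r. F m)" using that F0 by (intro member_le_sum) auto
    also have "\<dots> \<le> b" by (simp add: b_def)
    also have "b \<le> b ^ m" using b False by (intro self_le_power) auto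
    finally show ?thesis .
  qed
  have biased_sum: "(\<lambda>d. biased d * real (d choose m)) sums (real (Suc m) * F (Suc m))" if "m \<le> r" for m
  proof -
    have "(\<lambda>d. pmf p d * real (d choose Suc m)) sums F (Suc m)"
      unfolding F_def using that by (intro summable_sums sF) simp
    then have "(\<lambda>d. pmf p (Suc d) * real (Suc d choose Suc m)) sums (F (Suc m) - pmf p 0 * real (0 choose Suc m))"
      by (subst sums_Suc_iff) simp
    then have "(\<lambda>d. pmf p (Suc d) * real (Suc d choose Suc m)) sums F (Suc m)" by simp
    then have "(\<lambda>d. real (Suc m) * (pmf p (Suc d) * real (Suc d choose Suc m))) sums (real (Suc m) * F (Suc m))"
      by (rule sums_mult)
    moreover have "real (Suc m) * (pmf p (Suc d) * real (Suc d choose Suc m)) = biased d * real (d choose m)" for d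
    proof -
      have "real (Suc m) * real (Suc d choose Suc m) = real (Suc d) * real (d choose m)"
        using Suc_times_binomial[of m d] by (metis of_nat_mult)
      then show ?thesis by (simp add: size_biased_def mult_ac del: binomial_Suc_Suc of_nat_Suc)
    qed
    ultimately show ?thesis by simp
  qed
  show ?thesis
  proof (rule that[OF b])
    fix m :: nat and y :: real assume m: "1 \<le> m" "m \<le> r" and y: "0 \<le> y" "y < 1"
    have "taylor_val (pmf p) m y \<le> F m"
      unfolding F_def using m y by (intro taylor_val_le_moment sF) (auto simp: summable_pmf_nat)
    also have "\<dots> \<le> b ^ (m - 1)" using Fb[of "m - 1"] m by simp
    finally show "taylor_val (pmf p) m y \<le> b ^ (m - 1)" .
  next
    fix m :: nat and y :: real assume m: "m \<le> r" and y: "0 \<le> y" "y < 1"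
    have "taylor_val biased m y \<le> (\<Sum>d. biased d * real (d choose m))"
      using y sums_summable[OF biased_sum[OF m]]
      by (intro taylor_val_le_moment) (auto simp: summable_biased biased_nonneg)
    also have "\<dots> = real (Suc m) * F (Suc m)" using sums_unique[OF biased_sum[OF m]] by simp
    also have "\<dots> \<le> real (Suc m) * b ^ m" using Fb[OF m] by (intro mult_left_mono) auto
    finally show "taylor_val biased m y \<le> real (Suc m) * b ^ m" .
  qed
qed

text \<open>With \<open>r + 1\<close> moments, the Taylor coefficients of the offspring generating function are dominated
  by those of the Moebius map \<open>u \<mapsto> u / (1 - b * u)\<close>, whose iterates are explicit.\<close>

lemma spine_expansion_moments:
  fixes x b c :: real and i r h :: nat
  assumes x: "0 < x" "x \<le> 1/2" and i: "i \<ge> 1" and b: "b \<ge> 1"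
    and f: "\<And>m y. 1 \<le> m \<Longrightarrow> m \<le> r \<Longrightarrow> 0 \<le> y \<Longrightarrow> y < 1 \<Longrightarrow> taylor_val (pmf p) m y \<le> b ^ (m - 1)"
    and f': "\<And>m y. m \<le> r \<Longrightarrow> 0 \<le> y \<Longrightarrow> y < 1 \<Longrightarrow> taylor_val biased m y \<le> real (Suc m) * b ^ m"
    and c: "c > 0" "\<And>u. 0 \<le> u \<Longrightarrow> u \<le> 1 \<Longrightarrow> pd u \<le> 1 - c * (1 - u)"
  shows "steiner_expansion.expands Y (1 - x) (zval x) (1 / (4 * (1 + real i * b))) i r (int h)
    (24 * (1 - c * x) ^ (h - i)) (fps_swap (tree_gf (spine_gen (pmf p) i h)))"
proof -
  note z = zval_bounds[OF x]
  \<comment> \<open>So small that the first \<open>i\<close> iterates of the Moebius map from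
    \<open>\<beta>\<close> stay away from its pole, that is \<open>D j \<ge> 1 / 2\<close>. The
    \<open>j\<close>-th iterate is \<open>e j\<close>.\<close>
  define \<beta> where "\<beta> = 1 / (2 * (1 + real i * b))"
  \<comment> \<open>Half of \<open>\<beta>\<close>, since
    \<open>exp \<alpha> - 1 \<le> 2 * \<alpha>\<close> for \<open>\<alpha> \<le> 1\<close>.\<close>
  define \<alpha> where "\<alpha> = 1 / (4 * (1 + real i * b))"
  define \<rho> where "\<rho> = 1 - c * x"
  define D where "D j = 1 - real j * b * \<beta>" for j
  have ib: "real i * b \<ge> 0" using b by simp
  have \<beta>: "0 < \<beta>" "\<beta> \<le> 1/2" "\<beta> = 2 * \<alpha>"
    using ib by (auto simp: \<beta>_def \<alpha>_def divide_simps)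
  have \<alpha>: "0 < \<alpha>" "\<alpha> \<le> 1" using \<beta> by auto
  have pdy: "pd (1 - x) \<le> \<rho>" using c(2)[of "1 - x"] x by (simp add: \<rho>_def)
  have \<rho>: "0 \<le> \<rho>" "\<rho> \<le> 1" using pdy pd_nonneg[of "1 - x"] x c by (auto simp: \<rho>_def)
  have D: "1 / 2 \<le> D j" "D j \<le> 1" if "j \<le> i" for j
  proof -
    have "real j * b * \<beta> \<le> real i * b * \<beta>" using that b \<beta> by (intro mult_right_mono) auto
    also have "\<dots> \<le> 1/2" using ib by (simp add: \<beta>_def divide_simps)
    finally show "1 / 2 \<le> D j" by (simp add: D_def)
    show "D j \<le> 1" using b \<beta> by (simp add: D_def)
  qed
  have D_pos: "0 < D j" if "j \<le> i" for j using D[OF that] by linarith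
  define e where "e j = \<beta> / D j" for j
  have be: "1 - b * e j = D (Suc j) / D j" "0 \<le> b * e j" "b * e j < 1" if "Suc j \<le> i" for j
  proof -
    have "D (Suc j) = D j - b * \<beta>" by (simp add: D_def algebra_simps)
    then show 1: "1 - b * e j = D (Suc j) / D j"
      using D_pos[of j] that by (simp add: e_def field_simps)
    have "0 < D (Suc j) / D j" using D_pos that by simp
    then show "b * e j < 1" using 1 by linarith
    show "0 \<le> b * e j" using b \<beta> D_pos[of j] that by (simp add: e_def less_imp_le)
  qed
  have e_le: "0 \<le> e j" "e j \<le> 1" if "j \<le> i" for j
  proof -
    show "0 \<le> e j" using \<beta> D_pos[OF that] by (simp add: e_def less_imp_le)
    show "e j \<le> 1" using \<beta> D[OF that] D_pos[OF that] by (simp add: e_def divide_le_eq)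
  qed
  \<comment> \<open>At order 0 the general bound 1 is sharpened to \<open>\<rho>\<close>; this gives
    the decay where siblings carry no marks.\<close>
  let ?f' = "\<lambda>m. if m = 0 then \<rho> else real (Suc m) * b ^ m"
  interpret T: tree_expansion "pmf p" "1 - x" "zval x" \<alpha> i r "\<lambda>m. b ^ (m - 1)" ?f' e
  proof
    show "Y $ 0 = 0" by simp
    show "0 \<le> 1 - x" "0 \<le> zval x" "0 < \<alpha>" using x z \<alpha> by auto
    show "dominated (1 - x) (taylor_coeff (pmf p) m) (b ^ (m - 1))" if "m \<in> {1..r}" for m
      by (rule dominated_mono[OF dominated_taylor_coeff f]) (use that x in \<open>auto simp: summable_pmf_nat\<close>)
    show "dominated (1 - x) (taylor_coeff biased m) (?f' m)" if m: "m \<le> r" for m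
    proof (rule dominated_mono[OF dominated_taylor_coeff])
      have "taylor_val biased 0 (1 - x) = pd (1 - x)"
        using x by (intro taylor_val_0) (auto simp: biased_nonneg summable_biased)
      then show "taylor_val biased m (1 - x) \<le> ?f' m"
        using pdy f'[OF m, of "1 - x"] x by auto
    qed (use x in \<open>auto simp: summable_biased biased_nonneg\<close>)
    have "exp \<alpha> \<le> 1 + \<alpha> + \<alpha>\<^sup>2" using \<alpha> by (intro exp_bound) auto
    also have "\<alpha>\<^sup>2 \<le> \<alpha> * 1" unfolding power2_eq_square using \<alpha> by (intro mult_left_mono) auto
    finally have "exp \<alpha> - 1 \<le> \<beta>" using \<beta> by simp
    then have "(1 - x) * (exp \<alpha> - 1) \<le> 1 * \<beta>" using x \<alpha> by (intro mult_mono) auto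
    then show "(1 - x) * (exp \<alpha> - 1) \<le> e 0" by (simp add: e_def D_def)
    fix j assume j: "j < i"
    have "(\<Sum>m=1..r. b ^ (m - 1) * e j ^ m) = e j * (\<Sum>m<r. (b * e j) ^ m)"
      by (simp add: sum.atLeast1_atMost_eq sum_distrib_left power_mult_distrib mult_ac)
    also have "\<dots> \<le> e j * (1 / (1 - b * e j))"
      using be[of j] e_le[of j] j by (intro mult_left_mono sum_power_le_geometric) auto
    also have "\<dots> = e (Suc j)" using be[of j] D_pos[of j] j by (simp add: e_def)
    finally have "(\<Sum>m=1..r. b ^ (m - 1) * e j ^ m) \<le> e (Suc j)" .
    moreover have "zval x * (\<Sum>m=1..r. b ^ (m - 1) * e j ^ m) \<le> 1 * (\<Sum>m=1..r. b ^ (m - 1) * e j ^ m)"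
      using z b e_le[of j] j by (intro mult_right_mono sum_nonneg) auto
    ultimately show "zval x * (\<Sum>m=1..r. b ^ (m - 1) * e j ^ m) \<le> e (Suc j)" by simp
  qed
  define K where "K = 1 + e i"
  have K: "1 \<le> K" "K \<le> 2" using e_le[of i] by (auto simp: K_def)
  \<comment> \<open>Below height \<open>i\<close> the factors
    \<open>(D j / D (Suc j))\<^sup>2\<close>, derivatives of the Moebius map along its orbit,
    telescope. At height \<open>i\<close> the number 12 collects \<open>exp \<alpha> \<le> 3\<close>
    and a telescoped product of at most 4; from there on each step costs
    \<open>\<rho>\<close>.\<close>
  define \<kappa> where "\<kappa> h = K * (if h < i then (D (i - h - 1) / D (i - 1))\<^sup>2 else 12 * \<rho> ^ (h - i))" for h
  have \<kappa>0: "0 \<le> \<kappa> h" for h using K \<rho> by (simp add: \<kappa>_def)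
  have Dr: "(D j / D (i - 1))\<^sup>2 \<le> 4" if "j \<le> i" for j
  proof -
    have "D j / D (i - 1) \<le> 1 / (1 / 2)" using D[OF that] D[of "i - 1"] by (intro frac_le) auto
    then have "(D j / D (i - 1))\<^sup>2 \<le> 2\<^sup>2" using D_pos[OF that] D_pos[of "i - 1"] by (intro power_mono) auto
    then show ?thesis by simp
  qed
  have "T.expands (int h) (\<kappa> h) (fps_swap (tree_gf (spine_gen (pmf p) i h)))"
  proof (rule T.expands_spine)
    show "1 - x + e i \<le> \<kappa> 0" using i x D_pos[of "i - 1"] by (simp add: \<kappa>_def K_def)
    fix h
    let ?E = "if i = Suc h then exp \<alpha> else 1"
    let ?xi = "if i < h + 2 then 0 else e (i - h - 2)"
    let ?s = "\<Sum>m\<le>r. ?f' m * ?xi ^ m"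
    have xi0: "0 \<le> ?xi" using e_le by simp
    have s0: "0 \<le> ?s" using \<rho> b xi0 by (intro sum_nonneg mult_nonneg_nonneg zero_le_power) auto
    have "?E * (?s * \<kappa> h) \<le> \<kappa> (Suc h)"
    proof (cases "h + 2 \<le> i")
      case True
      define j where "j = i - h - 2"
      have j: "Suc j \<le> i" "i - h - 1 = Suc j" "i - Suc h - 1 = j" using True by (auto simp: j_def)
      have "?s = (\<Sum>m\<le>r. ?f' m * e j ^ m)" using True by (simp add: j_def)
      also have "\<dots> \<le> (\<Sum>m\<le>r. real (Suc m) * (b * e j) ^ m)"
      proof (intro sum_mono)
        fix m
        have "?f' m \<le> real (Suc m) * b ^ m" using \<rho> by auto
        then have "?f' m * e j ^ m \<le> real (Suc m) * b ^ m * e j ^ m"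
          using e_le[of j] j by (intro mult_right_mono) auto
        then show "?f' m * e j ^ m \<le> real (Suc m) * (b * e j) ^ m"
          by (simp only: power_mult_distrib mult.assoc)
      qed
      also have "\<dots> \<le> (1 / (1 - b * e j))\<^sup>2"
        using be[of j] j by (intro sum_Suc_power_le_geometric) auto
      also have "\<dots> = (D j / D (Suc j))\<^sup>2" using be(1)[of j] j by simp
      finally have "?s * \<kappa> h \<le> (D j / D (Suc j))\<^sup>2 * \<kappa> h" using \<kappa>0 by (rule mult_right_mono)
      also have "\<dots> = \<kappa> (Suc h)"
        using True D_pos[of "Suc j"] j(1) unfolding \<kappa>_def j(2,3) by (simp add: power_divide)
      finally show ?thesis using True by simp
    next
      case False
      have "?s = \<rho>" using False by (simp add: power_0_left if_distrib cong: if_cong)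
      show ?thesis
      proof (cases "i = Suc h")
        case True
        have "exp \<alpha> \<le> exp 1" using \<alpha> by simp
        also have "\<dots> \<le> 3" by (rule exp_le)
        finally have "exp \<alpha> * (\<rho> * \<kappa> h) \<le> 3 * (1 * (K * 4))"
          using \<rho> \<kappa>0[of h] Dr[of 0] K True
          by (intro mult_mono) (auto simp: \<kappa>_def)
        also have "\<dots> = \<kappa> (Suc h)" using True by (simp add: \<kappa>_def)
        finally show ?thesis using True \<open>?s = \<rho>\<close> by simp
      next
        case ne: False
        then have "i \<le> h" using False by simp
        then show ?thesis using ne \<open>?s = \<rho>\<close> by (simp add: \<kappa>_def Suc_diff_le)
      qed
    qed
    moreover have "(zval x * ?E) * (?s * \<kappa> h) \<le> (1 * ?E) * (?s * \<kappa> h)"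
      using z s0 \<kappa>0 by (intro mult_right_mono) auto
    ultimately show "(zval x * ?E) * (?s * \<kappa> h) \<le> \<kappa> (Suc h)" by simp
  qed
  moreover have "\<kappa> h \<le> 24 * (1 - c * x) ^ (h - i)"
  proof (cases "h < i")
    case True
    have "K * (D (i - h - 1) / D (i - 1))\<^sup>2 \<le> 2 * 4" using K by (intro mult_mono Dr) auto
    then show ?thesis using True by (simp add: \<kappa>_def)
  next
    case False
    have "K * (12 * \<rho> ^ (h - i)) \<le> 2 * (12 * \<rho> ^ (h - i))" using K \<rho> by (intro mult_right_mono) auto
    then show ?thesis using False by (simp add: \<kappa>_def \<rho>_def)
  qed
  ultimately show ?thesis using T.expands_cong unfolding \<alpha>_def by blast
qed

text \<open>Now \<open>1 / \<alpha>\<close> is of order \<open>i\<close>, whatever \<open>x\<close>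
  is, and each moment costs \<open>i\<close>; \<open>x\<close> only governs the exponentials. The
  decay starts at height \<open>i\<close>, hence the truncated difference
  \<open>h - i\<close>.\<close>

lemma profile_moment_bound_moments:
  assumes mom: "summable (\<lambda>k. real k ^ (1 + r) * pmf p k)"
  obtains C K c where "C > 0" "K > 0" "c > 0"
    "\<And>x n i h. 0 < x \<Longrightarrow> x \<le> 1/2 \<Longrightarrow> n \<ge> 1 \<Longrightarrow> i \<ge> 1 \<Longrightarrow> 2 * (h + r * i) \<le> n \<Longrightarrow>
      profile_moment n i h r \<le> C * real i ^ r / real n * exp (K * x\<^sup>2 * real n) * exp (- c * x * real (h - i))"
proof -
  obtain c where c: "c > 0" "\<And>u. 0 \<le> u \<Longrightarrow> u \<le> 1 \<Longrightarrow> pd u \<le> 1 - c * (1 - u)" by (rule pd_le) blast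
  obtain b where b: "b \<ge> 1"
    "\<And>m y. 1 \<le> m \<Longrightarrow> m \<le> r \<Longrightarrow> 0 \<le> y \<Longrightarrow> y < 1 \<Longrightarrow> taylor_val (pmf p) m y \<le> b ^ (m - 1)"
    "\<And>m y. m \<le> r \<Longrightarrow> 0 \<le> y \<Longrightarrow> y < 1 \<Longrightarrow> taylor_val biased m y \<le> real (Suc m) * b ^ m"
    using binomial_moment_bound[OF mom] by blast
  obtain C d where Cd: "C > 0" "d > 0"
    "\<And>n k N. n \<ge> 1 \<Longrightarrow> 2 * k \<le> n \<Longrightarrow> (Y ^ N) $ (n - k) \<le> C / real n * exp (- d * (real N)\<^sup>2 / real n)"
    using fixed_point_power_bound[OF Y_fixed_point] by blast
  define K where "K = 2 * S + 1 / d"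
  have K: "K > 0" using Cd S_nonneg by (auto simp: K_def add_nonneg_pos)
  define C' where "C' = fact r * ((4 * (1 + b)) ^ r * (C * 24))"
  have C': "C' > 0" using Cd b by (auto simp: C'_def)
  have "profile_moment n i h r \<le> C' * real i ^ r / real n * exp (K * x\<^sup>2 * real n) * exp (- c * x * real (h - i))"
    if x: "0 < x" "x \<le> 1/2" and n: "n \<ge> 1" and i: "i \<ge> 1" and deg: "2 * (h + r * i) \<le> n" for x n i h
  proof -
    define \<alpha> where "\<alpha> = 1 / (4 * (1 + real i * b))"
    have ib: "real i * b \<ge> 0" using b by simp
    then have \<alpha>_pos: "\<alpha> > 0" by (simp add: \<alpha>_def add_pos_nonneg)
    interpret steiner_expansion Y "1 - x" "zval x" \<alpha> i r
      by unfold_locales (use x \<alpha>_pos zval_bounds[OF x] in auto)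
    let ?A = "C / real n * exp (K * x\<^sup>2 * real n)"
    let ?B = "24 * (1 - c * x) ^ (h - i)"
    have A: "0 \<le> ?A" using Cd by simp
    have \<rho>0: "0 \<le> 1 - c * x" using c(2)[of "1 - x"] pd_nonneg[of "1 - x"] x by simp
    have "fps_swap (tree_gf (spine_gen (pmf p) i h)) $ r $ n * \<alpha> ^ r \<le> ?A * ?B"
    proof (rule expands_bound[OF spine_expansion_moments[OF x i b c, of r h, folded \<alpha>_def] order_refl _ A])
      show "int h + int (r * i) \<le> int (h + r * i)" by simp
      fix k N assume k: "k \<le> h + r * i" "k \<le> n"
      have "(Y ^ N) $ (n - k) \<le> C / real n * exp (- d * (real N)\<^sup>2 / real n)"
        using k deg n by (intro Cd(3)) auto
      also have "\<dots> \<le> C / real n * (exp (K * x\<^sup>2 * real n) * (zval x ^ k * (1 - x) ^ N))"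
        unfolding K_def using Cd k n by (intro mult_left_mono gaussian_le_zval x) auto
      finally show "(Y ^ N) $ (n - k) \<le> ?A * (zval x ^ k * (1 - x) ^ N)" by simp
    qed
    then have "fps_swap (tree_gf (spine_gen (pmf p) i h)) $ r $ n \<le> ?A * ?B / \<alpha> ^ r"
      by (rule mult_imp_le_div_pos[OF zero_less_power[OF \<alpha>_pos]])
    also have "\<dots> = (1 / \<alpha>) ^ r * (?A * ?B)"
      by (simp add: power_one_over)
    also have "\<dots> \<le> (4 * (1 + b) * real i) ^ r * (?A * (24 * exp (- c * x * real (h - i))))"
    proof (intro mult_mono power_mono mult_left_mono)
      have "1 / \<alpha> = 4 * (1 + real i * b)" by (simp add: \<alpha>_def)
      also have "\<dots> \<le> 4 * (real i + real i * b)" using i by simp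
      finally show "1 / \<alpha> \<le> 4 * (1 + b) * real i" by (simp add: algebra_simps)
      have "(1 - c * x) ^ (h - i) \<le> exp (- (c * x)) ^ (h - i)"
        using \<rho>0 exp_ge_add_one_self[of "- (c * x)"] by (intro power_mono) auto
      then show "(1 - c * x) ^ (h - i) \<le> exp (- c * x * real (h - i))"
        by (simp add: exp_of_nat_mult[symmetric] mult_ac)
    qed (use A \<alpha>_pos b \<rho>0 Cd(1) in auto)
    finally have "profile_moment n i h r \<le> fact r * ((4 * (1 + b) * real i) ^ r * (?A * (24 * exp (- c * x * real (h - i)))))"
      unfolding profile_moment_eq by (intro mult_left_mono) auto
    also have "\<dots> = C' * real i ^ r / real n * exp (K * x\<^sup>2 * real n) * exp (- c * x * real (h - i))"
      by (simp add: C'_def power_mult_distrib)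
    finally show ?thesis .
  qed
  then show ?thesis using that[OF C' K c(1)] by blast
qed

end

section \<open>The distance profile\<close>

lemma power_mult_exp_neg_le:
  fixes d x :: real
  assumes "d > 0" "x \<ge> 0"
  shows "x ^ k * exp (- d * x) \<le> fact k / d ^ k"
proof -
  have s: "(\<lambda>l. (d * x) ^ l / fact l) sums exp (d * x)"
    using exp_converges[of "d * x"] by (simp add: divide_inverse mult.commute)
  have "(\<Sum>l\<in>{k}. (d * x) ^ l / fact l) \<le> (\<Sum>l. (d * x) ^ l / fact l)"
    using assms by (intro sum_le_suminf sums_summable[OF s]) auto
  then have "(d * x) ^ k / fact k \<le> exp (d * x)" using sums_unique[OF s] by simp
  then have "x ^ k * d ^ k \<le> fact k * exp (d * x)"
    by (simp add: power_mult_distrib divide_le_eq mult.commute)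
  then have "x ^ k * d ^ k * exp (- d * x) \<le> fact k * exp (d * x) * exp (- d * x)"
    by (intro mult_right_mono) auto
  also have "fact k * exp (d * x) * exp (- d * x) = fact k"
    by (simp add: mult.assoc flip: exp_add)
  finally show ?thesis using assms by (simp add: le_divide_eq mult_ac)
qed

lemma sum_power_le_card_mult:
  fixes f :: "'a \<Rightarrow> real"
  assumes "finite A" "\<And>x. x \<in> A \<Longrightarrow> 0 \<le> f x"
  shows "(\<Sum>x\<in>A. f x) ^ Suc r \<le> real (card A) ^ r * (\<Sum>x\<in>A. f x ^ Suc r)"
proof (cases "A = {}")
  case False
  let ?k = "real (card A)"
  have k: "?k > 0" using assms(1) False by (simp add: card_gt_0_iff)
  have cv: "convex_on {0::real..} (\<lambda>x. x ^ Suc r)"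
    by (cases "even (Suc r)") (auto intro: convex_power_odd convex_on_subset[OF convex_power_even] simp del: power_Suc)
  have "(\<Sum>x\<in>A. (1 / ?k) *\<^sub>R f x) ^ Suc r \<le> (\<Sum>x\<in>A. (1 / ?k) * f x ^ Suc r)"
    by (rule convex_on_sum[OF assms(1) False cv]) (use k assms(2) in auto)
  then have "((\<Sum>x\<in>A. f x) / ?k) ^ Suc r \<le> (\<Sum>x\<in>A. f x ^ Suc r) / ?k"
    by (simp add: sum_divide_distrib del: power_Suc)
  then have "(\<Sum>x\<in>A. f x) ^ Suc r \<le> (\<Sum>x\<in>A. f x ^ Suc r) / ?k * ?k ^ Suc r"
    using k by (simp add: power_divide pos_divide_le_eq del: power_Suc)
  also have "\<dots> = ?k ^ r * (\<Sum>x\<in>A. f x ^ Suc r)"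
    using k by simp
  finally show ?thesis .
qed simp

lemma geometric_exp_sum_le:
  assumes "u > 0"
  shows "(\<Sum>h<n. exp (- u * real h)) \<le> 1 + 1 / u"
proof -
  have "(\<Sum>h<n. exp (- u * real h)) = (\<Sum>h<n. exp (- u) ^ h)"
    by (intro sum.cong refl) (simp add: exp_of_nat_mult[symmetric] mult.commute)
  also have "\<dots> \<le> 1 / (1 - exp (- u))"
    using assms by (intro sum_power_le_geometric) auto
  also have "\<dots> \<le> 1 + 1 / u"
  proof -
    have "1 + u \<le> exp u" by (rule exp_ge_add_one_self)
    then have "exp (- u) \<le> 1 / (1 + u)" using assms by (simp add: exp_minus field_simps)
    then have "u / (1 + u) \<le> 1 - exp (- u)" using assms by (simp add: field_simps)
    then have "1 / (1 - exp (- u)) \<le> 1 / (u / (1 + u))" using assms by (intro divide_left_mono) auto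
    also have "\<dots> = 1 + 1 / u" using assms by (simp add: field_simps)
    finally show ?thesis .
  qed
  finally show ?thesis .
qed

text \<open>With \<open>t = h / sqrt n\<close>, the inequality
  \<open>t\<^sup>2 \<ge> 2 * t - 1\<close> reduces the sum to a geometric series.\<close>

lemma gaussian_sum_le:
  assumes a: "a > 0" and n: "n \<ge> 1"
  shows "(\<Sum>h<m. exp (- a * (real h)\<^sup>2 / real n)) \<le> exp a * (1 + 1 / (2 * a)) * sqrt (real n)"
proof -
  have sn: "sqrt (real n) \<ge> 1" using n by simp
  have "(\<Sum>h<m. exp (- a * (real h)\<^sup>2 / real n)) \<le> (\<Sum>h<m. exp a * exp (- (2 * a / sqrt (real n)) * real h))"
  proof (intro sum_mono)
    fix h
    have "0 \<le> (real h / sqrt (real n) - 1)\<^sup>2" by simp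
    also have "\<dots> = (real h)\<^sup>2 / real n - 2 * (real h / sqrt (real n)) + 1"
      using n by (simp add: power2_diff power_divide)
    finally have "a * (2 * (real h / sqrt (real n)) - 1) \<le> a * ((real h)\<^sup>2 / real n)"
      using a by (intro mult_left_mono) auto
    then have "- a * (real h)\<^sup>2 / real n \<le> a + - (2 * a / sqrt (real n)) * real h"
      by (simp add: algebra_simps)
    then show "exp (- a * (real h)\<^sup>2 / real n) \<le> exp a * exp (- (2 * a / sqrt (real n)) * real h)"
      unfolding exp_add[symmetric] by (simp only: exp_le_cancel_iff)
  qed
  also have "\<dots> = exp a * (\<Sum>h<m. exp (- (2 * a / sqrt (real n)) * real h))"
    by (simp add: sum_distrib_left)
  also have "\<dots> \<le> exp a * (1 + 1 / (2 * a / sqrt (real n)))"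
    using a sn by (intro mult_left_mono geometric_exp_sum_le) auto
  also have "\<dots> \<le> exp a * ((1 + 1 / (2 * a)) * sqrt (real n))"
    using a sn by (intro mult_left_mono) (simp_all add: algebra_simps)
  finally show ?thesis by (simp add: mult.assoc)
qed

lemma at_dist_le: "at_dist i t v \<le> num_verts t"
  unfolding at_dist_def card_verts[symmetric] by (intro card_mono) auto

section \<open>From vertices of a given height to the distance profile\<close>

context critical_offspring begin

lemma wt_nonneg: "0 \<le> wt t"
  by (rule tree_wt_nonneg) simp

lemma profile_moment_eq_0: "n \<le> h \<Longrightarrow> profile_moment n i h r = 0"
  unfolding profile_moment_def
proof (intro sum.neutral ballI)
  fix t assume h: "n \<le> h" and t: "t \<in> trees n"
  have "(\<Sum>v\<in>verts t. if length v = h then real (at_dist i t v) ^ r else 0) = 0"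
    using h t length_less_num_verts[of _ t] by (intro sum.neutral) (fastforce simp: trees_def)
  then show "wt t * (\<Sum>v\<in>verts t. if length v = h then real (at_dist i t v) ^ r else 0) = 0" by simp
qed

lemma profile_moment_le_level:
  "profile_moment n i h r \<le> real n ^ r * profile_moment n i h 0"
proof -
  let ?A = "\<lambda>r t. \<Sum>v\<in>verts t. if length v = h then real (at_dist i t v) ^ r else 0"
  have "?A r t \<le> real n ^ r * ?A 0 t" if t: "t \<in> trees n" for t
    unfolding sum_distrib_left
    using t at_dist_le[of i t] by (intro sum_mono) (auto simp: trees_def intro!: power_mono)
  then have "profile_moment n i h r \<le> (\<Sum>t\<in>trees n. wt t * (real n ^ r * ?A 0 t))"
    unfolding profile_moment_def by (intro sum_mono mult_left_mono wt_nonneg)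
  also have "\<dots> = real n ^ r * profile_moment n i h 0"
    by (simp only: profile_moment_def sum_distrib_left[of "real n ^ r" _ "trees n"] mult.left_commute)
  finally show ?thesis .
qed

text \<open>As \<open>i \<le> 2 * h\<close>, a Steiner tree too large for the main estimate forces
  \<open>h\<close> to be comparable with \<open>n\<close>. Then part of the Gaussian factor is
  exponentially small in \<open>n\<close> and beats the trivial factor \<open>n ^ r\<close>. The
  rate is the same for all \<open>r\<close>.\<close>

lemma profile_moment_gaussian_bound:
  "\<exists>c>0. \<forall>r. \<exists>C>0. \<forall>n i h. n \<ge> 1 \<longrightarrow> i \<le> 2 * h \<longrightarrow>
     profile_moment n i h r \<le> C * (sqrt (real n) ^ r / real n) * exp (- c * (real h)\<^sup>2 / real n)"
proof -
  obtain C K c where C: "C > 0" and K: "K > 0" and c: "c > 0" and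
    main: "\<And>x n i h r. 0 < x \<Longrightarrow> x \<le> 1/2 \<Longrightarrow> n \<ge> 1 \<Longrightarrow> 2 * (h + r * i) \<le> n \<Longrightarrow>
      profile_moment n i h r \<le> fact r * (2 / x) ^ r * (C / real n * exp (K * x\<^sup>2 * real n - c * x * real h))" and
    level: "\<And>x n i h. 0 < x \<Longrightarrow> x \<le> 1/2 \<Longrightarrow>
      profile_moment n i h 0 \<le> C * exp (K * x\<^sup>2 * real n - c * x * real h)"
    by (rule profile_moment_bounds) blast
  \<comment> \<open>With \<open>x = \<epsilon> * h / (2 * n)\<close> the cost
    \<open>K * x\<^sup>2 * n\<close> is at most half of the gain \<open>c * x * h\<close>, and
    \<open>x \<le> 1 / 2\<close> for \<open>h < n\<close>.\<close>
  define \<epsilon> where "\<epsilon> = min 1 (c / K)"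
  have \<epsilon>: "0 < \<epsilon>" "\<epsilon> \<le> 1" "K * \<epsilon> \<le> c"
    using c K by (auto simp: \<epsilon>_def min_def field_simps)
  define c1 where "c1 = c * \<epsilon> / 4"
  have c1: "c1 > 0" using c \<epsilon> by (simp add: c1_def)
  have "\<exists>C'>0. \<forall>n i h. n \<ge> 1 \<longrightarrow> i \<le> 2 * h \<longrightarrow>
     profile_moment n i h r \<le> C' * (sqrt (real n) ^ r / real n) * exp (- (c1 / 2) * (real h)\<^sup>2 / real n)" for r
  proof -
    \<comment> \<open>Chosen so that \<open>n \<le> 2 * h * (1 + 2 * r)\<close> implies
      \<open>\<delta> * n \<le> (c1 / 2) * h\<^sup>2 / n\<close>.\<close>
    define \<delta> where "\<delta> = c1 / (8 * (1 + 2 * real r)\<^sup>2)"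
    have \<delta>: "\<delta> > 0" using c1 by (simp add: \<delta>_def)
    define C1 where "C1 = fact r * 4 ^ r * (C * exp (K / 4))"
    define C2 where "C2 = C * exp (K / 4) * (fact (Suc r) / \<delta> ^ Suc r)"
    have C12: "C1 > 0" "C2 > 0" using C \<delta> by (auto simp: C1_def C2_def)
    have "profile_moment n i h r \<le> (C1 + C2) * (sqrt (real n) ^ r / real n) * exp (- (c1 / 2) * (real h)\<^sup>2 / real n)"
      if n: "n \<ge> 1" and i: "i \<le> 2 * h" for n i h
    proof (cases "n \<le> h")
      case True
      then show ?thesis using profile_moment_eq_0 C12 by (simp add: add_pos_pos less_imp_le)
    next
      case False
      \<comment> \<open>The first entry keeps \<open>2 / x\<close> below \<open>4 * sqrt n\<close>,
        the second produces the decay in \<open>h\<close>. The square of a maximum is at most the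
        sum of the squares, so the cost exceeds that of the second entry by a constant only.\<close>
      define x where "x = max (1 / (2 * sqrt (real n))) (\<epsilon> * real h / (2 * real n))"
      have sn: "sqrt (real n) \<ge> 1" using n by simp
      have x0: "0 < x" using n by (simp add: x_def less_max_iff_disj)
      have "\<epsilon> * real h \<le> 1 * real n" using False \<epsilon> by (intro mult_mono) auto
      then have x1: "x \<le> 1/2" unfolding x_def using n sn
        by (intro max.boundedI) (simp_all add: divide_le_eq)
      have xx: "x\<^sup>2 \<le> 1 / (4 * real n) + \<epsilon>\<^sup>2 * (real h)\<^sup>2 / (4 * (real n)\<^sup>2)"
      proof (cases "1 / (2 * sqrt (real n)) \<le> \<epsilon> * real h / (2 * real n)")
        case True
        then show ?thesis using n by (simp add: x_def max_def power_divide power_mult_distrib)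
      next
        case False
        then show ?thesis using n by (simp add: x_def max_def power_divide power_mult_distrib)
      qed
      have "K * x\<^sup>2 * real n \<le> K * (1 / (4 * real n) + \<epsilon>\<^sup>2 * (real h)\<^sup>2 / (4 * (real n)\<^sup>2)) * real n"
        using xx K by (intro mult_right_mono mult_left_mono) auto
      also have "\<dots> = K / 4 + (K * \<epsilon>) * \<epsilon> / 4 * ((real h)\<^sup>2 / real n)"
        using n by (simp add: field_simps power2_eq_square)
      also have "\<dots> \<le> K / 4 + c * \<epsilon> / 4 * ((real h)\<^sup>2 / real n)"
        using \<epsilon> by (intro add_left_mono mult_right_mono divide_right_mono) auto
      finally have 1: "K * x\<^sup>2 * real n \<le> K / 4 + c1 * ((real h)\<^sup>2 / real n)" by (simp add: c1_def)
      have "c * (\<epsilon> * real h / (2 * real n)) * real h \<le> c * x * real h"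
        using c by (intro mult_right_mono mult_left_mono) (auto simp: x_def)
      then have 2: "2 * c1 * ((real h)\<^sup>2 / real n) \<le> c * x * real h"
        by (simp add: c1_def power2_eq_square mult_ac)
      have ex: "exp (K * x\<^sup>2 * real n - c * x * real h) \<le> exp (K / 4) * exp (- c1 * (real h)\<^sup>2 / real n)"
      proof -
        have "- c1 * (real h)\<^sup>2 / real n = - (c1 * ((real h)\<^sup>2 / real n))" by simp
        then have "K * x\<^sup>2 * real n - c * x * real h \<le> K / 4 + - c1 * (real h)\<^sup>2 / real n"
          using 1 2 by linarith
        then show ?thesis unfolding exp_add[symmetric] by (simp only: exp_le_cancel_iff)
      qed
      have half: "exp (- c1 * (real h)\<^sup>2 / real n) = exp (- (c1 / 2) * (real h)\<^sup>2 / real n) * exp (- (c1 / 2) * (real h)\<^sup>2 / real n)"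
        unfolding exp_add[symmetric] by simp
      have le1: "exp (- (c1 / 2) * (real h)\<^sup>2 / real n) \<le> 1" using c1 by simp
      have q: "0 \<le> sqrt (real n) ^ r / real n * exp (- (c1 / 2) * (real h)\<^sup>2 / real n)" by simp
      show ?thesis
      proof (cases "2 * (h + r * i) \<le> n")
        case True
        have "2 / x \<le> 4 * sqrt (real n)"
        proof -
          have "2 / x \<le> 2 / (1 / (2 * sqrt (real n)))"
            using x0 n by (intro divide_left_mono) (auto simp: x_def)
          then show ?thesis by simp
        qed
        then have "(2 / x) ^ r \<le> (4 * sqrt (real n)) ^ r" using x0 by (intro power_mono) auto
        then have "profile_moment n i h r \<le> fact r * (4 * sqrt (real n)) ^ r * (C / real n * (exp (K / 4) * exp (- c1 * (real h)\<^sup>2 / real n)))"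
          using ex C x0 by (intro order_trans[OF main[OF x0 x1 n True]] mult_mono mult_left_mono) auto
        also have "\<dots> = C1 * (sqrt (real n) ^ r / real n) * exp (- c1 * (real h)\<^sup>2 / real n)"
          by (simp add: C1_def power_mult_distrib)
        also have "\<dots> \<le> C1 * (sqrt (real n) ^ r / real n) * exp (- (c1 / 2) * (real h)\<^sup>2 / real n)"
          using C12 le1 unfolding half by (intro mult_left_mono mult_left_le) auto
        also have "\<dots> \<le> (C1 + C2) * (sqrt (real n) ^ r / real n) * exp (- (c1 / 2) * (real h)\<^sup>2 / real n)"
          using C12 by (intro mult_right_mono) auto
        finally show ?thesis .
      next
        case False
        have "n \<le> 2 * (h + r * i)" using False by simp
        also have "\<dots> \<le> 2 * (h + r * (2 * h))" using i by (intro mult_left_mono add_left_mono) auto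
        also have "\<dots> = 2 * h * (1 + 2 * r)" by (simp add: algebra_simps)
        finally have "n \<le> 2 * h * (1 + 2 * r)" .
        then have "real n \<le> real (2 * h * (1 + 2 * r))" by (simp only: of_nat_le_iff)
        also have "\<dots> = 2 * real h * (1 + 2 * real r)" by (simp add: algebra_simps)
        finally have nh: "real n \<le> 2 * real h * (1 + 2 * real r)" .
        define s where "s = 1 + 2 * real r"
        have s: "s > 0" by (simp add: s_def add_pos_nonneg)
        have "(real n)\<^sup>2 \<le> (2 * real h * s)\<^sup>2" using nh by (intro power_mono) (auto simp: s_def)
        then have "real n * real n \<le> 4 * s\<^sup>2 * (real h)\<^sup>2"
          by (simp add: power2_eq_square mult_ac)
        then have "real n \<le> 4 * s\<^sup>2 * ((real h)\<^sup>2 / real n)"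
          using n by (simp add: le_divide_eq)
        then have "\<delta> * real n \<le> \<delta> * (4 * s\<^sup>2 * ((real h)\<^sup>2 / real n))"
          using \<delta> by (intro mult_left_mono) auto
        also have "\<dots> = (c1 / 2) * ((real h)\<^sup>2 / real n)"
          using s by (simp add: \<delta>_def s_def[symmetric])
        finally have d: "exp (- (c1 / 2) * (real h)\<^sup>2 / real n) \<le> exp (- \<delta> * real n)" by simp
        have "profile_moment n i h r \<le> real n ^ r * (C * (exp (K / 4) * exp (- c1 * (real h)\<^sup>2 / real n)))"
          using ex C by (intro order_trans[OF profile_moment_le_level] mult_left_mono order_trans[OF level[OF x0 x1]]) auto
        also have "\<dots> = C * exp (K / 4) * (real n ^ Suc r * exp (- (c1 / 2) * (real h)\<^sup>2 / real n)) / real n * exp (- (c1 / 2) * (real h)\<^sup>2 / real n)"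
          unfolding half using n by simp
        also have "\<dots> \<le> C * exp (K / 4) * (real n ^ Suc r * exp (- \<delta> * real n)) / real n * exp (- (c1 / 2) * (real h)\<^sup>2 / real n)"
          using d C by (intro mult_right_mono divide_right_mono mult_left_mono) auto
        also have "\<dots> \<le> C * exp (K / 4) * (fact (Suc r) / \<delta> ^ Suc r) / real n * exp (- (c1 / 2) * (real h)\<^sup>2 / real n)"
          using \<delta> C by (intro mult_right_mono divide_right_mono mult_left_mono power_mult_exp_neg_le) auto
        also have "\<dots> = C2 * (1 / real n) * exp (- (c1 / 2) * (real h)\<^sup>2 / real n)" by (simp add: C2_def)
        also have "\<dots> \<le> (C1 + C2) * (sqrt (real n) ^ r / real n) * exp (- (c1 / 2) * (real h)\<^sup>2 / real n)"
          using C12 sn by (intro mult_right_mono mult_mono divide_right_mono one_le_power) auto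
        finally show ?thesis .
      qed
    qed
    then show ?thesis using C12 by (intro exI[of _ "C1 + C2"]) auto
  qed
  then show ?thesis using c1 by (intro exI[of _ "c1 / 2"]) auto
qed

definition profile_sum :: "nat \<Rightarrow> nat \<Rightarrow> nat \<Rightarrow> real" where
  "profile_sum n i r = (\<Sum>t\<in>trees n. wt t * real (distance_profile (verts t) i) ^ r)"

text \<open>Convexity over the at most \<open>n\<close> vertices of height at least
  \<open>i / 2\<close>, which are then sorted by height.\<close>

lemma profile_sum_le:
  assumes n: "n \<ge> 1" and r: "r \<ge> 1"
  shows "profile_sum n i r \<le> 2 ^ r * real n ^ (r - 1) * (\<Sum>h | h < n \<and> i \<le> 2 * h. profile_moment n i h r)"
proof -
  obtain s where s: "r = Suc s" using r by (cases r) auto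
  let ?H = "{h. h < n \<and> i \<le> 2 * h}"
  have "real (distance_profile (verts t) i) ^ r \<le> 2 ^ r * real n ^ (r - 1) *
      (\<Sum>h\<in>?H. \<Sum>v\<in>verts t. if length v = h then real (at_dist i t v) ^ r else 0)"
    if t: "t \<in> trees n" for t
  proof -
    let ?V = "{v \<in> verts t. i \<le> 2 * length v}"
    have num_verts: "num_verts t = n" using t by (simp add: trees_def)
    have "card ?V \<le> card (verts t)" by (intro card_mono) auto
    then have cV: "card ?V \<le> n" by (simp add: card_verts num_verts)
    have "real (distance_profile (verts t) i) \<le> real (2 * (\<Sum>v\<in>?V. at_dist i t v))"
      using distance_profile_le[of t i] by (simp only: of_nat_le_iff)
    then have "real (distance_profile (verts t) i) ^ r \<le> (2 * (\<Sum>v\<in>?V. real (at_dist i t v))) ^ r"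
      by (intro power_mono) auto
    also have "\<dots> = 2 ^ r * (\<Sum>v\<in>?V. real (at_dist i t v)) ^ Suc s" by (simp only: power_mult_distrib s)
    also have "\<dots> \<le> 2 ^ r * (real (card ?V) ^ s * (\<Sum>v\<in>?V. real (at_dist i t v) ^ Suc s))"
      by (intro mult_left_mono sum_power_le_card_mult) auto
    also have "\<dots> \<le> 2 ^ r * (real n ^ s * (\<Sum>v\<in>?V. real (at_dist i t v) ^ Suc s))"
      using cV by (intro mult_left_mono mult_right_mono power_mono sum_nonneg) auto
    also have "(\<Sum>v\<in>?V. real (at_dist i t v) ^ Suc s)
        = (\<Sum>v\<in>verts t. \<Sum>h\<in>?H. if length v = h then real (at_dist i t v) ^ r else 0)"
      unfolding s[symmetric] using length_less_num_verts[of _ t] num_verts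
      by (simp add: sum.inter_filter)
    also have "\<dots> = (\<Sum>h\<in>?H. \<Sum>v\<in>verts t. if length v = h then real (at_dist i t v) ^ r else 0)"
      by (rule sum.swap)
    finally show ?thesis by (simp add: s mult.assoc)
  qed
  then have "profile_sum n i r \<le> (\<Sum>t\<in>trees n. wt t * (2 ^ r * real n ^ (r - 1) *
      (\<Sum>h\<in>?H. \<Sum>v\<in>verts t. if length v = h then real (at_dist i t v) ^ r else 0)))"
    unfolding profile_sum_def by (intro sum_mono mult_left_mono wt_nonneg)
  also have "\<dots> = 2 ^ r * real n ^ (r - 1) * (\<Sum>t\<in>trees n. \<Sum>h\<in>?H. wt t *
      (\<Sum>v\<in>verts t. if length v = h then real (at_dist i t v) ^ r else 0))"
    unfolding sum_distrib_left by (simp only: mult.left_commute)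
  also have "(\<Sum>t\<in>trees n. \<Sum>h\<in>?H. wt t *
      (\<Sum>v\<in>verts t. if length v = h then real (at_dist i t v) ^ r else 0)) = (\<Sum>h\<in>?H. profile_moment n i h r)"
    unfolding profile_moment_def by (rule sum.swap)
  finally show ?thesis .
qed

end

text \<open>Passage from integer to real exponents: the first term dominates for
  \<open>a \<le> A\<close>, the second otherwise. With \<open>A\<close> the typical size of
  \<open>a\<close>, both terms have the right order.\<close>

lemma powr_interpolate:
  fixes a A r :: real
  assumes a: "0 \<le> a" and A: "0 < A" and r: "real k \<le> r" "r \<le> real l" and k: "1 \<le> k"
  shows "a powr r \<le> A powr (r - real k) * a ^ k + A powr (r - real l) * a ^ l"
proof (cases "a = 0")
  case False
  then have a0: "a > 0" using a by simp
  show ?thesis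
  proof (cases "a \<le> A")
    case True
    have "a powr r = a powr (r - real k) * a ^ k"
      using a0 by (simp add: powr_diff powr_realpow)
    also have "\<dots> \<le> A powr (r - real k) * a ^ k"
      using True a0 r by (intro mult_right_mono powr_mono2) auto
    finally show ?thesis using a0 A by (simp add: add_increasing2)
  next
    case False
    have "a powr r = a powr (r - real l) * a ^ l"
      using a0 by (simp add: powr_diff powr_realpow)
    also have "\<dots> \<le> A powr (r - real l) * a ^ l"
      using False a0 A r by (intro mult_right_mono powr_mono2') auto
    finally show ?thesis using a0 A by (simp add: add_increasing)
  qed
qed (use k in auto)

context critical_offspring begin

lemma Y_nonneg: "0 \<le> Y $ n"
  by (simp add: tree_gf_def sum_nonneg wt_nonneg)

lemma profile_sum_nonneg: "0 \<le> profile_sum n i r"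
  unfolding profile_sum_def by (intro sum_nonneg mult_nonneg_nonneg wt_nonneg) auto

lemma profile_sum_divide_le:
  assumes "profile_sum n i r \<le> b" "0 < d" "d \<le> Y $ n"
  shows "profile_sum n i r / Y $ n \<le> b / d"
  by (rule frac_le[OF order_trans[OF profile_sum_nonneg assms(1)] assms])

text \<open>Since \<open>h \<ge> i / 2\<close>, half of the exponent yields
  \<open>exp (- (c / 8) * i\<^sup>2 / n)\<close>; the other half makes the sum over \<open>h\<close>
  of order \<open>sqrt n\<close>. Division by \<open>d / (n * sqrt n)\<close> completes the power of
  \<open>n\<close> to \<open>3 * r / 2\<close>.\<close>

lemma profile_mean_gaussian_bound:
  "\<exists>c>0. \<forall>r\<ge>1. \<exists>C>0. \<forall>n\<ge>1. \<forall>i\<ge>1. Y $ n > 0 \<longrightarrow>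
     profile_sum n i r / Y $ n \<le> C * (real n ^ r * sqrt (real n) ^ r) * exp (- c * (real i)\<^sup>2 / real n)"
proof -
  obtain c where c: "c > 0" and ex: "\<And>r. \<exists>C>0. \<forall>n i h. n \<ge> 1 \<longrightarrow> i \<le> 2 * h \<longrightarrow>
     profile_moment n i h r \<le> C * (sqrt (real n) ^ r / real n) * exp (- c * (real h)\<^sup>2 / real n)"
    using profile_moment_gaussian_bound by blast
  obtain d where d: "d > 0" "\<And>n. Y $ n > 0 \<Longrightarrow> Y $ n \<ge> d / (real n * sqrt (real n))"
    using fixed_point_lower_bound[OF Y_fixed_point] by blast
  have "\<exists>C'>0. \<forall>n\<ge>1. \<forall>i\<ge>1. Y $ n > 0 \<longrightarrow>
     profile_sum n i r / Y $ n \<le> C' * (real n ^ r * sqrt (real n) ^ r) * exp (- (c / 8) * (real i)\<^sup>2 / real n)"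
    if r: "r \<ge> 1" for r
  proof -
    obtain C where C: "C > 0" "\<And>n i h. n \<ge> 1 \<Longrightarrow> i \<le> 2 * h \<Longrightarrow>
     profile_moment n i h r \<le> C * (sqrt (real n) ^ r / real n) * exp (- c * (real h)\<^sup>2 / real n)"
      using ex[of r] by blast
    define D where "D = exp (c / 2) * (1 + 1 / (2 * (c / 2)))"
    have D: "D > 0" using c by (simp add: D_def add_pos_pos)
    define C' where "C' = 2 ^ r * C * D / d"
    have C': "C' > 0" using C D d by (simp add: C'_def)
    have "profile_sum n i r / Y $ n \<le> C' * (real n ^ r * sqrt (real n) ^ r) * exp (- (c / 8) * (real i)\<^sup>2 / real n)"
      if n: "n \<ge> 1" and Yn: "Y $ n > 0" for n i
    proof -
      let ?H = "{h. h < n \<and> i \<le> 2 * h}"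
      let ?E = "exp (- (c / 8) * (real i)\<^sup>2 / real n)"
      let ?q = "C * (sqrt (real n) ^ r / real n)"
      have q: "0 \<le> ?q" using C by simp
      have "(\<Sum>h\<in>?H. profile_moment n i h r) \<le> (\<Sum>h\<in>?H. ?q * ?E * exp (- (c / 2) * (real h)\<^sup>2 / real n))"
      proof (intro sum_mono)
        fix h assume h: "h \<in> ?H"
        have "(real i)\<^sup>2 \<le> (2 * real h)\<^sup>2" using h by (intro power_mono) auto
        then have "c / 8 * ((real i)\<^sup>2 / real n) \<le> c / 8 * ((2 * real h)\<^sup>2 / real n)"
          using c by (intro mult_left_mono divide_right_mono) auto
        then have "- c * (real h)\<^sup>2 / real n \<le> - (c / 8) * (real i)\<^sup>2 / real n + - (c / 2) * (real h)\<^sup>2 / real n"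
          by (simp add: power_mult_distrib)
        then have "exp (- c * (real h)\<^sup>2 / real n) \<le> ?E * exp (- (c / 2) * (real h)\<^sup>2 / real n)"
          unfolding exp_add[symmetric] by (simp only: exp_le_cancel_iff)
        note E = this
        have "profile_moment n i h r \<le> ?q * exp (- c * (real h)\<^sup>2 / real n)"
          using h by (intro C(2) n) simp
        also have "\<dots> \<le> ?q * (?E * exp (- (c / 2) * (real h)\<^sup>2 / real n))"
          using E q by (rule mult_left_mono)
        finally show "profile_moment n i h r \<le> ?q * ?E * exp (- (c / 2) * (real h)\<^sup>2 / real n)"
          by (simp only: mult.assoc)
      qed
      also have "\<dots> \<le> (\<Sum>h<n. ?q * ?E * exp (- (c / 2) * (real h)\<^sup>2 / real n))"
        by (intro sum_mono2 mult_nonneg_nonneg q) auto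
      also have "\<dots> = ?q * ?E * (\<Sum>h<n. exp (- (c / 2) * (real h)\<^sup>2 / real n))"
        by (simp only: sum_distrib_left)
      also have "\<dots> \<le> ?q * ?E * (D * sqrt (real n))"
        unfolding D_def by (intro mult_left_mono gaussian_sum_le mult_nonneg_nonneg q) (use c n in auto)
      finally have 1: "(\<Sum>h\<in>?H. profile_moment n i h r) \<le> ?q * ?E * (D * sqrt (real n))" .
      have "profile_sum n i r \<le> 2 ^ r * real n ^ (r - 1) * (?q * ?E * (D * sqrt (real n)))"
        by (rule order_trans[OF profile_sum_le[OF n r]]) (intro mult_left_mono 1, simp)
      then have "profile_sum n i r / Y $ n \<le> 2 ^ r * real n ^ (r - 1) * (?q * ?E * (D * sqrt (real n))) / (d / (real n * sqrt (real n)))"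
        by (rule profile_sum_divide_le) (use d(1) d(2)[OF Yn] n in auto)
      also have "\<dots> = C' * (real n ^ (r - 1) * (sqrt (real n) * sqrt (real n)) * sqrt (real n) ^ r) * ?E"
        using n d by (simp add: C'_def field_simps)
      also have "real n ^ (r - 1) * (sqrt (real n) * sqrt (real n)) = real n ^ r"
        using r by (cases r) auto
      finally show ?thesis .
    qed
    then show ?thesis using C' by blast
  qed
  then show ?thesis using c by (intro exI[of _ "c / 8"]) auto
qed

lemma distance_profile_le_square: "distance_profile (verts t) i \<le> num_verts t * num_verts t"
proof -
  have "(\<Sum>v\<in>verts t. at_dist i t v) \<le> (\<Sum>v\<in>verts t. num_verts t)" by (intro sum_mono at_dist_le)
  then show ?thesis by (simp add: distance_profile_eq card_verts)
qed

lemma profile_sum_le_trivial: "profile_sum n i r \<le> (real n * real n) ^ r * Y $ n"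
proof -
  have "profile_sum n i r \<le> (\<Sum>t\<in>trees n. wt t * (real n * real n) ^ r)"
    unfolding profile_sum_def
  proof (intro sum_mono mult_left_mono wt_nonneg power_mono)
    fix t assume "t \<in> trees n"
    then show "real (distance_profile (verts t) i) \<le> real n * real n"
      using distance_profile_le_square[of t i] by (simp add: trees_def flip: of_nat_mult)
  qed auto
  then show ?thesis by (simp add: tree_gf_def sum_distrib_right mult.commute)
qed

text \<open>For \<open>i > sqrt n\<close> the Gaussian estimate is already better, as
  \<open>sqrt n ^ r \<le> i ^ r\<close>, and for small \<open>n\<close> the trivial bound serves.
  Otherwise \<open>4 * r * i \<le> n\<close>, so that the Steiner tree is small enough for all
  heights up to \<open>n / 4\<close>.\<close>

lemma profile_mean_moment_bound:
  assumes mom: "summable (\<lambda>k. real k ^ (1 + r) * pmf p k)" and r: "r \<ge> 1"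
  shows "\<exists>C>0. \<forall>n\<ge>1. \<forall>i\<ge>1. Y $ n > 0 \<longrightarrow> profile_sum n i r / Y $ n \<le> C * real i ^ r * real n ^ r"
proof -
  obtain C K c where C: "C > 0" and K: "K > 0" and c: "c > 0" and
    main: "\<And>x n i h. 0 < x \<Longrightarrow> x \<le> 1/2 \<Longrightarrow> n \<ge> 1 \<Longrightarrow> i \<ge> 1 \<Longrightarrow> 2 * (h + r * i) \<le> n \<Longrightarrow>
      profile_moment n i h r \<le> C * real i ^ r / real n * exp (K * x\<^sup>2 * real n) * exp (- c * x * real (h - i))"
    using profile_moment_bound_moments[OF mom] by blast
  obtain d where d: "d > 0" "\<And>n. Y $ n > 0 \<Longrightarrow> Y $ n \<ge> d / (real n * sqrt (real n))"
    using fixed_point_lower_bound[OF Y_fixed_point] by blast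
  obtain c2 C2 where c2: "c2 > 0" and C2: "C2 > 0" "\<And>n i h. n \<ge> 1 \<Longrightarrow> i \<le> 2 * h \<Longrightarrow>
     profile_moment n i h r \<le> C2 * (sqrt (real n) ^ r / real n) * exp (- c2 * (real h)\<^sup>2 / real n)"
    using profile_moment_gaussian_bound by meson
  obtain c3 C3 where c3: "c3 > 0" and C3: "C3 > 0" "\<And>n i. n \<ge> 1 \<Longrightarrow> i \<ge> 1 \<Longrightarrow> Y $ n > 0 \<Longrightarrow>
     profile_sum n i r / Y $ n \<le> C3 * (real n ^ r * sqrt (real n) ^ r) * exp (- c3 * (real i)\<^sup>2 / real n)"
    using profile_mean_gaussian_bound r by meson
  define A where "A = C * exp (K / 4) * (2 + 2 / c)"
  define B where "B = C2 * (fact (Suc r) / (c2 / 16) ^ Suc r)"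
  have AB: "A > 0" "B > 0" using C c C2 c2 by (auto simp: A_def B_def add_pos_pos)
  define C1 where "C1 = 2 ^ r * (A + B) / d"
  have C1: "C1 > 0" using AB d by (simp add: C1_def)
  define C0 where "C0 = (16 * (real r)\<^sup>2) ^ r"
  have C0: "C0 \<ge> 0" by (simp add: C0_def)
  have "profile_sum n i r / Y $ n \<le> (C0 + C1 + C3) * real i ^ r * real n ^ r"
    if n: "n \<ge> 1" and i: "i \<ge> 1" and Yn: "Y $ n > 0" for n i
  proof -
    have ge: "C' * real i ^ r * real n ^ r \<le> (C0 + C1 + C3) * real i ^ r * real n ^ r" if "C' \<le> C0 + C1 + C3" for C'
      using that by (intro mult_right_mono) auto
    have sn: "sqrt (real n) \<ge> 1" using n by simp
    consider "n < 16 * r\<^sup>2" | "real n < (real i)\<^sup>2" | "16 * r\<^sup>2 \<le> n" "(real i)\<^sup>2 \<le> real n" by linarith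
    then show ?thesis
    proof cases
      case 1
      then have "real n \<le> real (16 * r\<^sup>2)" by (simp only: of_nat_le_iff less_imp_le)
      then have nr: "real n \<le> 16 * (real r)\<^sup>2" by simp
      have "profile_sum n i r / Y $ n \<le> (real n * real n) ^ r"
        using profile_sum_le_trivial[of n i r] Yn by (simp add: divide_le_eq)
      also have "\<dots> = real n ^ r * 1 * real n ^ r" by (simp add: power_mult_distrib)
      also have "\<dots> \<le> C0 * real i ^ r * real n ^ r"
        unfolding C0_def using nr i by (intro mult_mono power_mono one_le_power) auto
      also have "\<dots> \<le> (C0 + C1 + C3) * real i ^ r * real n ^ r" using C1 C3(1) by (intro ge) auto
      finally show ?thesis .
    next
      case 2
      then have "sqrt (real n) \<le> real i" by (intro real_le_lsqrt) auto
      then have "C3 * (real n ^ r * sqrt (real n) ^ r) * exp (- c3 * (real i)\<^sup>2 / real n)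
          \<le> C3 * (real n ^ r * real i ^ r) * 1"
        using C3(1) c3 by (intro mult_mono mult_left_mono power_mono) auto
      then have "profile_sum n i r / Y $ n \<le> C3 * real i ^ r * real n ^ r"
        using C3(2)[OF n i Yn] by (simp add: mult_ac)
      also have "\<dots> \<le> (C0 + C1 + C3) * real i ^ r * real n ^ r" using C1 C0 by (intro ge) auto
      finally show ?thesis .
    next
      case 3
      let ?H = "{h. h < n \<and> i \<le> 2 * h}"
      have i_le: "real i \<le> sqrt (real n)" using 3(2) by (intro real_le_rsqrt)
      have "real (16 * r\<^sup>2) \<le> real n" using 3(1) by (simp only: of_nat_le_iff)
      then have "(4 * real r)\<^sup>2 \<le> real n" by (simp add: power_mult_distrib)
      then have "4 * real r \<le> sqrt (real n)" by (intro real_le_rsqrt)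
      then have "4 * real r * real i \<le> sqrt (real n) * sqrt (real n)" using i_le by (intro mult_mono) auto
      then have "real (4 * (r * i)) \<le> real n" by simp
      then have ri: "4 * (r * i) \<le> n" by (simp only: of_nat_le_iff)
      \<comment> \<open>The decay rate at \<open>x = 1 / (2 * sqrt n)\<close>, for which the cost
        \<open>exp (K * x\<^sup>2 * n)\<close> is constant.\<close>
      define u where "u = c / (2 * sqrt (real n))"
      have u: "u > 0" using c sn by (simp add: u_def)
      have M: "profile_moment n i h r \<le> C * exp (K / 4) * real i ^ r / real n * exp (- u * real (h - i))
          + B * real i ^ r / (real n * sqrt (real n))"
        if h: "h \<in> ?H" for h
      proof (cases "4 * h \<le> n")
        case True
        have "profile_moment n i h r \<le> C * real i ^ r / real n * exp (K * (1 / (2 * sqrt (real n)))\<^sup>2 * real n)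
            * exp (- c * (1 / (2 * sqrt (real n))) * real (h - i))"
          using sn True ri n i by (intro main) (auto simp: divide_le_eq)
        also have "K * (1 / (2 * sqrt (real n)))\<^sup>2 * real n = K / 4"
          using n by (simp add: power_divide power_mult_distrib)
        finally show ?thesis using AB by (simp add: u_def mult_ac add_increasing2)
      next
        \<comment> \<open>At heights above \<open>n / 4\<close> the Gaussian estimate is
          exponentially small in \<open>n\<close>. It can spare the factor
          \<open>n powr (- 3 / 2)\<close>, which survives a summation over \<open>n\<close>
          heights.\<close>
        case False
        then have "real n \<le> 4 * real h" by simp
        then have "real n * real n \<le> (4 * real h) * (4 * real h)" by (intro mult_mono) auto
        then have "real n \<le> 16 * ((real h)\<^sup>2 / real n)" using n by (simp add: field_simps power2_eq_square)
        then have "c2 / 16 * real n \<le> c2 / 16 * (16 * ((real h)\<^sup>2 / real n))" using c2 by (intro mult_left_mono) auto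
        then have e: "exp (- c2 * (real h)\<^sup>2 / real n) \<le> exp (- (c2 / 16) * real n)" by simp
        have "sqrt (real n) ^ Suc r \<le> real n ^ Suc r" using n by (intro power_mono real_le_lsqrt) (auto simp: power2_eq_square)
        then have "sqrt (real n) ^ Suc r * exp (- (c2 / 16) * real n) \<le> real n ^ Suc r * exp (- (c2 / 16) * real n)"
          by (intro mult_right_mono) auto
        also have "\<dots> \<le> fact (Suc r) / (c2 / 16) ^ Suc r" using c2 by (intro power_mult_exp_neg_le) auto
        finally have f: "sqrt (real n) ^ Suc r * exp (- (c2 / 16) * real n) \<le> fact (Suc r) / (c2 / 16) ^ Suc r" .
        have "profile_moment n i h r \<le> C2 * (sqrt (real n) ^ r / real n) * exp (- c2 * (real h)\<^sup>2 / real n)"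
          using h by (intro C2(2) n) auto
        also have "\<dots> \<le> C2 * (sqrt (real n) ^ r / real n) * exp (- (c2 / 16) * real n)"
          using e C2(1) by (intro mult_left_mono) auto
        also have "\<dots> = C2 * (sqrt (real n) ^ Suc r * exp (- (c2 / 16) * real n)) / (real n * sqrt (real n))"
          using n by (simp add: field_simps)
        also have "\<dots> \<le> B / (real n * sqrt (real n))"
          unfolding B_def using f C2(1) by (intro divide_right_mono mult_left_mono) auto
        also have "\<dots> \<le> B * real i ^ r / (real n * sqrt (real n))"
          using AB i by (intro divide_right_mono) (auto simp: one_le_power)
        finally show ?thesis using C by (simp add: add_increasing)
      qed
      have E: "(\<Sum>h\<in>?H. exp (- u * real (h - i))) \<le> (2 + 2 / c) * sqrt (real n)"
      proof -
        let ?g = "\<lambda>h. exp (- u * real (h - i))"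
        \<comment> \<open>Below height \<open>i\<close> there is no decay, but only
          \<open>i \<le> sqrt n\<close> heights; above it a geometric series sums to order
          \<open>sqrt n\<close>.\<close>
        have "?H \<subseteq> {..<i} \<union> (\<lambda>h. h + i) ` {..<n}"
        proof
          fix h assume "h \<in> ?H"
          then show "h \<in> {..<i} \<union> (\<lambda>h. h + i) ` {..<n}"
            by (cases "h < i") (auto simp: image_iff intro!: bexI[of _ "h - i"])
        qed
        then have "(\<Sum>h\<in>?H. ?g h) \<le> (\<Sum>h\<in>{..<i} \<union> (\<lambda>h. h + i) ` {..<n}. ?g h)"
          by (intro sum_mono2) auto
        also have "\<dots> = (\<Sum>h<i. ?g h) + (\<Sum>h\<in>(\<lambda>h. h + i) ` {..<n}. ?g h)"
          by (intro sum.union_disjoint) auto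
        also have "(\<Sum>h\<in>(\<lambda>h. h + i) ` {..<n}. ?g h) = (\<Sum>h<n. exp (- u * real h))"
          by (subst sum.reindex) auto
        also have "(\<Sum>h<i. ?g h) + (\<Sum>h<n. exp (- u * real h)) \<le> real i + (1 + 1 / u)"
          by (intro add_mono geometric_exp_sum_le u) simp
        also have "\<dots> = real i + 1 + 2 / c * sqrt (real n)" using c sn by (simp add: u_def)
        also have "\<dots> \<le> (2 + 2 / c) * sqrt (real n)" unfolding distrib_right using i_le sn by linarith
        finally show ?thesis .
      qed
      let ?a = "C * exp (K / 4) * real i ^ r / real n" and ?b = "B * real i ^ r / (real n * sqrt (real n))"
      have ab: "0 \<le> ?a" "0 \<le> ?b" using C AB by auto
      have "(\<Sum>h\<in>?H. profile_moment n i h r) \<le> (\<Sum>h\<in>?H. ?a * exp (- u * real (h - i)) + ?b)"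
        by (intro sum_mono M)
      also have "\<dots> = ?a * (\<Sum>h\<in>?H. exp (- u * real (h - i))) + real (card ?H) * ?b"
        by (simp add: sum.distrib sum_distrib_left)
      also have "\<dots> \<le> ?a * ((2 + 2 / c) * sqrt (real n)) + real n * ?b"
      proof (intro add_mono mult_left_mono mult_right_mono E ab)
        have "card ?H \<le> card {..<n}" by (intro card_mono) auto
        then show "real (card ?H) \<le> real n" by simp
      qed
      also have "\<dots> = (A + B) * real i ^ r / sqrt (real n)"
      proof -
        have "?a * ((2 + 2 / c) * sqrt (real n)) = A * real i ^ r * (sqrt (real n) / real n)"
          by (simp add: A_def)
        also have "sqrt (real n) / real n = 1 / sqrt (real n)"
          by (simp add: sqrt_divide_self_eq inverse_eq_divide)
        finally have "?a * ((2 + 2 / c) * sqrt (real n)) = A * real i ^ r / sqrt (real n)" by simp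
        moreover have "real n * ?b = B * real i ^ r / sqrt (real n)" using n by simp
        ultimately show ?thesis by (simp add: add_divide_distrib distrib_right)
      qed
      finally have 1: "(\<Sum>h\<in>?H. profile_moment n i h r) \<le> (A + B) * real i ^ r / sqrt (real n)" .
      have "profile_sum n i r \<le> 2 ^ r * real n ^ (r - 1) * ((A + B) * real i ^ r / sqrt (real n))"
        by (rule order_trans[OF profile_sum_le[OF n r]]) (intro mult_left_mono 1, simp)
      then have "profile_sum n i r / Y $ n \<le> 2 ^ r * real n ^ (r - 1) * ((A + B) * real i ^ r / sqrt (real n)) / (d / (real n * sqrt (real n)))"
        by (rule profile_sum_divide_le) (use d(1) d(2)[OF Yn] n in auto)
      also have "\<dots> = C1 * real i ^ r * (real n ^ (r - 1) * real n)"
        using n d by (simp add: C1_def)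
      also have "real n ^ (r - 1) * real n = real n ^ r" using r by (cases r) auto
      also have "C1 * real i ^ r * real n ^ r \<le> (C0 + C1 + C3) * real i ^ r * real n ^ r" using C0 C3(1) by (intro ge) auto
      finally show ?thesis .
    qed
  qed
  moreover have "C0 + C1 + C3 > 0" using C0 C1 C3(1) by simp
  ultimately show ?thesis by blast
qed

section \<open>Conditional expectations\<close>

lemma admissible_iff: "n \<ge> 1 \<Longrightarrow> gw_admissible p n \<longleftrightarrow> Y $ n > 0"
  by (simp add: gw_admissible_def measure_gw_size_event)

lemma conditioned_power_le:
  assumes "n \<ge> 1" "gw_admissible p n"
  shows "(\<integral>\<xi>. real (distance_profile (family_tree \<xi>) i) ^ r \<partial>conditioned_gw p n) \<le> profile_sum n i r / Y $ n"
  using conditioned_gw_integral_le[OF assms, of "\<lambda>T. real (distance_profile T i) ^ r"]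
  by (simp add: profile_sum_def)

lemma conditioned_powr_le:
  assumes n: "n \<ge> 1" and adm: "gw_admissible p n" and A: "A > 0"
    and r: "real k \<le> r" "r \<le> real l" and k: "1 \<le> k"
  shows "(\<integral>\<xi>. real (distance_profile (family_tree \<xi>) i) powr r \<partial>conditioned_gw p n)
    \<le> A powr (r - real k) * (profile_sum n i k / Y $ n) + A powr (r - real l) * (profile_sum n i l / Y $ n)"
proof -
  let ?f = "\<lambda>t. real (distance_profile (verts t) i)"
  have "(\<integral>\<xi>. real (distance_profile (family_tree \<xi>) i) powr r \<partial>conditioned_gw p n)
      \<le> (\<Sum>t\<in>trees n. wt t * ?f t powr r) / Y $ n"
    using conditioned_gw_integral_le[OF n adm, of "\<lambda>T. real (distance_profile T i) powr r"] by simp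
  also have "\<dots> \<le> (\<Sum>t\<in>trees n. wt t * (A powr (r - real k) * ?f t ^ k + A powr (r - real l) * ?f t ^ l)) / Y $ n"
    using Y_nonneg by (intro divide_right_mono sum_mono mult_left_mono powr_interpolate A r k wt_nonneg) auto
  also have "\<dots> = A powr (r - real k) * (profile_sum n i k / Y $ n) + A powr (r - real l) * (profile_sum n i l / Y $ n)"
    unfolding profile_sum_def
    by (simp add: sum.distrib distrib_left sum_distrib_left add_divide_distrib mult.left_commute)
  finally show ?thesis .
qed

lemma profile_moments_gaussian:
  "\<exists>c::real. c > 0 \<and> (\<forall>r::real. r \<ge> 1 \<longrightarrow> (\<exists>C::real. \<forall>i n::nat. i \<ge> 1 \<longrightarrow> n \<ge> 1 \<longrightarrow> gw_admissible p n \<longrightarrow>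
     (\<integral>\<xi>. real (distance_profile (family_tree \<xi>) i) powr r \<partial>conditioned_gw p n)
       \<le> C * real n powr (3 * r / 2) * exp (- c * (real i)\<^sup>2 / real n)))"
proof -
  obtain c where c: "c > 0" and bd: "\<And>r. r \<ge> 1 \<Longrightarrow> \<exists>C>0. \<forall>n\<ge>1. \<forall>i\<ge>1. Y $ n > 0 \<longrightarrow>
     profile_sum n i r / Y $ n \<le> C * (real n ^ r * sqrt (real n) ^ r) * exp (- c * (real i)\<^sup>2 / real n)"
    using profile_mean_gaussian_bound by blast
  have "\<exists>C. \<forall>i n::nat. i \<ge> 1 \<longrightarrow> n \<ge> 1 \<longrightarrow> gw_admissible p n \<longrightarrow>
     (\<integral>\<xi>. real (distance_profile (family_tree \<xi>) i) powr r \<partial>conditioned_gw p n)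
       \<le> C * real n powr (3 * r / 2) * exp (- c * (real i)\<^sup>2 / real n)" if r: "r \<ge> 1" for r :: real
  proof -
    define k l where "k = nat \<lfloor>r\<rfloor>" and "l = Suc (nat \<lfloor>r\<rfloor>)"
    have kl: "real k \<le> r" "r \<le> real l" "k \<ge> 1" "l \<ge> 1" using r by (auto simp: k_def l_def le_nat_iff) linarith+
    obtain C1 where C1: "\<And>n i. n \<ge> 1 \<Longrightarrow> i \<ge> 1 \<Longrightarrow> Y $ n > 0 \<Longrightarrow>
      profile_sum n i k / Y $ n \<le> C1 * (real n ^ k * sqrt (real n) ^ k) * exp (- c * (real i)\<^sup>2 / real n)"
      using bd[OF kl(3)] by blast
    obtain C2 where C2: "\<And>n i. n \<ge> 1 \<Longrightarrow> i \<ge> 1 \<Longrightarrow> Y $ n > 0 \<Longrightarrow>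
      profile_sum n i l / Y $ n \<le> C2 * (real n ^ l * sqrt (real n) ^ l) * exp (- c * (real i)\<^sup>2 / real n)"
      using bd[OF kl(4)] by blast
    have "(\<integral>\<xi>. real (distance_profile (family_tree \<xi>) i) powr r \<partial>conditioned_gw p n)
       \<le> (C1 + C2) * real n powr (3 * r / 2) * exp (- c * (real i)\<^sup>2 / real n)"
      if i: "i \<ge> 1" and n: "n \<ge> 1" and adm: "gw_admissible p n" for i n
    proof -
      \<comment> \<open>The order of magnitude of the profile, at which both interpolating terms
        give the same power of \<open>n\<close>.\<close>
      let ?A = "real n powr (3 / 2)" and ?E = "exp (- c * (real i)\<^sup>2 / real n)"
      have n0: "real n > 0" using n by simp
      have Yn: "Y $ n > 0" using adm n by (simp add: admissible_iff)
      have pw: "?A powr (r - real m) * (real n ^ m * sqrt (real n) ^ m) = real n powr (3 * r / 2)" for m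
      proof -
        have "real n ^ m * sqrt (real n) ^ m = real n powr (real m) * real n powr (real m / 2)"
          using n0 by (simp add: powr_realpow powr_half_sqrt[symmetric] powr_powr flip: powr_realpow[of "real n powr (1/2)"])
        then show ?thesis
          using n0 by (simp add: powr_powr powr_add[symmetric] field_simps)
      qed
      have "(\<integral>\<xi>. real (distance_profile (family_tree \<xi>) i) powr r \<partial>conditioned_gw p n)
        \<le> ?A powr (r - real k) * (profile_sum n i k / Y $ n) + ?A powr (r - real l) * (profile_sum n i l / Y $ n)"
        using n0 by (intro conditioned_powr_le n adm kl) simp
      also have "\<dots> \<le> ?A powr (r - real k) * (C1 * (real n ^ k * sqrt (real n) ^ k) * ?E)
          + ?A powr (r - real l) * (C2 * (real n ^ l * sqrt (real n) ^ l) * ?E)"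
        by (intro add_mono mult_left_mono C1 C2 n i Yn) auto
      also have "\<dots> = C1 * (?A powr (r - real k) * (real n ^ k * sqrt (real n) ^ k)) * ?E
          + C2 * (?A powr (r - real l) * (real n ^ l * sqrt (real n) ^ l)) * ?E"
        by (simp only: mult_ac)
      also have "\<dots> = (C1 + C2) * real n powr (3 * r / 2) * ?E"
        unfolding pw by (simp add: algebra_simps)
      finally show ?thesis .
    qed
    then show ?thesis by blast
  qed
  then show ?thesis using c by blast
qed

lemma profile_moments_linear:
  assumes r: "r \<ge> 1" and mom: "summable (\<lambda>k. real k ^ (1 + r) * pmf p k)"
  shows "\<exists>C>0. \<forall>i n::nat. i \<ge> 1 \<longrightarrow> n \<ge> 1 \<longrightarrow> gw_admissible p n \<longrightarrow>
     (\<integral>\<xi>. real (distance_profile (family_tree \<xi>) i) ^ r \<partial>conditioned_gw p n) \<le> C * real i ^ r * real n ^ r"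
proof -
  obtain C where C: "C > 0" "\<And>n i. n \<ge> 1 \<Longrightarrow> i \<ge> 1 \<Longrightarrow> Y $ n > 0 \<Longrightarrow>
      profile_sum n i r / Y $ n \<le> C * real i ^ r * real n ^ r"
    using profile_mean_moment_bound[OF mom r] by blast
  have "(\<integral>\<xi>. real (distance_profile (family_tree \<xi>) i) ^ r \<partial>conditioned_gw p n) \<le> C * real i ^ r * real n ^ r"
    if "i \<ge> 1" "n \<ge> 1" "gw_admissible p n" for i n
    using C(2)[OF that(2,1)] conditioned_power_le[OF that(2,3), of i r] that admissible_iff[OF that(2)]
    by (meson order_trans)
  then show ?thesis using C(1) by blast
qed

text \<open>For \<open>i\<^sup>2 \<le> n\<close> the exponential is at least
  \<open>exp (- c)\<close> and the linear bound suffices; beyond, the general Gaussian bound does,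
  by \<open>sqrt n \<le> i\<close>. The rate is thus that of the general bound and the same for all
  \<open>r\<close>.\<close>

lemma profile_moments_linear_gaussian:
  "\<exists>c::real. c > 0 \<and> (\<forall>r::nat. r \<ge> 1 \<longrightarrow> summable (\<lambda>k. real k ^ (1 + r) * pmf p k) \<longrightarrow>
     (\<exists>C::real. \<forall>i n::nat. i \<ge> 1 \<longrightarrow> n \<ge> 1 \<longrightarrow> gw_admissible p n \<longrightarrow>
       (\<integral>\<xi>. real (distance_profile (family_tree \<xi>) i) ^ r \<partial>conditioned_gw p n)
         \<le> C * real i ^ r * real n ^ r * exp (- c * (real i)\<^sup>2 / real n)))"
proof -
  obtain c where c: "c > 0" and bd: "\<And>r. r \<ge> 1 \<Longrightarrow> \<exists>C>0. \<forall>n\<ge>1. \<forall>i\<ge>1. Y $ n > 0 \<longrightarrow>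
     profile_sum n i r / Y $ n \<le> C * (real n ^ r * sqrt (real n) ^ r) * exp (- c * (real i)\<^sup>2 / real n)"
    using profile_mean_gaussian_bound by blast
  have "\<exists>C. \<forall>i n::nat. i \<ge> 1 \<longrightarrow> n \<ge> 1 \<longrightarrow> gw_admissible p n \<longrightarrow>
       (\<integral>\<xi>. real (distance_profile (family_tree \<xi>) i) ^ r \<partial>conditioned_gw p n)
         \<le> C * real i ^ r * real n ^ r * exp (- c * (real i)\<^sup>2 / real n)"
    if r: "r \<ge> 1" and mom: "summable (\<lambda>k. real k ^ (1 + r) * pmf p k)" for r
  proof -
    obtain C1 where C1: "C1 > 0" "\<And>i n. i \<ge> 1 \<Longrightarrow> n \<ge> 1 \<Longrightarrow> gw_admissible p n \<Longrightarrow>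
     (\<integral>\<xi>. real (distance_profile (family_tree \<xi>) i) ^ r \<partial>conditioned_gw p n) \<le> C1 * real i ^ r * real n ^ r"
      using profile_moments_linear[OF r mom] by blast
    obtain C2 where C2: "C2 > 0" "\<And>n i. n \<ge> 1 \<Longrightarrow> i \<ge> 1 \<Longrightarrow> Y $ n > 0 \<Longrightarrow>
      profile_sum n i r / Y $ n \<le> C2 * (real n ^ r * sqrt (real n) ^ r) * exp (- c * (real i)\<^sup>2 / real n)"
      using bd[OF r] by blast
    have "(\<integral>\<xi>. real (distance_profile (family_tree \<xi>) i) ^ r \<partial>conditioned_gw p n)
         \<le> (C1 * exp c + C2) * real i ^ r * real n ^ r * exp (- c * (real i)\<^sup>2 / real n)"
      if i: "i \<ge> 1" and n: "n \<ge> 1" and adm: "gw_admissible p n" for i n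
    proof -
      let ?E = "exp (- c * (real i)\<^sup>2 / real n)" and ?J = "\<integral>\<xi>. real (distance_profile (family_tree \<xi>) i) ^ r \<partial>conditioned_gw p n"
      have Yn: "Y $ n > 0" using adm n by (simp add: admissible_iff)
      have ge: "C' * (real i ^ r * real n ^ r * ?E) \<le> (C1 * exp c + C2) * (real i ^ r * real n ^ r * ?E)"
        if "C' \<le> C1 * exp c + C2" for C'
        using that by (intro mult_right_mono) auto
      have "?J \<le> (C1 * exp c + C2) * (real i ^ r * real n ^ r * ?E)"
      proof (cases "(real i)\<^sup>2 \<le> real n")
        case True
        then have "c * ((real i)\<^sup>2 / real n) \<le> c * 1" using c n by (intro mult_left_mono) (auto simp: divide_le_eq)
        then have "1 \<le> exp c * ?E" by (simp flip: exp_add)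
        then have "C1 * real i ^ r * real n ^ r * 1 \<le> C1 * real i ^ r * real n ^ r * (exp c * ?E)"
          using C1(1) by (intro mult_left_mono) auto
        then have "?J \<le> (C1 * exp c) * (real i ^ r * real n ^ r * ?E)"
          using C1(2)[OF i n adm] by (simp add: mult_ac)
        also have "\<dots> \<le> (C1 * exp c + C2) * (real i ^ r * real n ^ r * ?E)" using C2(1) by (intro ge) simp
        finally show ?thesis .
      next
        case False
        then have "sqrt (real n) \<le> real i" by (intro real_le_lsqrt) auto
        then have "C2 * (real n ^ r * sqrt (real n) ^ r) * ?E \<le> C2 * (real n ^ r * real i ^ r) * ?E"
          using C2(1) by (intro mult_right_mono mult_left_mono power_mono) auto
        then have "?J \<le> C2 * (real i ^ r * real n ^ r * ?E)"
          using C2(2)[OF n i Yn] conditioned_power_le[OF n adm, of i r] by (simp add: mult_ac)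
        also have "\<dots> \<le> (C1 * exp c + C2) * (real i ^ r * real n ^ r * ?E)" using C1(1) by (intro ge) simp
        finally show ?thesis .
      qed
      then show ?thesis by (simp add: mult.assoc)
    qed
    then show ?thesis by blast
  qed
  then show ?thesis using c by blast
qed

end

theorem theorem14p1:
  fixes p :: "nat pmf"
  assumes finite_second_moment: "integrable (measure_pmf p) (\<lambda>k. (real k)\<^sup>2)"
    and mean_one: "measure_pmf.expectation p real = 1"
    and variance_pos: "measure_pmf.variance p real > 0"
  shows
    "(\<exists>c::real. c > 0 \<and>
       (\<forall>r::real. r \<ge> 1 \<longrightarrow>
         (\<exists>C::real. \<forall>i n::nat. i \<ge> 1 \<longrightarrow> n \<ge> 1 \<longrightarrow> gw_admissible p n \<longrightarrow>
           (\<integral>\<xi>. real (distance_profile (family_tree \<xi>) i) powr r \<partial>conditioned_gw p n)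
             \<le> C * real n powr (3 * r / 2) * exp (- c * (real i)\<^sup>2 / real n))))
     \<and>
     (\<forall>r::nat. r \<ge> 1 \<longrightarrow> summable (\<lambda>k. real k ^ (1 + r) * pmf p k) \<longrightarrow>
         (\<exists>C::real. \<forall>i n::nat. i \<ge> 1 \<longrightarrow> n \<ge> 1 \<longrightarrow> gw_admissible p n \<longrightarrow>
           (\<integral>\<xi>. real (distance_profile (family_tree \<xi>) i) ^ r \<partial>conditioned_gw p n)
             \<le> C * real i ^ r * real n ^ r))
     \<and>
     (\<exists>c::real. c > 0 \<and>
       (\<forall>r::nat. r \<ge> 1 \<longrightarrow> summable (\<lambda>k. real k ^ (1 + r) * pmf p k) \<longrightarrow>
         (\<exists>C::real. \<forall>i n::nat. i \<ge> 1 \<longrightarrow> n \<ge> 1 \<longrightarrow> gw_admissible p n \<longrightarrow>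
           (\<integral>\<xi>. real (distance_profile (family_tree \<xi>) i) ^ r \<partial>conditioned_gw p n)
             \<le> C * real i ^ r * real n ^ r * exp (- c * (real i)\<^sup>2 / real n))))"
proof -
  interpret critical_offspring p
    by unfold_locales (fact finite_second_moment mean_one variance_pos)+
  show ?thesis
  proof (intro conjI allI impI)
    fix r :: nat assume "r \<ge> 1" "summable (\<lambda>k. real k ^ (1 + r) * pmf p k)"
    from profile_moments_linear[OF this] show "\<exists>C::real. \<forall>i n::nat. i \<ge> 1 \<longrightarrow> n \<ge> 1 \<longrightarrow> gw_admissible p n \<longrightarrow>
        (\<integral>\<xi>. real (distance_profile (family_tree \<xi>) i) ^ r \<partial>conditioned_gw p n)
          \<le> C * real i ^ r * real n ^ r"
      by (elim exE conjE) (rule exI)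
  qed (fact profile_moments_gaussian profile_moments_linear_gaussian)+
qed

end
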